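(* Let $B\#_{\sigma}H$ be a crossed product of an algebra $B$ and a Hopf algebra $H$ (with $H$ measuring $B$ via $\triangleright$ and with $\sigma:H\otimes H\to B$), where the image of $\sigma$ belongs to the centre of $B$, and suppose that the action of $H$ on $B$ is trivial, i.e. $h\triangleright b=\epsilon(h)b$ for all $h\in H$ and $b\in B$. Let $\mathcal{C}(B\#H,H)$ and $\mathcal{C}(B\#_\sigma H,H)$ be the Ehresmann–Schauenburg bialgebroids of the Hopf Galois extensions $B\subseteq B\#H$ and $B\subseteq B\#_\sigma H$. Then there is an invertible normalised 2-cocycle $\tilde\sigma$ on $\mathcal{C}(B\#H,H)$ such that $\phi:\mathcal{C}(B\#H,H)^{\tilde\sigma}\to\mathcal{C}(B\#_\sigma H,H)$ is an isomorphism of left $B$-bialgebroids, where, for all $b,b',c,c'\in B$ and $h,g\in H$, $\tilde\sigma$ is given by $$\tilde{\sigma}\big(b\#h_{(1)}\otimes b'\#S(h_{(2)}),\; c\#g_{(1)}\otimes c'\#S(g_{(2)})\big)=b\,(h_{(1)}\triangleright c)\,\sigma(h_{(2)},g_{(1)})\,\big((h_{(3)}g_{(2)})\triangleright c'\big)\,(h_{(4)}\triangleright b')$$ and $\phi$ is given by $$\phi\big(b\#h_{(1)}\otimes b'\#S(h_{(2)})\big)=b\#_\sigma h_{(1)}\otimes b'\sigma^{-1}(S(h_{(3)}),h_{(4)})\#_\sigma S(h_{(2)}).$$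
   Context: All algebras (unital, associative), modules and comodules are vector spaces over $\mathbb{C}$. $H$ is a Hopf algebra with coproduct $\Delta(h)=h_{(1)}\otimes h_{(2)}$ (sumless Sweedler notation), counit $\epsilon$, antipode $S$; it is not assumed cocommutative. Coactions are written $\delta(a)=a_{(0)}\otimes a_{(1)}$. Crossed product. $H$ measures an algebra $B$ if there is a linear map $H\otimes B\to B$, $h\otimes b\mapsto h\triangleright b$, with $h\triangleright 1=\epsilon(h)1$ and $h\triangleright(bb')=(h_{(1)}\triangleright b)(h_{(2)}\triangleright b')$. Let $\sigma:H\otimes H\to B$ be a convolution invertible linear map with convolution inverse $\sigma^{-1}$, such that for all $h,k,m\in H$, $b\in B$: (1) $1\triangleright b=b$; (2) $h\triangleright(k\triangleright b)=\sigma(h_{(1)},k_{(1)})(h_{(2)}k_{(2)}\triangleright b)\sigma^{-1}(h_{(3)},k_{(3)})$; (3) $\sigma(h,1)=\sigma(1,h)=\epsilon(h)1$; (4) $(h_{(1)}\triangleright\sigma(k_{(1)},m_{(1)}))\sigma(h_{(2)},k_{(2)}m_{(2)})=\sigma(h_{(1)},k_{(1)})\sigma(h_{(2)}k_{(2)},m)$. The crossed product $B\#_\sigma H$ is the vector space $B\otimes H$ (with $b\#_\sigma h:=b\otimes h$) with product $(b\#_\sigma h)(b'\#_\sigma h')=b(h_{(1)}\triangleright b')\sigma(h_{(2)},h'_{(1)})\#_\sigma h_{(3)}h'_{(2)}$ and unit $1\#_\sigma 1$. It is a right $H$-comodule algebra via $b\#_\sigma h\mapsto b\#_\sigma h_{(1)}\otimes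 h_{(2)}$, with coinvariant subalgebra $B$ (identified with $B\#_\sigma 1$). The smash product $B\#H$ is the vector space $B\otimes H$ with product $(b\#h)(b'\#g)=b(h_{(1)}\triangleright b')\#h_{(2)}g$ for the same $\triangleright$ (the crossed product for the trivial cocycle $\epsilon\otimes\epsilon$); for the trivial action it is the tensor product algebra. Hopf Galois extensions. For a right $H$-comodule algebra $A$ with $B=A^{coH}=\{b\in A:\delta(b)=b\otimes 1_H\}$, the extension $B\subseteq A$ is Hopf Galois if $\chi:A\otimes_BA\to A\otimes H$, $a\otimes_Ba'\mapsto aa'_{(0)}\otimes a'_{(1)}$ is bijective; $A$ is always assumed faithfully flat as a left $B$-module. The translation map is $\tau(h)=\chi^{-1}(1\otimes h)$. The extension $B\subseteq B\#_\sigma H$ is Hopf Galois with $\tau(h)=\sigma^{-1}(S(h_{(2)}),h_{(3)})\#_\sigma S(h_{(1)})\otimes_B1\#_\sigma h_{(4)}$; in particular for $B\#H$ one has $\tau(h)=1\#S(h_{(1)})\otimes_B1\#h_{(2)}$. Ehresmann–Schauenburg bialgebroid. For a Hopf Galois extension $B=A^{coH}\subseteq A$, $\mathcal{C}(A,H)=\{a\otimes\tilde a\in A\otimes A: a_{(0)}\otimes\tau(a_{(1)})\tilde a=a\otimes\tilde a\otimes_B1\}$ (summation over simple tensors suppressed), equivalently the elements of $A\otimes A$ coinvariant for the diagonal coaction. It is a left $B$-bialgebroid with product $(a\otimes\tilde a)(a'\otimes\tilde a')=aa'\otimes\tilde a'\tilde a$, source $s(b)=b\otimes1$, target $t(b)=1\otimes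 b$, coproduct $\Delta(a\otimes\tilde a)=a_{(0)}\otimes\tau(a_{(1)})\otimes\tilde a$, counit $\epsilon(a\otimes\tilde a)=a\tilde a$. The space $\mathcal{C}(B\#H,H)$ is spanned by the elements $b\#h_{(1)}\otimes b'\#S(h_{(2)})$ with $b,b'\in B$, $h\in H$. Left bialgebroids. A left $B$-bialgebroid $\mathcal{L}$ is an algebra with an algebra map $\eta:B\otimes B^{op}\to\mathcal{L}$, with source $s=\eta(\cdot\otimes1)$ and target $t=\eta(1\otimes\cdot)$ (having commuting ranges), together with a $B$-coring structure $(\Delta,\epsilon)$ for the bimodule structure $b\triangleright a\triangleleft b'=s(b)t(b')a$, such that $\Delta$ corestricts to an algebra map into $\mathcal{L}\times_B\mathcal{L}=\{\sum a_i\otimes_Ba_i':\sum a_it(b)\otimes_Ba_i'=\sum a_i\otimes_Ba_i's(b)\ \forall b\in B\}$ (with factorwise product), and $\epsilon(1)=1$, $\epsilon(s(b)a)=b\epsilon(a)$, $\epsilon(as(\epsilon(a')))=\epsilon(aa')=\epsilon(at(\epsilon(a')))$. Write $\Delta(a)=a_{(1)}\otimes_Ba_{(2)}$. Morphisms of left $B$-bialgebroids are $B$-coring maps (bimodule maps compatible with $\Delta$ and $\epsilon$) that are also algebra maps. 2-cocycles and twists. $\mathcal{L}\otimes_{B\otimes B^{op}}\mathcal{L}$ is the tensor product balanced via $\eta$ (i.e. $a\eta(x)\otimes a'=a\otimes\eta(x)a'$), with $B$-bimodule structure $b\triangleright(a\otimes a')\triangleleft b'=s(b)t(b')a\otimes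 a'$. ${}_B\mathrm{Hom}_B(\mathcal{L}\otimes_{B\otimes B^{op}}\mathcal{L},B)$ is an algebra under the convolution $(f\star g)(a,a')=f(a_{(1)},a'_{(1)})g(a_{(2)},a'_{(2)})$ with unit $a\otimes a'\mapsto\epsilon(aa')$. An invertible normalised 2-cocycle on $\mathcal{L}$ is a convolution invertible element $\tilde\sigma$ of this algebra such that for all $a,a',a''\in\mathcal{L}$, $b,b'\in B$: (1) $\tilde\sigma(s(b)t(b')a,a')=b\tilde\sigma(a,a')b'$; (2) $\tilde\sigma(a,s(\tilde\sigma(a'_{(1)},a''_{(1)}))a'_{(2)}a''_{(2)})=\tilde\sigma(s(\tilde\sigma(a_{(1)},a'_{(1)}))a_{(2)}a'_{(2)},a'')$; (3) $\tilde\sigma(1,a)=\epsilon(a)=\tilde\sigma(a,1)$. The twist $\mathcal{L}^{\tilde\sigma}$ is the left $B$-bialgebroid with the same underlying $B$-coring as $\mathcal{L}$ and product $a\cdot_{\tilde\sigma}a'=s(\tilde\sigma(a_{(1)},a'_{(1)}))\,t(\tilde\sigma^{-1}(a_{(3)},a'_{(3)}))\,a_{(2)}a'_{(2)}$. *)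

theory Defs
  imports Complex_Main "HOL-Library.Poly_Mapping"
begin

section \<open>Complex vector spaces and algebras\<close>

class complex_vector = ab_group_add +
  fixes scaleC :: "complex \<Rightarrow> 'a \<Rightarrow> 'a"  (infixr "*\<^sub>C" 75)
  assumes scaleC_add_right: "c *\<^sub>C (x + y) = c *\<^sub>C x + c *\<^sub>C y"
    and scaleC_add_left: "(c + d) *\<^sub>C x = c *\<^sub>C x + d *\<^sub>C x"
    and scaleC_scaleC: "c *\<^sub>C d *\<^sub>C x = (c * d) *\<^sub>C x"
    and scaleC_one: "1 *\<^sub>C x = x"

text \<open>Unital associative algebras; \<open>ring_1\<close> is avoided because it excludes the zero algebra.\<close>

class complex_algebra = complex_vector + ring + monoid_mult +
  assumes mult_scaleC_left: "(c *\<^sub>C x) * y = c *\<^sub>C (x * y)"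
    and mult_scaleC_right: "x * (c *\<^sub>C y) = c *\<^sub>C (x * y)"

global_interpretation cvec: vector_space "scaleC :: complex \<Rightarrow> 'a \<Rightarrow> 'a :: complex_vector"
  defines cspan = cvec.span and csubspace = cvec.subspace
  by unfold_locales (simp_all add: scaleC_add_right scaleC_add_left scaleC_scaleC scaleC_one)

abbreviation clinear :: "('a::complex_vector \<Rightarrow> 'b::complex_vector) \<Rightarrow> bool"
  where "clinear \<equiv> Vector_Spaces.linear scaleC scaleC"

definition cbilinear ::
    "('a::complex_vector \<Rightarrow> 'b::complex_vector \<Rightarrow> 'c::complex_vector) \<Rightarrow> bool"
  where "cbilinear f \<longleftrightarrow> (\<forall>x. clinear (f x)) \<and> (\<forall>y. clinear (\<lambda>x. f x y))"

lemma clinearI: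
  assumes "\<And>x y. f (x + y) = f x + f y" and "\<And>c x. f (c *\<^sub>C x) = c *\<^sub>C f x"
  shows "clinear f"
  using assms by unfold_locales auto

lemma clinear_add: "clinear f \<Longrightarrow> f (x + y) = f x + f y"
  using module_hom.add[of scaleC scaleC f] by (simp add: module_hom_iff_linear)

lemma clinear_scaleC: "clinear f \<Longrightarrow> f (c *\<^sub>C x) = c *\<^sub>C f x"
  by (rule module_hom.scale) (simp add: module_hom_iff_linear)

lemma clinear_zero: "clinear f \<Longrightarrow> f 0 = 0"
  using clinear_add[of f 0 0] by simp

lemma clinear_diff: "clinear f \<Longrightarrow> f (x - y) = f x - f y"
  using clinear_add[of f "x - y" y] by (simp add: algebra_simps)

instantiation complex :: complex_algebra
begin
definition scaleC_complex :: "complex \<Rightarrow> complex \<Rightarrow> complex"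
  where "scaleC_complex = (*)"
instance
  by standard (simp_all add: scaleC_complex_def algebra_simps)
end

instantiation poly_mapping :: (type, complex_vector) complex_vector
begin
definition scaleC_poly_mapping :: "complex \<Rightarrow> ('a \<Rightarrow>\<^sub>0 'b) \<Rightarrow> ('a \<Rightarrow>\<^sub>0 'b)"
  where "scaleC_poly_mapping c = Poly_Mapping.map (scaleC c)"
lemma lookup_scaleC:
  "Poly_Mapping.lookup (c *\<^sub>C p) k = c *\<^sub>C Poly_Mapping.lookup (p :: 'a \<Rightarrow>\<^sub>0 'b) k"
  by (simp add: scaleC_poly_mapping_def map.rep_eq when_def)
instance
  by standard
    (simp_all add: poly_mapping_eq_iff fun_eq_iff lookup_scaleC lookup_add
       scaleC_add_right scaleC_add_left scaleC_scaleC scaleC_one)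
end

section \<open>The tensor product over the complex numbers\<close>

abbreviation formal :: "'a \<Rightarrow> 'b \<Rightarrow> ('a \<times> 'b) \<Rightarrow>\<^sub>0 complex"
  where "formal x y \<equiv> Poly_Mapping.single (x, y) 1"

definition tensor_relators :: "(('a::complex_vector \<times> 'b::complex_vector) \<Rightarrow>\<^sub>0 complex) set"
  where "tensor_relators =
      {formal (x + x') y - formal x y - formal x' y | x x' y. True}
    \<union> {formal x (y + y') - formal x y - formal x y' | x y y'. True}
    \<union> {formal (c *\<^sub>C x) y - c *\<^sub>C formal x y | c x y. True}
    \<union> {formal x (c *\<^sub>C y) - c *\<^sub>C formal x y | c x y. True}"

definition tensor_eq where "tensor_eq p q \<longleftrightarrow> p - q \<in> cspan tensor_relators"

lemma tensor_eq_refl: "tensor_eq p p"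
  by (simp add: tensor_eq_def cvec.span_zero)

lemma tensor_eq_sym: "tensor_eq p q \<Longrightarrow> tensor_eq q p"
  unfolding tensor_eq_def using cvec.span_neg by fastforce

lemma tensor_eq_trans: "tensor_eq p q \<Longrightarrow> tensor_eq q r \<Longrightarrow> tensor_eq p r"
  unfolding tensor_eq_def using cvec.span_add by fastforce

quotient_type (overloaded) ('a, 'b) tensor (infixr "\<otimes>" 20) =
    "(('a::complex_vector \<times> 'b::complex_vector) \<Rightarrow>\<^sub>0 complex)" / tensor_eq
  by (intro equivpI reflpI sympI transpI)
    (blast intro: tensor_eq_refl tensor_eq_sym tensor_eq_trans)+

instantiation tensor :: (complex_vector, complex_vector) complex_vector
begin

lift_definition zero_tensor :: "'a \<otimes> 'b" is 0 .

lift_definition plus_tensor :: "('a \<otimes> 'b) \<Rightarrow> ('a \<otimes> 'b) \<Rightarrow> ('a \<otimes> 'b)" is plus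
  unfolding tensor_eq_def add_diff_add by (rule cvec.span_add)

lift_definition uminus_tensor :: "('a \<otimes> 'b) \<Rightarrow> ('a \<otimes> 'b)" is uminus
  unfolding tensor_eq_def minus_diff_minus by (rule cvec.span_neg)

lift_definition minus_tensor :: "('a \<otimes> 'b) \<Rightarrow> ('a \<otimes> 'b) \<Rightarrow> ('a \<otimes> 'b)" is minus
proof -
  fix p p' q q' :: "('a \<times> 'b) \<Rightarrow>\<^sub>0 complex"
  assume "tensor_eq p p'" and "tensor_eq q q'"
  moreover have "(p - q) - (p' - q') = (p - p') - (q - q')" by (simp add: algebra_simps)
  ultimately show "tensor_eq (p - q) (p' - q')" by (simp only: tensor_eq_def cvec.span_diff)
qed

lift_definition scaleC_tensor :: "complex \<Rightarrow> ('a \<otimes> 'b) \<Rightarrow> ('a \<otimes> 'b)" is scaleC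
  unfolding tensor_eq_def cvec.scale_right_diff_distrib[symmetric] by (rule cvec.span_scale)

instance
  by standard (transfer; simp add: tensor_eq_refl scaleC_add_right scaleC_add_left
      scaleC_scaleC scaleC_one algebra_simps)+

end

lift_definition tensor :: "'a::complex_vector \<Rightarrow> 'b::complex_vector \<Rightarrow> 'a \<otimes> 'b"
  (infixr "\<otimes>" 68) is formal .

lemma tensor_relatorsI:
  "formal (x + x') y - formal x y - formal x' y \<in> tensor_relators"
  "formal x (y + y') - formal x y - formal x y' \<in> tensor_relators"
  "formal (c *\<^sub>C x) y - c *\<^sub>C formal x y \<in> tensor_relators"
  "formal x (c *\<^sub>C y) - c *\<^sub>C formal x y \<in> tensor_relators"
  unfolding tensor_relators_def by blast+

lemma cbilinear_tensor: "cbilinear tensor"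
  unfolding cbilinear_def
  by (intro conjI allI clinearI; transfer; unfold tensor_eq_def)
    (simp_all only: tensor_relatorsI diff_diff_eq[symmetric] cvec.span_base)

lemmas tensor_add_right = clinear_add[OF cbilinear_tensor[unfolded cbilinear_def, THEN conjunct1, rule_format]]
lemmas tensor_scaleC_right = clinear_scaleC[OF cbilinear_tensor[unfolded cbilinear_def, THEN conjunct1, rule_format]]
lemmas tensor_add_left = clinear_add[OF cbilinear_tensor[unfolded cbilinear_def, THEN conjunct2, rule_format]]
lemmas tensor_scaleC_left = clinear_scaleC[OF cbilinear_tensor[unfolded cbilinear_def, THEN conjunct2, rule_format]]

text \<open>
  Maps out of a tensor product are written with finite lists of simple tensors, as in Sweedler
  notation: \<open>\<Sum>(x, y)\<leftarrow>simple t. f x y\<close> is the value at \<open>t\<close> of the linear map induced by the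
  bilinear map \<open>f\<close>. By \<open>simple_cong\<close> it does not depend on the chosen list.
\<close>

definition simple :: "('a::complex_vector \<otimes> 'b::complex_vector) \<Rightarrow> ('a \<times> 'b) list"
  where "simple t = (SOME xs. (\<Sum>(x, y)\<leftarrow>xs. x \<otimes> y) = t)"

lemma ex_simple: "\<exists>xs. (\<Sum>(x, y)\<leftarrow>xs. x \<otimes> y) = t"
proof (induction t rule: tensor.abs_induct)
  case (1 p)
  show ?case
  proof (induction p rule: update_induct)
    case const
    show ?case by (intro exI[of _ "[]"]) (simp add: zero_tensor_def)
  next
    case (update p k c)
    obtain x y where k: "k = (x, y)" by fastforce
    have "Poly_Mapping.update k c p = c *\<^sub>C formal x y + p"
      using update(1)
      by (auto simp: k poly_mapping_eq_iff fun_eq_iff lookup_scaleC lookup_add lookup_update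
          lookup_single when_def scaleC_complex_def in_keys_iff)
    then have *: "abs_tensor (Poly_Mapping.update k c p) = (c *\<^sub>C x) \<otimes> y + abs_tensor p"
      by (simp only: tensor_scaleC_left plus_tensor.abs_eq[symmetric] scaleC_tensor.abs_eq[symmetric]
          tensor.abs_eq[symmetric])
    obtain xs where "(\<Sum>(x, y)\<leftarrow>xs. x \<otimes> y) = abs_tensor p" using update(3) by blast
    then show ?case unfolding * by (intro exI[of _ "(c *\<^sub>C x, y) # xs"]) simp
  qed
qed

lemma sum_simple [simp]: "(\<Sum>(x, y)\<leftarrow>simple t. x \<otimes> y) = t"
  unfolding simple_def by (rule someI_ex) (rule ex_simple)

definition formal_eval ::
    "('a \<Rightarrow> 'b \<Rightarrow> 'c::complex_vector) \<Rightarrow> (('a \<times> 'b) \<Rightarrow>\<^sub>0 complex) \<Rightarrow> 'c"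
  where "formal_eval f p = (\<Sum>k\<in>Poly_Mapping.keys p. Poly_Mapping.lookup p k *\<^sub>C f (fst k) (snd k))"

lemma formal_eval_superset:
  assumes "finite K" and "Poly_Mapping.keys p \<subseteq> K"
  shows "formal_eval f p = (\<Sum>k\<in>K. Poly_Mapping.lookup p k *\<^sub>C f (fst k) (snd k))"
  unfolding formal_eval_def
  by (rule sum.mono_neutral_left[OF assms]) (auto simp: in_keys_iff)

lemma clinear_formal_eval: "clinear (formal_eval f)"
proof (rule clinearI)
  fix p q :: "('a \<times> 'b) \<Rightarrow>\<^sub>0 complex" and c :: complex
  let ?K = "Poly_Mapping.keys p \<union> Poly_Mapping.keys q"
  show "formal_eval f (p + q) = formal_eval f p + formal_eval f q"
    using formal_eval_superset[of ?K p f] formal_eval_superset[of ?K q f]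
      formal_eval_superset[of ?K "p + q" f] Poly_Mapping.keys_add[of p q]
    by (simp add: lookup_add scaleC_add_left sum.distrib)
  have "Poly_Mapping.keys (c *\<^sub>C p) \<subseteq> Poly_Mapping.keys p"
    by (auto simp: in_keys_iff lookup_scaleC)
  then show "formal_eval f (c *\<^sub>C p) = c *\<^sub>C formal_eval f p"
    using formal_eval_superset[of "Poly_Mapping.keys p" "c *\<^sub>C p" f]
    by (simp add: lookup_scaleC formal_eval_def cvec.scale_sum_right scaleC_complex_def)
qed

lemma formal_eval_formal [simp]: "formal_eval f (formal x y) = f x y"
  by (simp add: formal_eval_def)

lemma formal_eval_cong:
  assumes "cbilinear f" and "tensor_eq p q"
  shows "formal_eval f p = formal_eval f q"
proof -
  note lin = assms(1)[unfolded cbilinear_def, THEN conjunct1, rule_format]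
    assms(1)[unfolded cbilinear_def, THEN conjunct2, rule_format]
  have "formal_eval f r = 0" if "r \<in> cspan tensor_relators" for r
    using that
  proof (induction rule: cvec.span_induct_alt)
    case base
    show ?case by (rule clinear_zero[OF clinear_formal_eval])
  next
    case (step c x y)
    have "formal_eval f x = 0"
      using step(1) unfolding tensor_relators_def
      by (auto simp: clinear_diff[OF clinear_formal_eval] clinear_scaleC[OF clinear_formal_eval]
          clinear_add[OF lin(1)] clinear_scaleC[OF lin(1)]
          clinear_add[OF lin(2)] clinear_scaleC[OF lin(2)])
    then show ?case
      by (simp add: clinear_add[OF clinear_formal_eval] clinear_scaleC[OF clinear_formal_eval] step)
  qed
  then show ?thesis
    using assms(2) unfolding tensor_eq_def
    by (metis clinear_diff[OF clinear_formal_eval] eq_iff_diff_eq_0)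
qed

lemma simple_cong:
  assumes "cbilinear f" and "(\<Sum>(x, y)\<leftarrow>xs. x \<otimes> y) = (\<Sum>(x, y)\<leftarrow>ys. x \<otimes> y)"
  shows "(\<Sum>(x, y)\<leftarrow>xs. f x y) = (\<Sum>(x, y)\<leftarrow>ys. f x y)"
proof -
  have sum: "(\<Sum>(x, y)\<leftarrow>zs. x \<otimes> y) = abs_tensor (\<Sum>(x, y)\<leftarrow>zs. formal x y)" for zs :: "('a \<times> 'b) list"
    by (induction zs) (auto simp: zero_tensor_def plus_tensor.abs_eq tensor.abs_eq)
  have eval: "formal_eval f (\<Sum>(x, y)\<leftarrow>zs. formal x y) = (\<Sum>(x, y)\<leftarrow>zs. f x y)" for zs
    by (induction zs)
      (auto simp: clinear_zero[OF clinear_formal_eval] clinear_add[OF clinear_formal_eval])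
  show ?thesis
    using assms(2) formal_eval_cong[OF assms(1)] unfolding sum eval[symmetric]
    by (simp add: tensor.abs_eq_iff)
qed

text \<open>The product of \<open>A \<otimes> A\<^sup>o\<^sup>p\<close>, for the product \<open>m\<close> of \<open>A\<close>.\<close>

definition env_mult :: "('a::complex_vector \<Rightarrow> 'a \<Rightarrow> 'a) \<Rightarrow> ('a \<otimes> 'a) \<Rightarrow> ('a \<otimes> 'a) \<Rightarrow> ('a \<otimes> 'a)"
  where "env_mult m w w' = (\<Sum>(a, a')\<leftarrow>simple w. \<Sum>(c, c')\<leftarrow>simple w'. m a c \<otimes> m c' a')"

text \<open>A quotient \<open>V / J\<close> by a subspace is represented by the set of cosets \<open>coset J v\<close>.\<close>

definition coset :: "'v::ab_group_add set \<Rightarrow> 'v \<Rightarrow> 'v set"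
  where "coset J v = {w. w - v \<in> J}"

section \<open>Hopf algebras and crossed products\<close>

definition sw2 :: "('h::complex_vector \<Rightarrow> 'h \<otimes> 'h) \<Rightarrow> 'h \<Rightarrow> ('h \<times> 'h) list"
  where "sw2 \<Delta> h = simple (\<Delta> h)"

definition sw3 :: "('h::complex_vector \<Rightarrow> 'h \<otimes> 'h) \<Rightarrow> 'h \<Rightarrow> ('h \<times> 'h \<times> 'h) list"
  where "sw3 \<Delta> h = [(h1, h2, h3). (h1, k) \<leftarrow> sw2 \<Delta> h, (h2, h3) \<leftarrow> sw2 \<Delta> k]"

definition sw4 :: "('h::complex_vector \<Rightarrow> 'h \<otimes> 'h) \<Rightarrow> 'h \<Rightarrow> ('h \<times> 'h \<times> 'h \<times> 'h) list"
  where "sw4 \<Delta> h = [(h1, h2, h3, h4). (h1, k) \<leftarrow> sw2 \<Delta> h, (h2, h3, h4) \<leftarrow> sw3 \<Delta> k]"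

locale hopf_algebra =
  fixes \<Delta> :: "'h::complex_algebra \<Rightarrow> 'h \<otimes> 'h"
    and \<epsilon> :: "'h \<Rightarrow> complex"
    and S :: "'h \<Rightarrow> 'h"
  assumes linear_comult: "clinear \<Delta>"
    and linear_counit: "clinear \<epsilon>"
    and linear_antipode: "clinear S"
    and coassoc: "(\<Sum>(x, y)\<leftarrow>sw2 \<Delta> h. \<Sum>(u, v)\<leftarrow>sw2 \<Delta> x. u \<otimes> v \<otimes> y)
      = (\<Sum>(x, y)\<leftarrow>sw2 \<Delta> h. \<Sum>(u, v)\<leftarrow>sw2 \<Delta> y. x \<otimes> u \<otimes> v)"
    and counit_left: "(\<Sum>(x, y)\<leftarrow>sw2 \<Delta> h. \<epsilon> x *\<^sub>C y) = h"
    and counit_right: "(\<Sum>(x, y)\<leftarrow>sw2 \<Delta> h. \<epsilon> y *\<^sub>C x) = h"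
    and comult_one: "\<Delta> 1 = 1 \<otimes> 1"
    and comult_mult: "\<Delta> (h * k) = (\<Sum>(x, y)\<leftarrow>sw2 \<Delta> h. \<Sum>(u, v)\<leftarrow>sw2 \<Delta> k. (x * u) \<otimes> (y * v))"
    and counit_one: "\<epsilon> 1 = 1"
    and counit_mult: "\<epsilon> (h * k) = \<epsilon> h * \<epsilon> k"
    and antipode_left: "(\<Sum>(x, y)\<leftarrow>sw2 \<Delta> h. S x * y) = \<epsilon> h *\<^sub>C 1"
    and antipode_right: "(\<Sum>(x, y)\<leftarrow>sw2 \<Delta> h. x * S y) = \<epsilon> h *\<^sub>C 1"

text \<open>
  The data of a crossed product: \<open>act h b\<close> is \<open>h \<triangleright> b\<close>; linear maps on \<open>H \<otimes> B\<close> and \<open>H \<otimes> H\<close>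
  are given as bilinear maps, and \<open>\<sigma>i\<close> is the convolution inverse of \<open>\<sigma>\<close>.
\<close>

locale crossed_system = hopf_algebra \<Delta> \<epsilon> S
  for \<Delta> :: "'h::complex_algebra \<Rightarrow> 'h \<otimes> 'h" and \<epsilon> :: "'h \<Rightarrow> complex" and S :: "'h \<Rightarrow> 'h" +
  fixes act :: "'h \<Rightarrow> 'b::complex_algebra \<Rightarrow> 'b"
    and \<sigma> \<sigma>i :: "'h \<Rightarrow> 'h \<Rightarrow> 'b"
  assumes act_bilinear: "cbilinear act"
    and act_unit: "act h 1 = \<epsilon> h *\<^sub>C 1"
    and act_mult: "act h (b * b') = (\<Sum>(h1, h2)\<leftarrow>sw2 \<Delta> h. act h1 b * act h2 b')"
    and sigma_bilinear: "cbilinear \<sigma>"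
    and sigma_inv_bilinear: "cbilinear \<sigma>i"
    and sigma_inv_right:
      "(\<Sum>(h1, h2)\<leftarrow>sw2 \<Delta> h. \<Sum>(k1, k2)\<leftarrow>sw2 \<Delta> k. \<sigma> h1 k1 * \<sigma>i h2 k2) = (\<epsilon> h * \<epsilon> k) *\<^sub>C 1"
    and sigma_inv_left:
      "(\<Sum>(h1, h2)\<leftarrow>sw2 \<Delta> h. \<Sum>(k1, k2)\<leftarrow>sw2 \<Delta> k. \<sigma>i h1 k1 * \<sigma> h2 k2) = (\<epsilon> h * \<epsilon> k) *\<^sub>C 1"
    and act_one: "act 1 b = b"
    and act_act: "act h (act k b) = (\<Sum>(h1, h2, h3)\<leftarrow>sw3 \<Delta> h. \<Sum>(k1, k2, k3)\<leftarrow>sw3 \<Delta> k.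
      \<sigma> h1 k1 * act (h2 * k2) b * \<sigma>i h3 k3)"
    and sigma_one_right: "\<sigma> h 1 = \<epsilon> h *\<^sub>C 1"
    and sigma_one_left: "\<sigma> 1 h = \<epsilon> h *\<^sub>C 1"
    and sigma_cocycle:
      "(\<Sum>(h1, h2)\<leftarrow>sw2 \<Delta> h. \<Sum>(k1, k2)\<leftarrow>sw2 \<Delta> k. \<Sum>(m1, m2)\<leftarrow>sw2 \<Delta> m.
          act h1 (\<sigma> k1 m1) * \<sigma> h2 (k2 * m2))
      = (\<Sum>(h1, h2)\<leftarrow>sw2 \<Delta> h. \<Sum>(k1, k2)\<leftarrow>sw2 \<Delta> k. \<sigma> h1 k1 * \<sigma> (h2 * k2) m)"

text \<open>
  A right \<open>H\<close>-comodule algebra \<open>A\<close> with an algebra \<open>B\<close> identified, along \<open>incl\<close>, with its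
  subalgebra of coinvariants.
\<close>

record (overloaded) ('a::complex_vector, 'b, 'h::complex_vector) extension =
  amul :: "'a \<Rightarrow> 'a \<Rightarrow> 'a"
  aone :: 'a
  coact :: "'a \<Rightarrow> 'a \<otimes> 'h"
  incl :: "'b \<Rightarrow> 'a"

definition coact_right ::
    "('h::complex_vector \<Rightarrow> 'h \<otimes> 'h) \<Rightarrow> ('b::complex_vector \<otimes> 'h) \<Rightarrow> ('b \<otimes> 'h) \<otimes> 'h"
  where "coact_right \<Delta> X = (\<Sum>(b, h)\<leftarrow>simple X. \<Sum>(h1, h2)\<leftarrow>sw2 \<Delta> h. (b \<otimes> h1) \<otimes> h2)"

definition crossed_product ::
    "('h::complex_algebra \<Rightarrow> 'h \<otimes> 'h) \<Rightarrow> ('h \<Rightarrow> 'b::complex_algebra \<Rightarrow> 'b) \<Rightarrow> ('h \<Rightarrow> 'h \<Rightarrow> 'b)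
      \<Rightarrow> ('b \<otimes> 'h, 'b, 'h) extension"
  where "crossed_product \<Delta> act \<sigma> =
    \<lparr>amul = (\<lambda>X Y. \<Sum>(b, h)\<leftarrow>simple X. \<Sum>(b', h')\<leftarrow>simple Y.
        \<Sum>(h1, h2, h3)\<leftarrow>sw3 \<Delta> h. \<Sum>(k1, k2)\<leftarrow>sw2 \<Delta> h'. (b * act h1 b' * \<sigma> h2 k1) \<otimes> (h3 * k2)),
     aone = 1 \<otimes> 1,
     coact = coact_right \<Delta>,
     incl = (\<lambda>b. b \<otimes> 1)\<rparr>"

definition smash_product ::
    "('h::complex_algebra \<Rightarrow> 'h \<otimes> 'h) \<Rightarrow> ('h \<Rightarrow> 'b::complex_algebra \<Rightarrow> 'b)
      \<Rightarrow> ('b \<otimes> 'h, 'b, 'h) extension"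
  where "smash_product \<Delta> act =
    \<lparr>amul = (\<lambda>X Y. \<Sum>(b, h)\<leftarrow>simple X. \<Sum>(b', g)\<leftarrow>simple Y.
        \<Sum>(h1, h2)\<leftarrow>sw2 \<Delta> h. (b * act h1 b') \<otimes> (h2 * g)),
     aone = 1 \<otimes> 1,
     coact = coact_right \<Delta>,
     incl = (\<lambda>b. b \<otimes> 1)\<rparr>"

section \<open>Left bialgebroids\<close>

text \<open>
  The underlying space of the bialgebroid is a subspace \<open>lcar\<close> of the ambient type \<open>'l\<close>. The
  coproduct takes values in \<open>L \<otimes>\<^sub>B L\<close>, whose elements are cosets in \<open>'l \<otimes> 'l\<close>.
\<close>

record (overloaded) ('l::complex_vector, 'b::complex_vector) env_ring =
  lcar :: "'l set"
  lmul :: "'l \<Rightarrow> 'l \<Rightarrow> 'l"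
  lone :: 'l
  leta :: "('b \<otimes> 'b) \<Rightarrow> 'l"

record (overloaded) ('l::complex_vector, 'b::complex_vector) bialgebroid = "('l, 'b) env_ring" +
  lcop :: "'l \<Rightarrow> ('l \<otimes> 'l) set"
  lcou :: "'l \<Rightarrow> 'b"

definition src :: "('l::complex_vector, 'b::complex_algebra, 'm) env_ring_scheme \<Rightarrow> 'b \<Rightarrow> 'l"
  where "src L b = leta L (b \<otimes> 1)"

definition tgt :: "('l::complex_vector, 'b::complex_algebra, 'm) env_ring_scheme \<Rightarrow> 'b \<Rightarrow> 'l"
  where "tgt L b = leta L (1 \<otimes> b)"

text \<open>
  With \<open>b \<triangleright> x \<triangleleft> b' = s(b) t(b') x\<close>, the space \<open>L \<otimes>\<^sub>B L\<close> is the quotient of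
  \<open>L \<otimes> L \<subseteq> 'l \<otimes> 'l\<close> by the span of all \<open>x \<triangleleft> b \<otimes> y - x \<otimes> b \<triangleright> y\<close>.
\<close>

definition bal :: "('l::complex_vector, 'b::complex_algebra, 'm) env_ring_scheme \<Rightarrow> ('l \<otimes> 'l) set"
  where "bal L = cspan {lmul L (tgt L b) x \<otimes> y - x \<otimes> lmul L (src L b) y
    | x y b. x \<in> lcar L \<and> y \<in> lcar L}"

definition bal3 ::
    "('l::complex_vector, 'b::complex_algebra, 'm) env_ring_scheme \<Rightarrow> ('l \<otimes> 'l \<otimes> 'l) set"
  where "bal3 L = cspan
      ({lmul L (tgt L b) x \<otimes> y \<otimes> z - x \<otimes> lmul L (src L b) y \<otimes> z
        | x y z b. x \<in> lcar L \<and> y \<in> lcar L \<and> z \<in> lcar L}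
     \<union> {x \<otimes> lmul L (tgt L b) y \<otimes> z - x \<otimes> y \<otimes> lmul L (src L b) z
        | x y z b. x \<in> lcar L \<and> y \<in> lcar L \<and> z \<in> lcar L})"

definition btensor ::
    "('l::complex_vector, 'b::complex_algebra, 'm) env_ring_scheme \<Rightarrow> ('l \<otimes> 'l) set set"
  where "btensor L = coset (bal L) ` cspan {x \<otimes> y | x y. x \<in> lcar L \<and> y \<in> lcar L}"

text \<open>Sweedler notation in \<open>L\<close>: a representative of \<open>\<Delta>(a)\<close> by simple tensors of elements of \<open>L\<close>.\<close>

definition csw2 :: "('l::complex_vector, 'b::complex_vector) bialgebroid \<Rightarrow> 'l \<Rightarrow> ('l \<times> 'l) list"
  where "csw2 L a = (SOME xs. set xs \<subseteq> lcar L \<times> lcar L \<and> (\<Sum>(x, y)\<leftarrow>xs. x \<otimes> y) \<in> lcop L a)"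

definition csw3 :: "('l::complex_vector, 'b::complex_vector) bialgebroid \<Rightarrow> 'l \<Rightarrow> ('l \<times> 'l \<times> 'l) list"
  where "csw3 L a = [(x, y, z). (x, w) \<leftarrow> csw2 L a, (y, z) \<leftarrow> csw2 L w]"

text \<open>
  Identities in \<open>L \<otimes>\<^sub>B L\<close> and \<open>L \<otimes>\<^sub>B L \<otimes>\<^sub>B L\<close> are stated for representatives, modulo the
  balancing relations. Complex linearity of \<open>\<Delta>\<close> and \<open>\<epsilon>\<close> is contained in \<open>B\<close>-bilinearity, as
  \<open>c *\<^sub>C a = s(c *\<^sub>C 1) a\<close>.
\<close>

locale left_bialgebroid =
  fixes L :: "('l::complex_vector, 'b::complex_algebra) bialgebroid"
  assumes car_subspace: "csubspace (lcar L)"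
    and mul_closed: "\<lbrakk>x \<in> lcar L; y \<in> lcar L\<rbrakk> \<Longrightarrow> lmul L x y \<in> lcar L"
    and one_closed: "lone L \<in> lcar L"
    and mul_add_left: "\<lbrakk>x \<in> lcar L; y \<in> lcar L; z \<in> lcar L\<rbrakk>
      \<Longrightarrow> lmul L (x + y) z = lmul L x z + lmul L y z"
    and mul_add_right: "\<lbrakk>x \<in> lcar L; y \<in> lcar L; z \<in> lcar L\<rbrakk>
      \<Longrightarrow> lmul L x (y + z) = lmul L x y + lmul L x z"
    and mul_scale_left: "\<lbrakk>x \<in> lcar L; y \<in> lcar L\<rbrakk> \<Longrightarrow> lmul L (c *\<^sub>C x) y = c *\<^sub>C lmul L x y"
    and mul_scale_right: "\<lbrakk>x \<in> lcar L; y \<in> lcar L\<rbrakk> \<Longrightarrow> lmul L x (c *\<^sub>C y) = c *\<^sub>C lmul L x y"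
    and mul_assoc: "\<lbrakk>x \<in> lcar L; y \<in> lcar L; z \<in> lcar L\<rbrakk>
      \<Longrightarrow> lmul L (lmul L x y) z = lmul L x (lmul L y z)"
    and mul_one_left: "x \<in> lcar L \<Longrightarrow> lmul L (lone L) x = x"
    and mul_one_right: "x \<in> lcar L \<Longrightarrow> lmul L x (lone L) = x"
    and eta_closed: "leta L p \<in> lcar L"
    and eta_linear: "clinear (leta L)"
    and eta_one: "leta L (1 \<otimes> 1) = lone L"
    and eta_mult: "leta L (env_mult (*) p q) = lmul L (leta L p) (leta L q)"
    and cop_closed: "a \<in> lcar L \<Longrightarrow> lcop L a \<in> btensor L"
    and cop_add: "\<lbrakk>a \<in> lcar L; a' \<in> lcar L\<rbrakk>
      \<Longrightarrow> (\<Sum>(x, y)\<leftarrow>csw2 L a. x \<otimes> y) + (\<Sum>(x, y)\<leftarrow>csw2 L a'. x \<otimes> y) \<in> lcop L (a + a')"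
    and cop_bimodule: "a \<in> lcar L
      \<Longrightarrow> (\<Sum>(x, y)\<leftarrow>csw2 L a. lmul L (src L b) x \<otimes> lmul L (tgt L b') y)
          \<in> lcop L (lmul L (src L b) (lmul L (tgt L b') a))"
    and cou_add: "\<lbrakk>a \<in> lcar L; a' \<in> lcar L\<rbrakk> \<Longrightarrow> lcou L (a + a') = lcou L a + lcou L a'"
    and cou_bimodule: "a \<in> lcar L
      \<Longrightarrow> lcou L (lmul L (src L b) (lmul L (tgt L b') a)) = b * lcou L a * b'"
    and cop_coassoc: "a \<in> lcar L
      \<Longrightarrow> (\<Sum>(x, y)\<leftarrow>csw2 L a. \<Sum>(u, v)\<leftarrow>csw2 L x. u \<otimes> v \<otimes> y)
        - (\<Sum>(x, y)\<leftarrow>csw2 L a. \<Sum>(u, v)\<leftarrow>csw2 L y. x \<otimes> u \<otimes> v) \<in> bal3 L"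
    and cou_left: "a \<in> lcar L \<Longrightarrow> (\<Sum>(x, y)\<leftarrow>csw2 L a. lmul L (src L (lcou L x)) y) = a"
    and cou_right: "a \<in> lcar L \<Longrightarrow> (\<Sum>(x, y)\<leftarrow>csw2 L a. lmul L (tgt L (lcou L y)) x) = a"
    and cop_takeuchi: "a \<in> lcar L
      \<Longrightarrow> (\<Sum>(x, y)\<leftarrow>csw2 L a. lmul L x (tgt L b) \<otimes> y)
        - (\<Sum>(x, y)\<leftarrow>csw2 L a. x \<otimes> lmul L y (src L b)) \<in> bal L"
    and cop_one: "lone L \<otimes> lone L \<in> lcop L (lone L)"
    and cop_mult: "\<lbrakk>a \<in> lcar L; a' \<in> lcar L\<rbrakk>
      \<Longrightarrow> (\<Sum>(x, y)\<leftarrow>csw2 L a. \<Sum>(x', y')\<leftarrow>csw2 L a'. lmul L x x' \<otimes> lmul L y y')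
          \<in> lcop L (lmul L a a')"
    and cou_one: "lcou L (lone L) = 1"
    and cou_src: "a \<in> lcar L \<Longrightarrow> lcou L (lmul L (src L b) a) = b * lcou L a"
    and cou_mult_src: "\<lbrakk>a \<in> lcar L; a' \<in> lcar L\<rbrakk>
      \<Longrightarrow> lcou L (lmul L a (src L (lcou L a'))) = lcou L (lmul L a a')"
    and cou_mult_tgt: "\<lbrakk>a \<in> lcar L; a' \<in> lcar L\<rbrakk>
      \<Longrightarrow> lcou L (lmul L a (tgt L (lcou L a'))) = lcou L (lmul L a a')"

locale bialgebroid_morphism = dom: left_bialgebroid L + cod: left_bialgebroid L'
  for L :: "('l::complex_vector, 'b::complex_algebra) bialgebroid"
    and L' :: "('k::complex_vector, 'b) bialgebroid" +
  fixes \<phi> :: "'l \<Rightarrow> 'k"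
  assumes mor_closed: "a \<in> lcar L \<Longrightarrow> \<phi> a \<in> lcar L'"
    and mor_add: "\<lbrakk>a \<in> lcar L; a' \<in> lcar L\<rbrakk> \<Longrightarrow> \<phi> (a + a') = \<phi> a + \<phi> a'"
    and mor_bimodule: "a \<in> lcar L
      \<Longrightarrow> \<phi> (lmul L (src L b) (lmul L (tgt L b') a))
        = lmul L' (src L' b) (lmul L' (tgt L' b') (\<phi> a))"
    and mor_cop: "a \<in> lcar L \<Longrightarrow> (\<Sum>(x, y)\<leftarrow>csw2 L a. \<phi> x \<otimes> \<phi> y) \<in> lcop L' (\<phi> a)"
    and mor_cou: "a \<in> lcar L \<Longrightarrow> lcou L' (\<phi> a) = lcou L a"
    and mor_one: "\<phi> (lone L) = lone L'"
    and mor_mult: "\<lbrakk>a \<in> lcar L; a' \<in> lcar L\<rbrakk> \<Longrightarrow> \<phi> (lmul L a a') = lmul L' (\<phi> a) (\<phi> a')"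

locale bialgebroid_isomorphism = bialgebroid_morphism L L' \<phi>
  for L :: "('l::complex_vector, 'b::complex_algebra) bialgebroid"
    and L' :: "('k::complex_vector, 'b) bialgebroid" and \<phi> :: "'l \<Rightarrow> 'k" +
  assumes mor_bij: "bij_betw \<phi> (lcar L) (lcar L')"

section \<open>Two-cocycles and twists\<close>

text \<open>
  An element of \<open>\<^sub>BHom\<^sub>B(L \<otimes> L, B)\<close>, the tensor product being over \<open>B \<otimes> B\<^sup>o\<^sup>p\<close>, is given as
  a balanced map of two arguments.
\<close>

definition bihom ::
    "('l::complex_vector, 'b::complex_algebra, 'm) env_ring_scheme \<Rightarrow> ('l \<Rightarrow> 'l \<Rightarrow> 'b) \<Rightarrow> bool"
  where "bihom L f \<longleftrightarrow>
    (\<forall>a\<in>lcar L. \<forall>a'\<in>lcar L. \<forall>a''\<in>lcar L.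
        f (a + a') a'' = f a a'' + f a' a'' \<and> f a (a' + a'') = f a a' + f a a'') \<and>
    (\<forall>a\<in>lcar L. \<forall>a'\<in>lcar L. \<forall>p. f (lmul L a (leta L p)) a' = f a (lmul L (leta L p) a')) \<and>
    (\<forall>a\<in>lcar L. \<forall>a'\<in>lcar L. \<forall>b b'.
        f (lmul L (src L b) (lmul L (tgt L b') a)) a' = b * f a a' * b')"

definition conv ::
    "('l::complex_vector, 'b::complex_algebra) bialgebroid \<Rightarrow> ('l \<Rightarrow> 'l \<Rightarrow> 'b) \<Rightarrow> ('l \<Rightarrow> 'l \<Rightarrow> 'b)
      \<Rightarrow> 'l \<Rightarrow> 'l \<Rightarrow> 'b"
  where "conv L f g a a' = (\<Sum>(x, y)\<leftarrow>csw2 L a. \<Sum>(x', y')\<leftarrow>csw2 L a'. f x x' * g y y')"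

definition conv_inverse ::
    "('l::complex_vector, 'b::complex_algebra) bialgebroid \<Rightarrow> ('l \<Rightarrow> 'l \<Rightarrow> 'b) \<Rightarrow> ('l \<Rightarrow> 'l \<Rightarrow> 'b)
      \<Rightarrow> bool"
  where "conv_inverse L f g \<longleftrightarrow> bihom L g \<and>
    (\<forall>a\<in>lcar L. \<forall>a'\<in>lcar L. conv L f g a a' = lcou L (lmul L a a')
      \<and> conv L g f a a' = lcou L (lmul L a a'))"

text \<open>The inverse is unique only on the underlying space of \<open>L\<close>, hence \<open>SOME\<close>.\<close>

definition conv_inv ::
    "('l::complex_vector, 'b::complex_algebra) bialgebroid \<Rightarrow> ('l \<Rightarrow> 'l \<Rightarrow> 'b) \<Rightarrow> 'l \<Rightarrow> 'l \<Rightarrow> 'b"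
  where "conv_inv L f = (SOME g. conv_inverse L f g)"

locale invertible_normalised_cocycle = left_bialgebroid L
  for L :: "('l::complex_vector, 'b::complex_algebra) bialgebroid" +
  fixes f :: "'l \<Rightarrow> 'l \<Rightarrow> 'b"
  assumes cocycle_bihom: "bihom L f"
    and cocycle_invertible: "\<exists>g. conv_inverse L f g"
    and cocycle: "\<lbrakk>a \<in> lcar L; a' \<in> lcar L; a'' \<in> lcar L\<rbrakk> \<Longrightarrow>
      f a (\<Sum>(x, y)\<leftarrow>csw2 L a'. \<Sum>(x', y')\<leftarrow>csw2 L a''. lmul L (src L (f x x')) (lmul L y y'))
      = f (\<Sum>(x, y)\<leftarrow>csw2 L a. \<Sum>(x', y')\<leftarrow>csw2 L a'. lmul L (src L (f x x')) (lmul L y y')) a''"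
    and cocycle_one_left: "a \<in> lcar L \<Longrightarrow> f (lone L) a = lcou L a"
    and cocycle_one_right: "a \<in> lcar L \<Longrightarrow> f a (lone L) = lcou L a"

definition twist ::
    "('l::complex_vector, 'b::complex_algebra) bialgebroid \<Rightarrow> ('l \<Rightarrow> 'l \<Rightarrow> 'b)
      \<Rightarrow> ('l, 'b) bialgebroid"
  where "twist L f = L\<lparr>lmul := (\<lambda>a a'. \<Sum>(x, y, z)\<leftarrow>csw3 L a. \<Sum>(x', y', z')\<leftarrow>csw3 L a'.
    lmul L (src L (f x x')) (lmul L (tgt L (conv_inv L f z z')) (lmul L y y')))\<rparr>"

section \<open>The Ehresmann--Schauenburg bialgebroid\<close>

text \<open>\<open>A \<otimes>\<^sub>B A\<close> is the quotient of \<open>A \<otimes> A\<close> by \<open>ext_bal E\<close>.\<close>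

definition ext_bal :: "('a::complex_vector, 'b, 'h::complex_vector) extension \<Rightarrow> ('a \<otimes> 'a) set"
  where "ext_bal E = cspan {amul E x (incl E b) \<otimes> y - x \<otimes> amul E (incl E b) y | x b y. True}"

text \<open>\<open>\<chi>(a \<otimes>\<^sub>B a') = a a'\<^sub>0 \<otimes> a'\<^sub>1\<close>, evaluated on a representative of the coset.\<close>

definition canonical_map ::
    "('a::complex_vector, 'b, 'h::complex_vector) extension \<Rightarrow> ('a \<otimes> 'a) set \<Rightarrow> 'a \<otimes> 'h"
  where "canonical_map E Z = (\<Sum>(a, a')\<leftarrow>simple (SOME z. z \<in> Z).
    \<Sum>(a0, a1)\<leftarrow>simple (coact E a'). amul E a a0 \<otimes> a1)"

text \<open>
  \<open>\<tau>(h) = \<chi>\<^sup>-\<^sup>1(1 \<otimes> h)\<close> as an element (coset) of \<open>A \<otimes>\<^sub>B A\<close>; meaningful when \<open>\<chi>\<close> is bijective, i.e. for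
  Hopf Galois extensions, in particular for crossed and smash products.
\<close>

definition translation ::
    "('a::complex_vector, 'b, 'h::complex_vector) extension \<Rightarrow> 'h \<Rightarrow> ('a \<otimes> 'a) set"
  where "translation E h = inv_into (range (coset (ext_bal E))) (canonical_map E) (aone E \<otimes> h)"

text \<open>A representative \<open>\<Sum> u \<otimes> v\<close> of \<open>\<tau>(h)\<close>.\<close>

definition tau ::
    "('a::complex_vector, 'b, 'h::complex_vector) extension \<Rightarrow> 'h \<Rightarrow> ('a \<times> 'a) list"
  where "tau E h = simple (SOME z. z \<in> translation E h)"

text \<open>
  The defining equation \<open>a\<^sub>0 \<otimes> \<tau>(a\<^sub>1)a' = a \<otimes> a' \<otimes>\<^sub>B 1\<close> holds in \<open>A \<otimes> (A \<otimes>\<^sub>B A)\<close>, the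
  quotient of \<open>A \<otimes> A \<otimes> A\<close> by \<open>A \<otimes> ext_bal E\<close>.
\<close>

definition es_carrier ::
    "('a::complex_vector, 'b, 'h::complex_vector) extension \<Rightarrow> ('a \<otimes> 'a) set"
  where "es_carrier E = {w.
    (\<Sum>(a, a')\<leftarrow>simple w. \<Sum>(a0, a1)\<leftarrow>simple (coact E a). \<Sum>(u, v)\<leftarrow>tau E a1. a0 \<otimes> u \<otimes> amul E v a')
    - (\<Sum>(a, a')\<leftarrow>simple w. a \<otimes> a' \<otimes> aone E)
    \<in> cspan {x \<otimes> z | x z. z \<in> ext_bal E}}"

definition es_env_ring ::
    "('a::complex_vector, 'b::complex_algebra, 'h::complex_vector) extension
      \<Rightarrow> ('a \<otimes> 'a, 'b) env_ring"
  where "es_env_ring E =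
    \<lparr>lcar = es_carrier E,
     lmul = env_mult (amul E),
     lone = aone E \<otimes> aone E,
     leta = (\<lambda>p. \<Sum>(b, b')\<leftarrow>simple p. incl E b \<otimes> incl E b')\<rparr>"

text \<open>
  \<open>\<Delta>(a \<otimes> a') = a\<^sub>0 \<otimes> \<tau>(a\<^sub>1) \<otimes> a'\<close> is a priori an element of \<open>A \<otimes> (A \<otimes>\<^sub>B A) \<otimes> A\<close>, that is, of
  the quotient of \<open>(A \<otimes> A) \<otimes> (A \<otimes> A)\<close> by \<open>es_middle_bal E\<close>. For a faithfully flat Hopf Galois
  extension \<open>L \<otimes>\<^sub>B L\<close> embeds there, and \<open>es_coproduct E w\<close> is the preimage in \<open>L \<otimes>\<^sub>B L\<close>.
\<close>

definition es_middle_bal ::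
    "('a::complex_vector, 'b, 'h::complex_vector) extension \<Rightarrow> (('a \<otimes> 'a) \<otimes> ('a \<otimes> 'a)) set"
  where "es_middle_bal E = cspan
    {(x \<otimes> amul E y (incl E b)) \<otimes> (x' \<otimes> y') - (x \<otimes> y) \<otimes> (amul E (incl E b) x' \<otimes> y')
      | x y b x' y'. True}"

definition es_coproduct ::
    "('a::complex_vector, 'b::complex_algebra, 'h::complex_vector) extension
      \<Rightarrow> 'a \<otimes> 'a \<Rightarrow> (('a \<otimes> 'a) \<otimes> ('a \<otimes> 'a)) set"
  where "es_coproduct E w = (THE Z. Z \<in> btensor (es_env_ring E) \<and>
    Z \<subseteq> coset (es_middle_bal E)
      (\<Sum>(a, a')\<leftarrow>simple w. \<Sum>(a0, a1)\<leftarrow>simple (coact E a). \<Sum>(u, v)\<leftarrow>tau E a1.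
        (a0 \<otimes> u) \<otimes> (v \<otimes> a')))"

definition es_bialgebroid ::
    "('a::complex_vector, 'b::complex_algebra, 'h::complex_vector) extension
      \<Rightarrow> ('a \<otimes> 'a, 'b) bialgebroid"
  where "es_bialgebroid E = env_ring.extend (es_env_ring E)
    \<lparr>lcop = es_coproduct E,
     lcou = (\<lambda>w. inv (incl E) (\<Sum>(a, a')\<leftarrow>simple w. amul E a a'))\<rparr>"

end

theory Submission
  imports Defs
begin

text \<open>
  As the action is trivial and \<open>\<sigma>\<close> is central, \<open>j h = 1 # h\<close> is a cleaving map of \<open>B #\<^sub>\<sigma> H\<close>
  that commutes with \<open>B\<close>; its convolution inverse is \<open>j\<^sup>-\<^sup>1 h = \<sigma>\<^sup>-\<^sup>1(S h\<^sub>2, h\<^sub>3) # S h\<^sub>1\<close>.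
  Therefore \<open>b \<otimes> b' \<otimes> h \<mapsto> b j(h\<^sub>1) \<otimes> b' j\<^sup>-\<^sup>1(h\<^sub>2)\<close> identifies \<open>B \<otimes> B \<otimes> H\<close> with the
  Ehresmann--Schauenburg bialgebroid. In this model the coring structure, the source and the
  target do not involve \<open>\<sigma>\<close>, and the product is \<open>(b, b', h) (c, c', g) = (b c \<sigma>(h\<^sub>1, g\<^sub>1),
  \<sigma>\<^sup>-\<^sup>1(h\<^sub>3, g\<^sub>3) c' b', h\<^sub>2 g\<^sub>2)\<close>. This is the product for the trivial cocycle, twisted by
  the map \<open>(b, b', h), (c, c', g) \<mapsto> b c \<sigma>(h, g) c' b'\<close>, so \<open>\<phi>\<close> is the composite of the two
  identifications.
\<close>

section \<open>Linear maps out of tensor products\<close>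

text \<open>Most notions in the statement rest on choices: lists of simple tensors, representatives
  of \<open>\<tau>(h)\<close> and of coproduct cosets, the convolution inverse in the twist. The
  obstacle is to show that no value depends on them. Tensor products over \<open>B\<close> are
  therefore replaced by linear tests with the right kernel: the canonical map for
  \<open>A \<otimes>\<^sub>B A\<close>, a normal form in the model for
  \<open>L \<otimes>\<^sub>B L\<close>. The definite description of the coproduct needs the passage
  from \<open>L \<otimes>\<^sub>B L\<close> to the quotient with balanced inner legs to be
  injective; this comes from an explicit linear left inverse of the identification, defined on all
  of \<open>A \<otimes> A\<close>. That \<open>j\<^sup>-\<^sup>1\<close> inverts \<open>j\<close>
  from the right is the one place where its formula needs the cocycle identity at antipode
  arguments, namely \<open>\<sigma>(h\<^sub>1, S h\<^sub>2) \<sigma>\<^sup>-\<^sup>1(S h\<^sub>3,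
  h\<^sub>4) = \<epsilon>(h)\<close>. The identification is proved once for an arbitrary central
  cocycle and used for \<open>\<sigma>\<close> and for the trivial one; the bialgebroid axioms are
  proved in the model and serve the twist as well.\<close>

definition tfold ::
    "('a::complex_vector \<otimes> 'b::complex_vector) \<Rightarrow> ('a \<Rightarrow> 'b \<Rightarrow> 'c) \<Rightarrow> 'c::complex_vector"
  where "tfold t f = (\<Sum>(x, y)\<leftarrow>simple t. f x y)"

lemma sum_list_simple: "(\<Sum>(x, y)\<leftarrow>simple t. f x y) = tfold t f"
  by (simp add: tfold_def)

named_theorems linear_intros

lemma clinear_ident [linear_intros]: "clinear (\<lambda>x. x)"
  by (rule clinearI) auto

lemma clinear_const_zero [linear_intros]: "clinear (\<lambda>x. 0)"
  by (rule clinearI) auto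

lemma clinear_compose: "clinear f \<Longrightarrow> clinear g \<Longrightarrow> clinear (\<lambda>x. f (g x))"
  by (rule clinearI) (simp_all add: clinear_add clinear_scaleC)

lemma clinear_plus [linear_intros]: "clinear f \<Longrightarrow> clinear g \<Longrightarrow> clinear (\<lambda>x. f x + g x)"
  by (rule clinearI) (simp_all add: clinear_add clinear_scaleC scaleC_add_right)

lemma clinear_minus [linear_intros]: "clinear f \<Longrightarrow> clinear g \<Longrightarrow> clinear (\<lambda>x. f x - g x)"
  by (rule clinearI)
    (simp_all add: clinear_add clinear_scaleC cvec.scale_right_diff_distrib)

lemma clinear_scale_right [linear_intros]: "clinear f \<Longrightarrow> clinear (\<lambda>x. c *\<^sub>C f x)"
  by (rule clinearI) (simp_all add: clinear_add clinear_scaleC scaleC_add_right scaleC_scaleC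
      mult.commute)

lemma clinear_scale_left [linear_intros]: "clinear f \<Longrightarrow> clinear (\<lambda>x. f x *\<^sub>C v)"
  by (rule clinearI) (simp_all add: clinear_add clinear_scaleC scaleC_add_left scaleC_scaleC
      scaleC_complex_def)

lemma clinear_mult_left [linear_intros]:
  "clinear f \<Longrightarrow> clinear (\<lambda>x. f x * (a :: 'a::complex_algebra))"
  by (rule clinearI) (simp_all add: clinear_add clinear_scaleC distrib_right mult_scaleC_left)

lemma clinear_mult_right [linear_intros]:
  "clinear f \<Longrightarrow> clinear (\<lambda>x. (a :: 'a::complex_algebra) * f x)"
  by (rule clinearI) (simp_all add: clinear_add clinear_scaleC distrib_left mult_scaleC_right)

lemma clinear_tensor_left [linear_intros]: "clinear f \<Longrightarrow> clinear (\<lambda>x. f x \<otimes> a)"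
  by (rule clinearI) (simp_all add: clinear_add clinear_scaleC tensor_add_left tensor_scaleC_left)

lemma clinear_tensor_right [linear_intros]: "clinear f \<Longrightarrow> clinear (\<lambda>x. a \<otimes> f x)"
  by (rule clinearI) (simp_all add: clinear_add clinear_scaleC tensor_add_right tensor_scaleC_right)

lemma clinear_bilinear_left: "cbilinear F \<Longrightarrow> clinear f \<Longrightarrow> clinear (\<lambda>x. F (f x) y)"
  using clinear_compose[of "\<lambda>x. F x y" f] by (simp add: cbilinear_def)

lemma clinear_bilinear_right: "cbilinear F \<Longrightarrow> clinear f \<Longrightarrow> clinear (\<lambda>x. F y (f x))"
  using clinear_compose[of "F y" f] by (simp add: cbilinear_def)

lemma clinear_sum_list: "clinear f \<Longrightarrow> f (\<Sum>x\<leftarrow>xs. g x) = (\<Sum>x\<leftarrow>xs. f (g x))"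
  by (induction xs) (simp_all add: clinear_zero clinear_add)

lemma sum_list_plus: "(\<Sum>x\<leftarrow>xs. f x + g x) = (\<Sum>x\<leftarrow>xs. f x) + (\<Sum>x\<leftarrow>xs. g x :: 'a::ab_group_add)"
  by (induction xs) simp_all

lemma sum_list_scale: "(\<Sum>x\<leftarrow>xs. c *\<^sub>C f x) = c *\<^sub>C (\<Sum>x\<leftarrow>xs. f x)"
  by (induction xs) (simp_all add: scaleC_add_right)

lemma sum_list_map_swap:
  "(\<Sum>x\<leftarrow>xs. \<Sum>y\<leftarrow>ys. f x y) = (\<Sum>y\<leftarrow>ys. \<Sum>x\<leftarrow>xs. f x y :: 'a::ab_group_add)"
  by (induction xs) (simp_all add: sum_list_plus)

lemma clinear_sum_list_map [linear_intros]:
  assumes "\<And>y. clinear (\<lambda>x. f x y)" shows "clinear (\<lambda>x. \<Sum>y\<leftarrow>ys. f x y)"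
proof (induction ys)
  case Nil
  show ?case unfolding list.map sum_list.Nil by (rule clinear_const_zero)
next
  case (Cons y ys)
  show ?case unfolding list.map sum_list.Cons by (rule clinear_plus[OF assms Cons])
qed

lemma tfold_unique:
  assumes "cbilinear f" and "(\<Sum>(x, y)\<leftarrow>xs. x \<otimes> y) = t"
  shows "(\<Sum>(x, y)\<leftarrow>xs. f x y) = tfold t f"
  unfolding tfold_def by (rule simple_cong[OF assms(1)]) (simp add: assms(2))

lemma tfold_tensor [simp]:
  assumes "cbilinear f" shows "tfold (x \<otimes> y) f = f x y"
  using tfold_unique[OF assms, of "[(x, y)]", OF refl] by simp

lemma tfold_add_left:
  assumes "cbilinear f" shows "tfold (s + t) f = tfold s f + tfold t f"
proof -
  have "(\<Sum>(x, y)\<leftarrow>simple s @ simple t. x \<otimes> y) = s + t" by simp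
  from tfold_unique[OF assms this] show ?thesis by (simp add: tfold_def)
qed

lemma tfold_scale_left:
  assumes "cbilinear f" shows "tfold (c *\<^sub>C t) f = c *\<^sub>C tfold t f"
proof -
  have "(\<Sum>(x, y)\<leftarrow>map (\<lambda>(x, y). (c *\<^sub>C x, y)) (simple t). x \<otimes> y)
      = (\<Sum>z\<leftarrow>simple t. c *\<^sub>C (fst z \<otimes> snd z))"
    by (simp add: comp_def split_def tensor_scaleC_left)
  also have "\<dots> = c *\<^sub>C t"
    unfolding sum_list_scale using sum_simple[of t] by (simp only: split_def)
  finally have "(\<Sum>(x, y)\<leftarrow>map (\<lambda>(x, y). (c *\<^sub>C x, y)) (simple t). f x y) = tfold (c *\<^sub>C t) f"
    by (rule tfold_unique[OF assms])
  moreover have "f (c *\<^sub>C x) y = c *\<^sub>C f x y" for x y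
    using assms clinear_scaleC[of "\<lambda>x. f x y"] by (simp only: cbilinear_def)
  ultimately show ?thesis
    unfolding tfold_def by (simp only: map_map comp_def split_def fst_conv snd_conv sum_list_scale)
qed

lemma clinear_tfold_left: "cbilinear f \<Longrightarrow> clinear (\<lambda>t. tfold t f)"
  by (rule clinearI) (simp_all add: tfold_add_left tfold_scale_left)

lemma clinear_tfold_subject [linear_intros]:
  "cbilinear f \<Longrightarrow> clinear g \<Longrightarrow> clinear (\<lambda>x. tfold (g x) f)"
  by (rule clinear_compose[OF clinear_tfold_left])

lemma clinear_tfold_body [linear_intros]:
  "(\<And>u v. clinear (\<lambda>x. f x u v)) \<Longrightarrow> clinear (\<lambda>x. tfold t (\<lambda>u v. f x u v))"
  unfolding tfold_def split_def by (rule clinear_sum_list_map)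

lemma cbilinearI [linear_intros]:
  "(\<And>x. clinear (\<lambda>y. f x y)) \<Longrightarrow> (\<And>y. clinear (\<lambda>x. f x y)) \<Longrightarrow> cbilinear (\<lambda>x y. f x y)"
  by (simp add: cbilinear_def)

lemma tfold_push: "clinear f \<Longrightarrow> f (tfold t g) = tfold t (\<lambda>x y. f (g x y))"
  unfolding tfold_def by (simp add: clinear_sum_list split_def)

lemma tfold_id [simp]: "tfold t (\<lambda>x y. x \<otimes> y) = t"
  by (simp add: tfold_def)

lemma tfold_linear_tensor: "clinear f \<Longrightarrow> tfold t (\<lambda>x y. f (x \<otimes> y)) = f t"
  by (simp add: tfold_push[symmetric])

lemma tensor_ext:
  assumes "clinear f" "clinear g" "\<And>x y. f (x \<otimes> y) = g (x \<otimes> y)"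
  shows "f t = g t"
  using tfold_linear_tensor[OF assms(1), of t] tfold_linear_tensor[OF assms(2), of t] assms(3)
  by simp

text \<open>Each side is a finite sum over the same two chosen lists.\<close>

lemma tfold_swap:
  "tfold s (\<lambda>x y. tfold t (\<lambda>u v. f x y u v)) = tfold t (\<lambda>u v. tfold s (\<lambda>x y. f x y u v))"
  unfolding tfold_def split_def by (rule sum_list_map_swap)

lemma tfold_plus: "tfold t (\<lambda>x y. f x y + g x y) = tfold t f + tfold t g"
  unfolding tfold_def by (simp add: split_def sum_list_plus)

lemma tfold_scale: "tfold t (\<lambda>x y. c *\<^sub>C f x y) = c *\<^sub>C tfold t f"
  unfolding tfold_def by (simp add: split_def sum_list_scale)

lemma tfold_diff: "tfold t (\<lambda>x y. f x y - g x y) = tfold t f - tfold t g"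
  using tfold_plus[of t "\<lambda>x y. f x y - g x y" g] by (simp add: algebra_simps)

lemma tfold_mult_left:
  "tfold t f * a = tfold t (\<lambda>x y. f x y * a)"
  for a :: "'a::complex_algebra"
  by (rule tfold_push) (intro linear_intros)

lemma tfold_mult_right:
  "a * tfold t f = tfold t (\<lambda>x y. a * f x y)"
  for a :: "'a::complex_algebra"
  by (rule tfold_push) (intro linear_intros)

lemma tfold_tensor_left: "tfold t f \<otimes> a = tfold t (\<lambda>x y. f x y \<otimes> a)"
  by (rule tfold_push) (intro linear_intros)

lemma tfold_tensor_right: "a \<otimes> tfold t f = tfold t (\<lambda>x y. a \<otimes> f x y)"
  by (rule tfold_push) (intro linear_intros)

lemma tfold_tfold: "cbilinear g \<Longrightarrow> tfold (tfold t f) g = tfold t (\<lambda>x y. tfold (f x y) g)"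
  by (rule tfold_push) (rule clinear_tfold_left)

lemmas tfold_out = tfold_mult_left tfold_mult_right tfold_tensor_left tfold_tensor_right tfold_tfold
  tfold_scale[symmetric]

lemmas scaleC_out = mult_scaleC_left mult_scaleC_right tensor_scaleC_left tensor_scaleC_right

text \<open>
  As simplification rules these discharge the multilinearity side conditions of rewriting
  steps.
\<close>

declare linear_intros [simp]

lemma sum_list_concat_map: "(\<Sum>x\<leftarrow>concat (map f xs). g x) = (\<Sum>x\<leftarrow>xs. \<Sum>y\<leftarrow>f x. g y :: 'z::ab_group_add)"
  by (induction xs) simp_all

section \<open>Sweedler notation in a Hopf algebra\<close>

context hopf_algebra
begin

abbreviation sw where "sw h f \<equiv> tfold (\<Delta> h) f"

lemma sw2_eq: "(\<Sum>(x, y)\<leftarrow>sw2 \<Delta> h. f x y) = sw h f"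
  by (simp add: sw2_def tfold_def)

lemma sw3_eq: "(\<Sum>(x, y, z)\<leftarrow>sw3 \<Delta> h. f x y z) = sw h (\<lambda>x r. sw r (\<lambda>y z. f x y z))"
  by (simp add: sw3_def sw2_def tfold_def split_def sum_list_concat_map comp_def)

lemma sw4_eq:
  "(\<Sum>(x, y, z, w)\<leftarrow>sw4 \<Delta> h. f x y z w) = sw h (\<lambda>x r. sw r (\<lambda>y s. sw s (\<lambda>z w. f x y z w)))"
  by (simp add: sw4_def sw3_def sw2_def tfold_def split_def sum_list_concat_map comp_def)

lemmas [linear_intros, simp] = clinear_compose[OF linear_comult] clinear_compose[OF linear_counit]
    clinear_compose[OF linear_antipode]

text \<open>A trilinear \<open>f\<close> induces the map \<open>?F\<close> on the triple tensor
  product, and \<open>?F\<close> is applied to both sides of \<open>coassoc\<close>.\<close>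

lemma tricoassoc:
  assumes "\<And>y z. clinear (\<lambda>x. f x y z)" "\<And>x z. clinear (\<lambda>y. f x y z)" "\<And>x y. clinear (\<lambda>z. f x y z)"
  shows "sw h (\<lambda>x y. sw x (\<lambda>u v. f u v y)) = sw h (\<lambda>x y. sw y (\<lambda>u v. f x u v))"
proof -
  let ?F = "\<lambda>t. tfold t (\<lambda>x r. tfold r (\<lambda>y z. f x y z))"
  have "sw h (\<lambda>x y. sw x (\<lambda>u v. u \<otimes> v \<otimes> y)) = sw h (\<lambda>x y. sw y (\<lambda>u v. x \<otimes> u \<otimes> v))"
    using coassoc[of h] by (simp add: sw2_eq)
  then have "?F (sw h (\<lambda>x y. sw x (\<lambda>u v. u \<otimes> v \<otimes> y))) = ?F (sw h (\<lambda>x y. sw y (\<lambda>u v. x \<otimes> u \<otimes> v)))"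
    by simp
  then show ?thesis using assms by (simp add: tfold_out)
qed

lemma sw_antipode_left:
  assumes "clinear f"
  shows "sw h (\<lambda>x y. f (S x * y)) = \<epsilon> h *\<^sub>C f 1"
  using antipode_left[of h] tfold_push[OF assms, of "\<Delta> h" "\<lambda>x y. S x * y"] clinear_scaleC[OF assms]
  by (simp add: sw2_eq)

lemma sw_antipode_right:
  assumes "clinear f"
  shows "sw h (\<lambda>x y. f (x * S y)) = \<epsilon> h *\<^sub>C f 1"
  using antipode_right[of h] tfold_push[OF assms, of "\<Delta> h" "\<lambda>x y. x * S y"] clinear_scaleC[OF assms]
  by (simp add: sw2_eq)

lemma sw_counit_left:
  assumes "clinear f"
  shows "sw h (\<lambda>x y. \<epsilon> x *\<^sub>C f y) = f h"
  using counit_left[of h] tfold_push[OF assms, of "\<Delta> h" "\<lambda>x y. \<epsilon> x *\<^sub>C y"] clinear_scaleC[OF assms]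
  by (simp add: sw2_eq)

lemma sw_counit_right:
  assumes "clinear f"
  shows "sw h (\<lambda>x y. \<epsilon> y *\<^sub>C f x) = f h"
  using counit_right[of h] tfold_push[OF assms, of "\<Delta> h" "\<lambda>x y. \<epsilon> y *\<^sub>C x"] clinear_scaleC[OF assms]
  by (simp add: sw2_eq)

lemma sw_mult:
  assumes "cbilinear f"
  shows "sw (h * k) f = sw h (\<lambda>x y. sw k (\<lambda>u v. f (x * u) (y * v)))"
  using comult_mult[of h k] assms by (simp add: sw2_eq tfold_out)

lemma sw_one:
  assumes "cbilinear f"
  shows "sw 1 f = f 1 1"
  using comult_one assms by simp

text \<open>
  Normalisation of iterated Sweedler sums. All Sweedler components of a variable carry the
  rank \<open>r\<close> assigned to it by \<open>tag_start\<close>. The general exchange law \<open>tfold_swap\<close> loops as a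
  rewrite rule; the ranks orient it, so that the simplifier sorts nested sums by variable.
  The rules \<open>tag_coassoc1\<close> to \<open>tag_coassoc3\<close> then move the splitting of a left component
  next to the sum it stems from, where \<open>tag_coassoc\<close> makes it right-nested.
\<close>

definition tag :: "nat \<Rightarrow> 'h \<Rightarrow> 'h" where "tag r h = h"

definition tag_comult :: "nat \<Rightarrow> 'h \<Rightarrow> 'h \<otimes> 'h" where "tag_comult r h = \<Delta> h"

lemma clinear_tag [linear_intros, simp]: "clinear f \<Longrightarrow> clinear (\<lambda>x. tag r (f x))"
  by (simp add: tag_def)

lemma clinear_tag_comult [linear_intros, simp]: "clinear f \<Longrightarrow> clinear (\<lambda>x. tag_comult r (f x))"
  by (simp add: tag_comult_def)

lemma tag_start: "tfold (\<Delta> h) f = tfold (tag_comult r h) (\<lambda>x y. f (tag r x) (tag r y))"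
  by (simp add: tag_def tag_comult_def)

lemma tag_step: "tfold (\<Delta> (tag r h)) f = tfold (tag_comult r h) (\<lambda>x y. f (tag r x) (tag r y))"
  by (simp add: tag_def tag_comult_def)

lemma counit_tag: "\<epsilon> (tag r h) = \<epsilon> h"
  by (simp add: tag_def)

lemma tag_swap:
  "s < r \<Longrightarrow> tfold (tag_comult r h) (\<lambda>x y. tfold (tag_comult s k) (\<lambda>u v. f x y u v))
   = tfold (tag_comult s k) (\<lambda>u v. tfold (tag_comult r h) (\<lambda>x y. f x y u v))"
  by (rule tfold_swap)

lemma tag_coassoc:
  assumes "\<And>y z. clinear (\<lambda>x. f x y z)" "\<And>x z. clinear (\<lambda>y. f x y z)" "\<And>x y. clinear (\<lambda>z. f x y z)"
  shows "tfold (tag_comult r h) (\<lambda>x y. tfold (tag_comult r x) (\<lambda>u v. f u v y))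
    = tfold (tag_comult r h) (\<lambda>x y. tfold (tag_comult r y) (\<lambda>u v. f x u v))"
  using assms unfolding tag_comult_def by (rule tricoassoc)

lemma tag_coassoc1:
  "tfold (tag_comult r h) (\<lambda>x y. tfold (tag_comult r y)
      (\<lambda>p q. tfold (tag_comult r x) (\<lambda>u v. f u v p q)))
    = tfold (tag_comult r h) (\<lambda>x y. tfold (tag_comult r x)
        (\<lambda>u v. tfold (tag_comult r y) (\<lambda>p q. f u v p q)))"
  by (rule arg_cong[where f="tfold _"], (rule ext)+, rule tfold_swap)

lemma tag_coassoc2:
  "tfold (tag_comult r h) (\<lambda>x y. tfold (tag_comult r y)
      (\<lambda>p q. tfold (tag_comult r q) (\<lambda>p' q'. tfold (tag_comult r x) (\<lambda>u v. f u v p p' q'))))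
    = tfold (tag_comult r h) (\<lambda>x y. tfold (tag_comult r x)
        (\<lambda>u v. tfold (tag_comult r y) (\<lambda>p q. tfold (tag_comult r q) (\<lambda>p' q'. f u v p p' q'))))"
  by (rule arg_cong[where f="tfold _"], (rule ext)+, rule trans[OF _ tfold_swap], rule
      arg_cong[where f="tfold _"], (rule ext)+, rule tfold_swap)

lemma tag_coassoc3:
  "tfold (tag_comult r h) (\<lambda>x y. tfold (tag_comult r y) (\<lambda>p q. tfold (tag_comult r q)
      (\<lambda>p' q'. tfold (tag_comult r q')
      (\<lambda>p'' q''. tfold (tag_comult r x) (\<lambda>u v. f u v p p' p'' q'')))))
    = tfold (tag_comult r h) (\<lambda>x y. tfold (tag_comult r x)
        (\<lambda>u v. tfold (tag_comult r y)
        (\<lambda>p q. tfold (tag_comult r q)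
        (\<lambda>p' q'. tfold (tag_comult r q') (\<lambda>p'' q''. f u v p p' p'' q'')))))"
  by (rule arg_cong[where f="tfold _"], (rule ext)+, rule trans[OF _ tfold_swap], rule
      arg_cong[where f="tfold _"], (rule ext)+, rule trans[OF _ tfold_swap], rule
      arg_cong[where f="tfold _"], (rule ext)+, rule tfold_swap)

lemma tag_counit_left: "clinear f \<Longrightarrow> tfold (tag_comult r h) (\<lambda>x y. \<epsilon> x *\<^sub>C f y) = f h"
  unfolding tag_comult_def by (rule sw_counit_left)

lemma tag_counit_right: "clinear f \<Longrightarrow> tfold (tag_comult r h) (\<lambda>x y. \<epsilon> y *\<^sub>C f x) = f h"
  unfolding tag_comult_def by (rule sw_counit_right)

lemmas tensor_nf = tfold_mult_left tfold_mult_right tfold_tensor_left tfold_tensor_right tfold_tfold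
  scaleC_out tfold_scale tfold_scale_left

lemmas counits = sw_counit_left sw_counit_right
lemmas sweedler = tensor_nf sw_mult sw_one tag_step counit_tag tag_swap tag_coassoc tag_coassoc1
    tag_coassoc2 tag_coassoc3
  tag_counit_left tag_counit_right

section \<open>Anti-comultiplicativity of the antipode\<close>

definition tensor_mult :: "'h \<otimes> 'h \<Rightarrow> 'h \<otimes> 'h \<Rightarrow> 'h \<otimes> 'h" where
  "tensor_mult s t = tfold s (\<lambda>x y. tfold t (\<lambda>u v. (x * u) \<otimes> (y * v)))"

lemma clinear_tensor_mult [linear_intros, simp]:
  "clinear f \<Longrightarrow> clinear (\<lambda>x. tensor_mult (f x) t)"
  "clinear f \<Longrightarrow> clinear (\<lambda>x. tensor_mult t (f x))"
  unfolding tensor_mult_def by simp_all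

lemma comult_tensor_mult: "\<Delta> (h * k) = tensor_mult (\<Delta> h) (\<Delta> k)"
  using comult_mult[of h k] by (simp add: tensor_mult_def sw2_eq)

lemma tensor_mult_assoc: "tensor_mult (tensor_mult r s) t = tensor_mult r (tensor_mult s t)"
  by (simp add: tensor_mult_def tfold_mult_left tfold_mult_right tfold_tensor_left
      tfold_tensor_right tfold_tfold mult.assoc)

lemma tensor_mult_one:
  "tensor_mult (1 \<otimes> 1) t = t"
  "tensor_mult t (1 \<otimes> 1) = t"
  by (simp_all add: tensor_mult_def)

lemma tensor_mult_tfold:
  "tensor_mult (tfold r f) t = tfold r (\<lambda>x y. tensor_mult (f x y) t)"
  "tensor_mult t (tfold r f) = tfold r (\<lambda>x y. tensor_mult t (f x y))"
  by (rule tfold_push, simp)+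

lemma tensor_mult_scale:
  "tensor_mult (c *\<^sub>C s) t = c *\<^sub>C tensor_mult s t"
  "tensor_mult s (c *\<^sub>C t) = c *\<^sub>C tensor_mult s t"
  by (simp_all add: tensor_mult_def tfold_scale tfold_scale_left)

text \<open>The candidate for \<open>\<Delta> (S h)\<close>, recognised below as a convolution
  inverse of \<open>\<Delta>\<close> with respect to \<open>tensor_mult\<close>.\<close>

definition antipode_op where "antipode_op h = sw h (\<lambda>x y. S y \<otimes> S x)"

lemma clinear_antipode_op [linear_intros, simp]: "clinear f \<Longrightarrow> clinear (\<lambda>x. antipode_op (f x))"
  unfolding antipode_op_def by simp

text \<open>Written out, the sum is \<open>h1 * S h4 \<otimes> h2 * S h3\<close>; the inner pair
  collapses first, which makes the outer pair adjacent.\<close>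

lemma comult_antipode_op: "sw h (\<lambda>x y. tensor_mult (\<Delta> x) (antipode_op y)) = \<epsilon> h *\<^sub>C (1 \<otimes> 1)"
proof -
  have "sw h (\<lambda>x y. tensor_mult (\<Delta> x) (antipode_op y))
      = sw h (\<lambda>x r. sw r (\<lambda>y z. sw y (\<lambda>u v. (x * S z) \<otimes> (u * S v))))"
    by (simp add: tensor_mult_def antipode_op_def tag_start[of h _ 0] sweedler)
  also have "\<dots> = \<epsilon> h *\<^sub>C (1 \<otimes> 1)"
    by (simp add: sw_antipode_right[of "\<lambda>z. z \<otimes> 1"] sw_antipode_right[of "\<lambda>z. w \<otimes> z" for w]
        tfold_scale scaleC_out counits)
  finally show ?thesis .
qed

text \<open>Uniqueness of convolution inverses: composing \<open>\<Delta>\<close> with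
  \<open>S\<close> gives a left inverse of \<open>\<Delta>\<close>, and \<open>antipode_op\<close>
  is a right inverse.\<close>

lemma comult_S: "\<Delta> (S h) = antipode_op h"
proof -
  have "\<Delta> (S h) = sw h (\<lambda>x r. sw r (\<lambda>y z. tensor_mult (\<Delta> (S x))
      (tensor_mult (\<Delta> y) (antipode_op z))))"
    by (simp add: tensor_mult_tfold(2)[symmetric] comult_antipode_op tensor_mult_scale
        tensor_mult_one counits)
  also have "\<dots> = sw h (\<lambda>x r. sw x (\<lambda>y z. tensor_mult (\<Delta> (S y * z)) (antipode_op r)))"
    by (simp add: tricoassoc comult_tensor_mult tensor_mult_assoc)
  also have "\<dots> = antipode_op h"
    by (simp add: sw_antipode_left[of "\<lambda>y. tensor_mult (\<Delta> y) _"] comult_one tensor_mult_one counits)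
  finally show ?thesis .
qed

lemma sw_S: "cbilinear f \<Longrightarrow> sw (S h) f = sw h (\<lambda>x y. f (S y) (S x))"
  by (simp add: comult_S antipode_op_def tfold_tfold)

text \<open>Apply \<open>\<epsilon>\<close> to the antipode law and absorb the second factor by the
  counit law.\<close>

lemma counit_antipode [simp]: "\<epsilon> (S h) = \<epsilon> h"
proof -
  have "clinear \<epsilon>" by (rule linear_counit)
  then have "sw h (\<lambda>x y. \<epsilon> (S x * y)) = \<epsilon> h *\<^sub>C \<epsilon> 1"
    by (rule sw_antipode_left)
  moreover have "sw h (\<lambda>x y. \<epsilon> (S x * y)) = sw h (\<lambda>x y. \<epsilon> y *\<^sub>C \<epsilon> (S x))"
    by (simp add: counit_mult scaleC_complex_def mult.commute)
  moreover have "sw h (\<lambda>x y. \<epsilon> y *\<^sub>C \<epsilon> (S x)) = \<epsilon> (S h)"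
    by (rule sw_counit_right) (intro linear_intros linear_counit linear_antipode)
  ultimately show ?thesis
    by (simp only: counit_one) (simp add: scaleC_complex_def)
qed

lemma antipode_one [simp]: "S 1 = 1"
  using sw_antipode_left[of "\<lambda>x. x" 1] by (simp add: sw_one counit_one linear_intros)

lemmas counit_simps = counit_mult counit_one scaleC_scaleC[symmetric]

end

text \<open>
  The products of scalars formed by this rule would hide the redexes of \<open>counits\<close>.
\<close>

declare cvec.scale_scale [simp del]

section \<open>Crossed products with trivial action and central cocycle\<close>

text \<open>What remains of a crossed system once the action is the counit. It is separated from
  \<open>crossed_system\<close> because it is interpreted twice in the same argument, with
  \<open>\<sigma>\<close> for the crossed product and with the trivial cocycle for the smash
  product.\<close>

locale central_cocycle = hopf_algebra \<Delta> \<epsilon> S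
  for \<Delta> :: "'h::complex_algebra \<Rightarrow> 'h \<otimes> 'h" and \<epsilon> :: "'h \<Rightarrow> complex" and S :: "'h \<Rightarrow> 'h" +
  fixes \<sigma> \<sigma>i :: "'h \<Rightarrow> 'h \<Rightarrow> 'b::complex_algebra"
  assumes sigma_bilin: "cbilinear \<sigma>"
    and sigma_inv_bilin: "cbilinear \<sigma>i"
    and sigma_central: "\<sigma> h k * b = b * \<sigma> h k"
    and sigma_inverse_right: "sw h (\<lambda>h1 h2. sw k (\<lambda>k1 k2. \<sigma> h1 k1 * \<sigma>i h2 k2)) = (\<epsilon> h * \<epsilon> k) *\<^sub>C 1"
    and sigma_inverse_left: "sw h (\<lambda>h1 h2. sw k (\<lambda>k1 k2. \<sigma>i h1 k1 * \<sigma> h2 k2)) = (\<epsilon> h * \<epsilon> k) *\<^sub>C 1"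
    and sigma_unit_right: "\<sigma> h 1 = \<epsilon> h *\<^sub>C 1"
    and sigma_unit_left: "\<sigma> 1 h = \<epsilon> h *\<^sub>C 1"
    and sigma_2cocycle: "sw k (\<lambda>k1 k2. sw m (\<lambda>m1 m2. \<sigma> k1 m1 * \<sigma> h (k2 * m2)))
      = sw h (\<lambda>h1 h2. sw k (\<lambda>k1 k2. \<sigma> h1 k1 * \<sigma> (h2 * k2) m))"
begin

text \<open>
  Values of \<open>\<sigma>\<close> are treated as operators like scalars; centrality then takes the form of
  rewrite rules that move them out of products.
\<close>

definition sigma_mult where "sigma_mult h k b = \<sigma> h k * b"

definition sigma_inv_mult where "sigma_inv_mult h k b = \<sigma>i h k * b"

lemmas clinear_sigma [linear_intros, simp] =
  clinear_bilinear_left[OF sigma_bilin] clinear_bilinear_right[OF sigma_bilin]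
  clinear_bilinear_left[OF sigma_inv_bilin] clinear_bilinear_right[OF sigma_inv_bilin]

lemma clinear_sigma_mult [linear_intros, simp]:
  "clinear f \<Longrightarrow> clinear (\<lambda>x. sigma_mult (f x) k b)"
  "clinear f \<Longrightarrow> clinear (\<lambda>x. sigma_mult h (f x) b)"
  "clinear g \<Longrightarrow> clinear (\<lambda>x. sigma_mult h k (g x))"
  "clinear f \<Longrightarrow> clinear (\<lambda>x. sigma_inv_mult (f x) k b)"
  "clinear f \<Longrightarrow> clinear (\<lambda>x. sigma_inv_mult h (f x) b)"
  "clinear g \<Longrightarrow> clinear (\<lambda>x. sigma_inv_mult h k (g x))"
  by (simp_all add: sigma_mult_def sigma_inv_mult_def)

text \<open>Centrality passes to the convolution inverse: insert \<open>\<sigma> * \<sigma>i\<close>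
  to the right of \<open>b\<close>, move \<open>b\<close> past the central \<open>\<sigma>\<close>,
  and cancel \<open>\<sigma>i * \<sigma>\<close> on the left.\<close>

lemma sigma_inv_central: "\<sigma>i h k * b = b * \<sigma>i h k"
proof -
  have *: "b * (\<sigma> p q * z) = \<sigma> p q * (b * z)" for p q z
    by (simp add: mult.assoc[symmetric] sigma_central[of p q b])
  have "\<sigma>i h k * b = sw h (\<lambda>x y. sw k (\<lambda>u v. \<sigma>i x u * b * ((\<epsilon> y * \<epsilon> v) *\<^sub>C 1)))"
    by (simp add: scaleC_out counit_simps tfold_scale counits)
  also have "\<dots> = sw h (\<lambda>x y. sw k (\<lambda>u v. \<sigma>i x u *
      (b * sw y (\<lambda>y1 y2. sw v (\<lambda>v1 v2. \<sigma> y1 v1 * \<sigma>i y2 v2)))))"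
    by (simp add: sigma_inverse_right mult.assoc)
  also have "\<dots> = sw h (\<lambda>x y. sw k (\<lambda>u v. sw x (\<lambda>x1 x2. sw u (\<lambda>u1 u2. \<sigma>i x1 u1 * \<sigma> x2 u2)) *
      (b * \<sigma>i y v)))"
    by (simp add: tag_start[of h _ 0] tag_start[of k _ 1] sweedler mult.assoc *)
  also have "\<dots> = b * \<sigma>i h k"
    by (simp add: sigma_inverse_left scaleC_out counit_simps tfold_scale counits)
  finally show ?thesis .
qed

lemma sigma_mult_left:
  "sigma_mult h k b * c = sigma_mult h k (b * c)"
  "sigma_inv_mult h k b * c = sigma_inv_mult h k (b * c)"
  by (simp_all add: sigma_mult_def sigma_inv_mult_def mult.assoc)

lemma sigma_mult_right:
  "c * sigma_mult h k b = sigma_mult h k (c * b)"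
  "c * sigma_inv_mult h k b = sigma_inv_mult h k (c * b)"
  unfolding sigma_mult_def sigma_inv_mult_def mult.assoc[symmetric] by
      (simp_all add: sigma_central[of h k c] sigma_inv_central[of h k c])

text \<open>The first two equations are permutative and are used for ordered rewriting; the third
  moves every \<open>\<sigma>\<close> outside every \<open>\<sigma>i\<close>.\<close>

lemma sigma_mult_commute:
  "sigma_mult h k (sigma_mult h' k' b) = sigma_mult h' k' (sigma_mult h k b)"
  "sigma_inv_mult h k (sigma_inv_mult h' k' b) = sigma_inv_mult h' k' (sigma_inv_mult h k b)"
  "sigma_inv_mult h k (sigma_mult h' k' b) = sigma_mult h' k' (sigma_inv_mult h k b)"
  by (metis mult.assoc sigma_mult_def sigma_central, metis mult.assoc sigma_inv_mult_def
      sigma_inv_central, metis mult.assoc sigma_mult_def sigma_inv_mult_def sigma_central)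

lemma sigma_mult_scale:
  "sigma_mult h k (c *\<^sub>C b) = c *\<^sub>C sigma_mult h k b"
  "sigma_inv_mult h k (c *\<^sub>C b) = c *\<^sub>C sigma_inv_mult h k b"
  by (simp_all add: sigma_mult_def sigma_inv_mult_def scaleC_out)

lemma sigma_mult_tfold: "sigma_mult h k (tfold t f) = tfold t (\<lambda>x y. sigma_mult h k (f x y))"
    "sigma_inv_mult h k (tfold t f) = tfold t (\<lambda>x y. sigma_inv_mult h k (f x y))"
  by (simp_all add: sigma_mult_def sigma_inv_mult_def tfold_mult_right)

lemma sigma_mult_cancel:
  "sw h (\<lambda>h1 h2. sw k (\<lambda>k1 k2. sigma_mult h1 k1 (sigma_inv_mult h2 k2 b))) = \<epsilon> h *\<^sub>C \<epsilon> k *\<^sub>C b"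
proof -
  have "sw h (\<lambda>h1 h2. sw k (\<lambda>k1 k2. \<sigma> h1 k1 * \<sigma>i h2 k2)) * b = (\<epsilon> h * \<epsilon> k) *\<^sub>C 1 * b"
    by (simp only: sigma_inverse_right)
  then show ?thesis
    by (simp only: sigma_mult_def sigma_inv_mult_def mult.assoc tfold_mult_left scaleC_out
        scaleC_scaleC mult_1_left)
qed

lemma sigma_inv_mult_cancel:
  "sw h (\<lambda>h1 h2. sw k (\<lambda>k1 k2. sigma_inv_mult h1 k1 (sigma_mult h2 k2 b))) = \<epsilon> h *\<^sub>C \<epsilon> k *\<^sub>C b"
proof -
  have "sw h (\<lambda>h1 h2. sw k (\<lambda>k1 k2. \<sigma>i h1 k1 * \<sigma> h2 k2)) * b = (\<epsilon> h * \<epsilon> k) *\<^sub>C 1 * b"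
    by (simp only: sigma_inverse_left)
  then show ?thesis
    by (simp only: sigma_mult_def sigma_inv_mult_def mult.assoc tfold_mult_left scaleC_out
        scaleC_scaleC mult_1_left)
qed

lemma sigma_mult_one:
  "sigma_mult h 1 b = \<epsilon> h *\<^sub>C b"
  "sigma_mult 1 h b = \<epsilon> h *\<^sub>C b"
  by (simp_all add: sigma_mult_def sigma_unit_left sigma_unit_right scaleC_out)

text \<open>In \<open>sigma_mult_cancel\<close> with one argument equal to 1, the factor
  \<open>\<sigma>\<close> becomes a counit and only \<open>\<sigma>i\<close> is left.\<close>

lemma sigma_inv_mult_one:
  "sigma_inv_mult h 1 b = \<epsilon> h *\<^sub>C b"
  "sigma_inv_mult 1 h b = \<epsilon> h *\<^sub>C b"
  using sigma_mult_cancel[of h 1 b] sigma_mult_cancel[of 1 h b]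
  by (simp_all add: sw_one sigma_mult_one counits counit_one)

lemma sigma_mult_cocycle:
  "sw k (\<lambda>k1 k2. sw m (\<lambda>m1 m2. sigma_mult k1 m1 (sigma_mult h (k2 * m2) b)))
    = sw h (\<lambda>h1 h2. sw k (\<lambda>k1 k2. sigma_mult h1 k1 (sigma_mult (h2 * k2) m b)))"
proof -
  have "sw k (\<lambda>k1 k2. sw m (\<lambda>m1 m2. \<sigma> k1 m1 * \<sigma> h (k2 * m2))) * b
      = sw h (\<lambda>h1 h2. sw k (\<lambda>k1 k2. \<sigma> h1 k1 * \<sigma> (h2 * k2) m)) * b"
    by (simp only: sigma_2cocycle)
  then show ?thesis
    by (simp only: sigma_mult_def mult.assoc tfold_mult_left)
qed

lemmas sigma_mult_nf = sigma_mult_left sigma_mult_right sigma_mult_scale sigma_mult_tfold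
    sigma_mult_commute sweedler

section \<open>The crossed product algebra\<close>

definition crossed_mult where
  "crossed_mult X Y = tfold X (\<lambda>b h. tfold Y (\<lambda>c g. sw h
      (\<lambda>h1 h2. sw g (\<lambda>g1 g2. sigma_mult h1 g1 (b * c) \<otimes> (h2 * g2)))))"

lemma clinear_crossed_mult [linear_intros, simp]:
  "clinear f \<Longrightarrow> clinear (\<lambda>x. crossed_mult (f x) t)"
  "clinear f \<Longrightarrow> clinear (\<lambda>x. crossed_mult t (f x))"
  by (simp_all add: crossed_mult_def)

lemma crossed_mult_tensor:
  "crossed_mult (b \<otimes> h) (c \<otimes> g) = sw h (\<lambda>h1 h2. sw g
      (\<lambda>g1 g2. sigma_mult h1 g1 (b * c) \<otimes> (h2 * g2)))"
  by (simp add: crossed_mult_def)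

text \<open>Both bracketings have the same component \<open>h3 * g3 * k3\<close> in the Hopf
  algebra; their coefficients in the base are the two sides of the cocycle identity.\<close>

lemma crossed_mult_assoc_tensor:
  "crossed_mult (crossed_mult (b \<otimes> h) (c \<otimes> g)) (d \<otimes> k)
      = crossed_mult (b \<otimes> h) (crossed_mult (c \<otimes> g) (d \<otimes> k))"
proof -
  have "crossed_mult (crossed_mult (b \<otimes> h) (c \<otimes> g)) (d \<otimes> k) = sw h (\<lambda>x h3. sw g (\<lambda>y g3. sw k (\<lambda>z k3.
     sw x (\<lambda>h1 h2. sw y (\<lambda>g1 g2. sigma_mult h1 g1 (sigma_mult (h2 * g2) z (b * c * d)))) \<otimes>
         (h3 * g3 * k3))))"
    by (simp add: crossed_mult_def tag_start[of h _ 0] tag_start[of g _ 1] tag_start[of k _ 2]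
        sigma_mult_nf)
  also have "\<dots> = sw h (\<lambda>x h3. sw g (\<lambda>y g3. sw k (\<lambda>z k3.
     sw y (\<lambda>k1 k2. sw z (\<lambda>m1 m2. sigma_mult k1 m1 (sigma_mult x (k2 * m2) (b * c * d)))) \<otimes>
         (h3 * g3 * k3))))"
    by (simp only: sigma_mult_cocycle)
  also have "\<dots> = crossed_mult (b \<otimes> h) (crossed_mult (c \<otimes> g) (d \<otimes> k))"
    by (simp add: crossed_mult_def tag_start[of h _ 0] tag_start[of g _ 1] tag_start[of k _ 2]
        sigma_mult_nf mult.assoc)
  finally show ?thesis .
qed

lemma crossed_mult_assoc: "crossed_mult (crossed_mult X Y) Z = crossed_mult X (crossed_mult Y Z)"
  by (rule tensor_ext[of "\<lambda>X. crossed_mult (crossed_mult X Y) Z" "\<lambda>X. crossed_mult X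
      (crossed_mult Y Z)"], simp, simp,
      rule tensor_ext[of "\<lambda>Y. crossed_mult (crossed_mult _ Y) Z" "\<lambda>Y. crossed_mult _
          (crossed_mult Y Z)"], simp, simp,
      rule tensor_ext[of "\<lambda>Z. crossed_mult (crossed_mult _ _) Z" "\<lambda>Z. crossed_mult _
          (crossed_mult _ Z)"], simp, simp,
      rule crossed_mult_assoc_tensor)

lemma crossed_mult_incl_left: "crossed_mult (b \<otimes> 1) X = tfold X (\<lambda>c g. (b * c) \<otimes> g)"
  by (simp add: crossed_mult_def sw_one sigma_mult_one scaleC_out counits)

lemma crossed_mult_incl_right: "crossed_mult X (b \<otimes> 1) = tfold X (\<lambda>c g. (c * b) \<otimes> g)"
  by (simp add: crossed_mult_def sw_one sigma_mult_one scaleC_out counits)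

lemma crossed_mult_one [simp]:
  "crossed_mult (1 \<otimes> 1) X = X"
  "crossed_mult X (1 \<otimes> 1) = X"
  by (simp_all add: crossed_mult_incl_left crossed_mult_incl_right)

section \<open>The convolution inverse of the cleaving map\<close>

lemma sigma_mult_push:
  "sigma_mult (tfold t f) k b = tfold t (\<lambda>x y. sigma_mult (f x y) k b)"
  "sigma_mult h (tfold t f) b = tfold t (\<lambda>x y. sigma_mult h (f x y) b)"
  "sigma_inv_mult (tfold t f) k b = tfold t (\<lambda>x y. sigma_inv_mult (f x y) k b)"
  "sigma_inv_mult h (tfold t f) b = tfold t (\<lambda>x y. sigma_inv_mult h (f x y) b)"
  by (rule tfold_push, simp)+

lemma sigma_mult_scale_subject:
  "sigma_mult (c *\<^sub>C h) k b = c *\<^sub>C sigma_mult h k b" "sigma_mult h (c *\<^sub>C k) b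
      = c *\<^sub>C sigma_mult h k b"
  "sigma_inv_mult (c *\<^sub>C h) k b = c *\<^sub>C sigma_inv_mult h k b" "sigma_inv_mult h (c *\<^sub>C k) b
      = c *\<^sub>C sigma_inv_mult h k b"
  by (rule clinear_scaleC, simp)+

text \<open>
  \<open>cleft_inv b h\<close> is \<open>b j\<^sup>-\<^sup>1(h)\<close> for the cleaving map \<open>j h = 1 \<otimes> h\<close>.
\<close>

definition cleft_inv where
  "cleft_inv b h = sw h (\<lambda>x y. sw y (\<lambda>u v. sigma_inv_mult (S u) v b \<otimes> S x))"

lemma clinear_cleft_inv [linear_intros, simp]:
  "clinear f \<Longrightarrow> clinear (\<lambda>x. cleft_inv (f x) h)"
  "clinear g \<Longrightarrow> clinear (\<lambda>x. cleft_inv b (g x))"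
  by (simp_all add: cleft_inv_def)

lemma cleft_inv_incl_left: "crossed_mult (b \<otimes> 1) (cleft_inv c h) = cleft_inv (b * c) h"
  by (simp add: cleft_inv_def crossed_mult_incl_left sigma_mult_nf)

lemma cleft_inv_incl_right: "crossed_mult (cleft_inv c h) (b \<otimes> 1) = cleft_inv (c * b) h"
  by (simp add: cleft_inv_def crossed_mult_incl_right sigma_mult_nf)

text \<open>
  The cocycle identity, multiplied by \<open>\<sigma>\<^sup>-\<^sup>1\<close> on both sides.
\<close>

lemma sigma_mult_exchange:
  "sw k (\<lambda>k1 k2. sigma_mult h k2 (sigma_inv_mult k1 m b))
   = sw h (\<lambda>h1 h2. sw k (\<lambda>k1 k2. sw m (\<lambda>m1 m2. sigma_mult h1 (k1 * m1)
       (sigma_inv_mult (h2 * k2) m2 b))))"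
proof -
  \<comment> \<open>A factor \<open>\<sigma> * \<sigma>i\<close> at the product of the last legs of
    \<open>h\<close> and \<open>k\<close> and the last leg of \<open>m\<close> is inserted. Its
    \<open>\<sigma>\<close> and the given \<open>sigma_mult x q\<close> form the right-hand side of
    the cocycle identity, while \<open>sigma_inv_mult p m1\<close> waits to cancel against the
    left-hand side.\<close>
  have "sw k (\<lambda>k1 k2. sigma_mult h k2 (sigma_inv_mult k1 m b)) =
    sw h (\<lambda>x y. sw k (\<lambda>p r. sw r (\<lambda>q s. sw m (\<lambda>m1 m2. sigma_inv_mult p m1
        (sigma_mult x q (sw (y * s)
        (\<lambda>w1 w2. sw m2 (\<lambda>n1 n2. sigma_mult w1 n1 (sigma_inv_mult w2 n2 b)))))))))"
    by (simp add: sigma_mult_cancel counit_simps sigma_mult_scale tfold_scale counits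
        sigma_mult_commute)
  also have "\<dots> = sw h (\<lambda>x y. sw k (\<lambda>p r. sw r (\<lambda>q s. sw m (\<lambda>m1 n. sw n (\<lambda>m2 m3. sigma_inv_mult p m1
        (sw x (\<lambda>h1 h2. sw q (\<lambda>k1 k2. sigma_mult h1 k1
            (sigma_mult (h2 * k2) m2 (sigma_inv_mult (y * s) m3 b))))))))))"
    by (simp add: tag_start[of h _ 0] tag_start[of k _ 1] tag_start[of m _ 2] sigma_mult_nf)
  also have "\<dots> = sw h (\<lambda>x y. sw k (\<lambda>p r. sw r (\<lambda>q s. sw m (\<lambda>m1 n. sw n (\<lambda>m2 m3. sigma_inv_mult p m1
        (sw q (\<lambda>k1 k2. sw m2 (\<lambda>m1 m2. sigma_mult k1 m1
            (sigma_mult x (k2 * m2) (sigma_inv_mult (y * s) m3 b))))))))))"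
    by (simp only: sigma_mult_cocycle)
  also have "\<dots> = sw h (\<lambda>x y. sw k (\<lambda>p r. sw r (\<lambda>q s. sw m (\<lambda>m1 n. sw n (\<lambda>m2 m3.
        sw p (\<lambda>p1 p2. sw m1 (\<lambda>n1 n2. sigma_inv_mult p1 n1
            (sigma_mult p2 n2 (sigma_mult x (q * m2) (sigma_inv_mult (y * s) m3 b))))))))))"
    by (simp add: tag_start[of h _ 0] tag_start[of k _ 1] tag_start[of m _ 2] sigma_mult_nf)
  also have "\<dots> = sw h (\<lambda>h1 h2. sw k (\<lambda>k1 k2. sw m
      (\<lambda>m1 m2. sigma_mult h1 (k1 * m1) (sigma_inv_mult (h2 * k2) m2 b))))"
    by (simp add: sigma_inv_mult_cancel counit_simps tfold_scale counits)
  finally show ?thesis .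
qed

text \<open>The key to \<open>cleft_inv_mult_right\<close>. Take \<open>k = S y\<close> in
  \<open>sigma_mult_exchange\<close>: since the antipode reverses the coproduct, the arguments
  become \<open>\<sigma> h1 (S h4 * h5)\<close> and \<open>\<sigma>i (h2 * S h3) h6\<close>, and
  both antipode products collapse to scalars.\<close>

lemma sigma_mult_antipode:
  "sw h (\<lambda>x r. sw r (\<lambda>y s. sw s (\<lambda>z w. sigma_mult x (S y) (sigma_inv_mult (S z) w b)))) = \<epsilon> h *\<^sub>C b"
proof -
  have "sw h (\<lambda>x r. sw r (\<lambda>y s. sw s (\<lambda>z w. sigma_mult x (S y) (sigma_inv_mult (S z) w b))))
    = sw h (\<lambda>x s. sw s (\<lambda>y m. sw (S y) (\<lambda>k1 k2. sigma_mult x k2 (sigma_inv_mult k1 m b))))"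
    by (simp add: sw_S tag_start[of h _ 0] sigma_mult_nf)
  also have "\<dots> = sw h (\<lambda>x s. sw s (\<lambda>y m. sw x (\<lambda>h1 h2. sw (S y)
      (\<lambda>k1 k2. sw m (\<lambda>m1 m2. sigma_mult h1 (k1 * m1) (sigma_inv_mult (h2 * k2) m2 b))))))"
    by (simp only: sigma_mult_exchange)
  also have "\<dots> = sw h (\<lambda>x r. sw r (\<lambda>y s. sw s (\<lambda>z w. sigma_mult x (sw z (\<lambda>p q. S p * q))
      (sigma_inv_mult (sw y (\<lambda>p q. p * S q)) w b))))"
    by (simp add: sw_S tag_start[of h _ 0] sigma_mult_nf sigma_mult_push)
  also have "\<dots> = \<epsilon> h *\<^sub>C b"
    by (simp add: sw_antipode_left[of "\<lambda>x. x"] sw_antipode_right[of "\<lambda>x. x"]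
        sigma_mult_scale_subject sigma_mult_one sigma_inv_mult_one sigma_mult_scale tfold_scale
        counits)
  finally show ?thesis .
qed

text \<open>Because the antipode reverses the coproduct, \<open>\<sigma>i\<close> and
  \<open>\<sigma>\<close> meet at consecutive legs of a single \<open>S p\<close> and a single
  \<open>q\<close> and cancel. In the Hopf algebra component \<open>S x * d\<close> remains.\<close>

lemma cleft_inv_mult_left:
  "sw h (\<lambda>x y. crossed_mult (cleft_inv b x) (c \<otimes> y)) = \<epsilon> h *\<^sub>C ((b * c) \<otimes> 1)"
proof -
  have "sw h (\<lambda>x y. crossed_mult (cleft_inv b x) (c \<otimes> y)) = sw h (\<lambda>x r. sw r (\<lambda>m d.
      sw m (\<lambda>p q. sw (S p) (\<lambda>p1 p2. sw q (\<lambda>q1 q2. sigma_inv_mult p1 q1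
          (sigma_mult p2 q2 (b * c))))) \<otimes> (S x * d)))"
    by (simp add: cleft_inv_def crossed_mult_def tag_start[of h _ 0] sigma_mult_nf sw_S)
  also have "\<dots> = \<epsilon> h *\<^sub>C ((b * c) \<otimes> 1)"
    by (simp add: sigma_inv_mult_cancel tfold_scale scaleC_out counits
        sw_antipode_left[of "\<lambda>x. w \<otimes> x" for w])
  finally show ?thesis .
qed

text \<open>The Hopf algebra component \<open>h2 * S h3\<close> collapses first; this leaves the
  coefficient \<open>\<sigma> h1 (S h2) * \<sigma>i (S h3) h4\<close>, up to renumbering of legs,
  which is \<open>sigma_mult_antipode\<close>.\<close>

lemma cleft_inv_mult_right:
  "sw h (\<lambda>x y. crossed_mult (c \<otimes> x) (cleft_inv b y)) = \<epsilon> h *\<^sub>C ((c * b) \<otimes> 1)"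
proof -
  have "sw h (\<lambda>x y. crossed_mult (c \<otimes> x) (cleft_inv b y))
      = sw h (\<lambda>x r. sw r (\<lambda>m s. sw s (\<lambda>y r. sw r (\<lambda>z w.
      sigma_mult x (S y) (sigma_inv_mult (S z) w (c * b)) \<otimes> sw m (\<lambda>p q. p * S q)))))"
    by (simp add: cleft_inv_def crossed_mult_def tag_start[of h _ 0] sigma_mult_nf sw_S)
  also have "\<dots> = sw h (\<lambda>x r. sw r (\<lambda>y s. sw s (\<lambda>z w. sigma_mult x (S y)
      (sigma_inv_mult (S z) w (c * b))))) \<otimes> 1"
    by (simp add: sw_antipode_right[of "\<lambda>x. x"] tfold_scale scaleC_out counits tfold_tensor_left)
  finally show ?thesis by (simp add: sigma_mult_antipode scaleC_out)
qed

text \<open>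
  \<open>b j\<^sup>-\<^sup>1(h\<^sub>1 g\<^sub>1) \<sigma>\<^sup>-\<^sup>1(h\<^sub>2, g\<^sub>2)\<close> and \<open>b j\<^sup>-\<^sup>1(g) j\<^sup>-\<^sup>1(h)\<close> agree: up to the factor \<open>b\<close>
  both are convolution inverse to \<open>j(h) j(g) = \<sigma>(h\<^sub>1, g\<^sub>1) j(h\<^sub>2 g\<^sub>2)\<close>.
\<close>

definition cleft_inv2 where
  "cleft_inv2 b h g = sw h (\<lambda>h1 h2. sw g (\<lambda>g1 g2. cleft_inv (sigma_inv_mult h2 g2 b) (h1 * g1)))"

lemma clinear_cleft_inv2 [linear_intros, simp]:
  "clinear f \<Longrightarrow> clinear (\<lambda>x. cleft_inv2 (f x) h k)"
  "clinear g \<Longrightarrow> clinear (\<lambda>x. cleft_inv2 b (g x) k)"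
  "clinear g \<Longrightarrow> clinear (\<lambda>x. cleft_inv2 b h (g x))"
  by (simp_all add: cleft_inv2_def)

lemma crossed_mult_out:
  "crossed_mult (tfold t f) Y = tfold t (\<lambda>x y. crossed_mult (f x y) Y)"
  "crossed_mult X (tfold t f) = tfold t (\<lambda>x y. crossed_mult X (f x y))"
  "crossed_mult (c *\<^sub>C X) Y = c *\<^sub>C crossed_mult X Y"
  "crossed_mult X (c *\<^sub>C Y) = c *\<^sub>C crossed_mult X Y"
  by (rule tfold_push clinear_scaleC, simp)+

lemma cleft_inv_out: "cleft_inv b (tfold t g) = tfold t (\<lambda>x y. cleft_inv b (g x y))"
  "cleft_inv (c *\<^sub>C b) h = c *\<^sub>C cleft_inv b h" "cleft_inv b (c *\<^sub>C h) = c *\<^sub>C cleft_inv b h"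
  by (rule tfold_push clinear_scaleC, simp)+

text \<open>\<open>j h2 * j g2\<close> expands to \<open>\<sigma>\<close> times \<open>j\<close> of
  a product. At that product \<open>cleft_inv_mult_right\<close> removes \<open>j\<close> together
  with its inverse, and \<open>\<sigma>\<close> then cancels against the \<open>\<sigma>i\<close>
  built into \<open>cleft_inv2\<close>.\<close>

lemma cleft_inv2_mult:
  "sw h (\<lambda>h1 h2. sw g (\<lambda>g1 g2. crossed_mult (crossed_mult (1 \<otimes> h1) (1 \<otimes> g1)) (cleft_inv2 b h2 g2)))
      = \<epsilon> h *\<^sub>C \<epsilon> g *\<^sub>C (b \<otimes> 1)"
proof -
  have "sw h (\<lambda>h1 h2. sw g (\<lambda>g1 g2. crossed_mult (crossed_mult (1 \<otimes> h1) (1 \<otimes> g1))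
      (cleft_inv2 b h2 g2)))
    = sw h (\<lambda>h1 r. sw r (\<lambda>h2 h3. sw g (\<lambda>g1 s. sw s (\<lambda>g2 g3. sw (h2 * g2)
        (\<lambda>x y. crossed_mult (sigma_mult h1 g1 1 \<otimes> x) (cleft_inv (sigma_inv_mult h3 g3 b) y))))))"
    by (simp add: cleft_inv2_def crossed_mult_tensor tag_start[of h _ 0] tag_start[of g _ 1]
        sigma_mult_nf crossed_mult_out)
  also have "\<dots> = sw h (\<lambda>h1 h2. sw g (\<lambda>g1 g2. sigma_mult h1 g1 (sigma_inv_mult h2 g2 b))) \<otimes> 1"
    by (simp add: cleft_inv_mult_right counit_simps tfold_scale counits sigma_mult_left scaleC_out
        tfold_tensor_left)
  finally show ?thesis by (simp add: sigma_mult_cancel scaleC_out)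
qed

text \<open>A unit is inserted on the right in the form provided by \<open>cleft_inv2_mult\<close>.
  Then the inverse at \<open>h\<close> meets \<open>j\<close> at \<open>h\<close>, leaving
  \<open>b\<close> in the middle, and after that the inverse at \<open>g\<close> meets
  \<open>j\<close> at \<open>g\<close>.\<close>

lemma cleft_inv_cleft_inv: "crossed_mult (cleft_inv c g) (cleft_inv b h) = cleft_inv2 (c * b) h g"
proof -
  have "crossed_mult (cleft_inv c g) (cleft_inv b h) = sw h
      (\<lambda>h1 h2. sw g (\<lambda>g1 g2. crossed_mult (crossed_mult (cleft_inv c g1) (cleft_inv b h1))
      (\<epsilon> h2 *\<^sub>C \<epsilon> g2 *\<^sub>C (1 \<otimes> 1))))"
    by (simp add: crossed_mult_out counit_simps tfold_scale counits)
  also have "\<dots> = sw h (\<lambda>h1 r. sw g (\<lambda>g1 s. crossed_mult (crossed_mult (cleft_inv c g1)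
      (cleft_inv b h1)) (sw r (\<lambda>h2 h3. sw s
      (\<lambda>g2 g3. crossed_mult (crossed_mult (1 \<otimes> h2) (1 \<otimes> g2)) (cleft_inv2 1 h3 g3))))))"
    by (simp only: cleft_inv2_mult)
  also have "\<dots> = sw h (\<lambda>x h3. sw g (\<lambda>g1 s. sw s (\<lambda>g2 g3. crossed_mult (cleft_inv c g1)
      (crossed_mult (sw x (\<lambda>h1 h2. crossed_mult (cleft_inv b h1) (1 \<otimes> h2)))
      (crossed_mult (1 \<otimes> g2) (cleft_inv2 1 h3 g3))))))"
    by (simp add: crossed_mult_assoc tag_start[of h _ 0] tag_start[of g _ 1] sigma_mult_nf
        crossed_mult_out)
  also have "\<dots> = sw g (\<lambda>g1 s. sw s (\<lambda>g2 g3. crossed_mult (cleft_inv c g1)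
      (crossed_mult (b \<otimes> 1) (crossed_mult (1 \<otimes> g2) (cleft_inv2 1 h g3)))))"
    by (simp add: cleft_inv_mult_left crossed_mult_out tfold_scale counits)
  also have "\<dots> = sw g (\<lambda>y g3. crossed_mult (sw y (\<lambda>g1 g2. crossed_mult (cleft_inv c g1) (b \<otimes> g2)))
      (cleft_inv2 1 h g3))"
    by (simp add: crossed_mult_incl_left[of _ "_ \<otimes> _"] crossed_mult_assoc[symmetric]
        tag_start[of g _ 0] sigma_mult_nf crossed_mult_out)
  also have "\<dots> = crossed_mult ((c * b) \<otimes> 1) (cleft_inv2 1 h g)"
    by (simp add: cleft_inv_mult_left crossed_mult_out tfold_scale counits)
  also have "\<dots> = cleft_inv2 (c * b) h g"
    by (simp add: cleft_inv2_def crossed_mult_out cleft_inv_incl_left sigma_mult_right)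
  finally show ?thesis .
qed

section \<open>The parametrisation of the coinvariants and its left inverse\<close>

definition base_proj :: "'b \<otimes> 'h \<Rightarrow> 'b" where "base_proj X = tfold X (\<lambda>b h. \<epsilon> h *\<^sub>C b)"

lemma clinear_base_proj [linear_intros, simp]: "clinear f \<Longrightarrow> clinear (\<lambda>x. base_proj (f x))"
  by (simp add: base_proj_def)

lemma base_proj_tensor [simp]: "base_proj (b \<otimes> h) = \<epsilon> h *\<^sub>C b"
  by (simp add: base_proj_def)

lemma base_proj_mult_incl:
  "base_proj (crossed_mult (b \<otimes> 1) X) = b * base_proj X"
  "base_proj (crossed_mult X (b \<otimes> 1)) = base_proj X * b"
  by (simp_all add: base_proj_def crossed_mult_incl_left crossed_mult_incl_right tfold_tfold
      tensor_nf)

lemma base_proj_out: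
  "base_proj (tfold t f) = tfold t (\<lambda>x y. base_proj (f x y))"
  "base_proj (c *\<^sub>C X) = c *\<^sub>C base_proj X"
  by (rule tfold_push clinear_scaleC, simp)+

definition \<Phi> :: "'b \<otimes> 'b \<otimes> 'h \<Rightarrow> ('b \<otimes> 'h) \<otimes> ('b \<otimes> 'h)" where
  "\<Phi> m = tfold m (\<lambda>b r. tfold r (\<lambda>b' h. sw h (\<lambda>x y. (b \<otimes> x) \<otimes> cleft_inv b' y)))"

text \<open>On the image of \<open>\<Phi>\<close> the second leg is
  \<open>z = b' j\<^sup>-\<^sup>1(h\<^sub>3)\<close>; multiplying it by \<open>j(h\<^sub>2)\<close>
  from the left frees \<open>b'\<close>. Reading off the coefficient with \<open>base_proj\<close>
  keeps the map linear on all pairs, coinvariant or not.\<close>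

definition Phi_inv :: "('b \<otimes> 'h) \<otimes> ('b \<otimes> 'h) \<Rightarrow> 'b \<otimes> 'b \<otimes> 'h" where
  "Phi_inv w = tfold w (\<lambda>a z. tfold a (\<lambda>b h. sw h
      (\<lambda>x y. b \<otimes> base_proj (crossed_mult (1 \<otimes> y) z) \<otimes> x)))"

lemma clinear_Phi [linear_intros, simp]: "clinear f \<Longrightarrow> clinear (\<lambda>x. \<Phi> (f x))"
  by (simp add: \<Phi>_def)

lemma clinear_Phi_inv [linear_intros, simp]: "clinear f \<Longrightarrow> clinear (\<lambda>x. Phi_inv (f x))"
  by (simp add: Phi_inv_def)

lemma Phi_tensor: "\<Phi> (b \<otimes> b' \<otimes> h) = sw h (\<lambda>x y. (b \<otimes> x) \<otimes> cleft_inv b' y)"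
  by (simp add: \<Phi>_def)

lemma Phi_inv_Phi_tensor: "Phi_inv (\<Phi> (b \<otimes> b' \<otimes> h)) = b \<otimes> b' \<otimes> h"
proof -
  have "Phi_inv (\<Phi> (b \<otimes> b' \<otimes> h)) = sw h (\<lambda>x r. b \<otimes> base_proj
      (sw r (\<lambda>y z. crossed_mult (1 \<otimes> y) (cleft_inv b' z))) \<otimes> x)"
    by (simp add: Phi_inv_def \<Phi>_def tag_start[of h _ 0] sigma_mult_nf base_proj_out
        crossed_mult_out)
  also have "\<dots> = b \<otimes> b' \<otimes> h"
    by (simp add: cleft_inv_mult_right base_proj_out counit_one scaleC_out counits)
  finally show ?thesis .
qed

lemma Phi_inv_Phi [simp]: "Phi_inv (\<Phi> m) = m"
  by (rule tensor_ext[of "\<lambda>m. Phi_inv (\<Phi> m)" "\<lambda>m. m"], simp, simp,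
      rule tensor_ext[of "\<lambda>r. Phi_inv (\<Phi> (_ \<otimes> r))" "\<lambda>r. _ \<otimes> r"], simp, simp, rule
          Phi_inv_Phi_tensor)

end

section \<open>The model of the bialgebroid\<close>

lemma subspace_sum_list: "csubspace T \<Longrightarrow> (\<And>x. x \<in> set xs \<Longrightarrow> f x \<in> T) \<Longrightarrow> (\<Sum>x\<leftarrow>xs. f x) \<in> T"
  by (induction xs) (simp_all add: cvec.subspace_0 cvec.subspace_add)

lemma tfold_in_subspace:
  assumes "csubspace T" "\<And>x y. f x y \<in> T" shows "tfold t f \<in> T"
  unfolding tfold_def split_def by (rule subspace_sum_list[OF assms(1)]) (rule assms(2))

lemma tensor_in_subspace:
  assumes "csubspace T" "clinear f" "\<And>x y. f (x \<otimes> y) \<in> T" shows "f t \<in> T"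
  using tfold_in_subspace[OF assms(1), of "\<lambda>x y. f (x \<otimes> y)" t] assms(3)
  by (simp add: tfold_linear_tensor[OF assms(2)])

lemma linear_span_zero:
  assumes "clinear f" "\<And>x. x \<in> X \<Longrightarrow> f x = 0" "z \<in> cspan X" shows "f z = 0"
  using assms(3)
proof (induction rule: cvec.span_induct_alt)
  case base show ?case by (rule clinear_zero[OF assms(1)])
next
  case (step c x y)
  then show ?case by (simp add: clinear_add[OF assms(1)] clinear_scaleC[OF assms(1)] assms(2))
qed

lemma linear_span_in:
  assumes "clinear f" "csubspace T" "\<And>x. x \<in> X \<Longrightarrow> f x \<in> T" "z \<in> cspan X" shows "f z \<in> T"
  using assms(4)
proof (induction rule: cvec.span_induct_alt)
  case base show ?case using clinear_zero[OF assms(1)] cvec.subspace_0[OF assms(2)] by simp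
next
  case (step c x y)
  then show ?case
    by (simp add: clinear_add[OF assms(1)] clinear_scaleC[OF assms(1)] assms(3)
        cvec.subspace_add[OF assms(2)] cvec.subspace_scale[OF assms(2)])
qed

lemma coset_eqI: "csubspace J \<Longrightarrow> v - w \<in> J \<Longrightarrow> coset J v = coset J w"
proof -
  assume J: "csubspace J" and vw: "v - w \<in> J"
  have "x - v \<in> J \<longleftrightarrow> x - w \<in> J" for x
    using cvec.subspace_add[OF J _ vw, of "x - v"] cvec.subspace_diff[OF J _ vw, of "x - w"]
    by (auto simp: algebra_simps)
  then show ?thesis by (simp add: coset_def)
qed

lemma in_coset_self: "csubspace J \<Longrightarrow> v \<in> coset J v"
  by (simp add: coset_def cvec.subspace_0)

lemma tensor3_ext:
  assumes "clinear f" "clinear g" "\<And>b b' h. f (b \<otimes> b' \<otimes> h) = g (b \<otimes> b' \<otimes> h)"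
  shows "f m = g m"
proof (rule tensor_ext[OF assms(1,2)])
  fix b r show "f (b \<otimes> r) = g (b \<otimes> r)"
    by (rule tensor_ext[of "\<lambda>r. f (b \<otimes> r)" "\<lambda>r. g (b \<otimes> r)"])
      (intro clinear_compose[OF assms(1)] clinear_compose[OF assms(2)] clinear_tensor_right
          clinear_ident assms(3))+
qed

text \<open>
  In \<open>B \<otimes> B \<otimes> H\<close>, \<open>tgt_mult \<beta>\<close> and \<open>src_mult \<beta>\<close> are the left multiplications by \<open>t(\<beta>)\<close> and
  \<open>s(\<beta>)\<close>. Moving \<open>b'\<close> from \<open>(b, b', h) \<otimes> n\<close> to the right is a normal form modulo the
  balancing relations, so these are the kernel of \<open>bal_nf\<close>.
\<close>

definition tgt_mult :: "'b \<Rightarrow> 'b \<otimes> 'b \<otimes> 'h \<Rightarrow> 'b::complex_algebra \<otimes> 'b \<otimes> 'h::complex_vector" where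
  "tgt_mult \<beta> m = tfold m (\<lambda>b r. tfold r (\<lambda>b' h. b \<otimes> (b' * \<beta>) \<otimes> h))"

definition src_mult :: "'b \<Rightarrow> 'b \<otimes> 'b \<otimes> 'h \<Rightarrow> 'b::complex_algebra \<otimes> 'b \<otimes> 'h::complex_vector" where
  "src_mult \<beta> m = tfold m (\<lambda>b r. (\<beta> * b) \<otimes> r)"

definition bal_nf :: "('b \<otimes> 'b \<otimes> 'h) \<otimes> ('b \<otimes> 'b \<otimes> 'h) \<Rightarrow>
    ('b::complex_algebra \<otimes> 'b \<otimes> 'h::complex_vector) \<otimes> ('b \<otimes> 'b \<otimes> 'h)" where
  "bal_nf z = tfold z (\<lambda>m n. tfold m (\<lambda>b r. tfold r (\<lambda>b' h. (b \<otimes> 1 \<otimes> h) \<otimes> src_mult b' n)))"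

definition bal_model :: "(('b::complex_algebra \<otimes> 'b \<otimes> 'h::complex_vector) \<otimes> ('b \<otimes> 'b \<otimes> 'h)) set"
    where
  "bal_model = cspan {tgt_mult \<beta> m \<otimes> n - m \<otimes> src_mult \<beta> n | \<beta> m n. True}"

lemma clinear_tgt_mult [linear_intros, simp]:
  "clinear f \<Longrightarrow> clinear (\<lambda>x. tgt_mult (f x) m)"
  "clinear g \<Longrightarrow> clinear (\<lambda>x. tgt_mult b (g x))"
  "clinear f \<Longrightarrow> clinear (\<lambda>x. src_mult (f x) m)"
  "clinear g \<Longrightarrow> clinear (\<lambda>x. src_mult b (g x))"
  by (simp_all add: tgt_mult_def src_mult_def)

lemma clinear_bal_nf [linear_intros, simp]: "clinear g \<Longrightarrow> clinear (\<lambda>x. bal_nf (g x))"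
  by (simp_all add: bal_nf_def)

lemma tgt_mult_tensor [simp]: "tgt_mult \<beta> (b \<otimes> b' \<otimes> h) = b \<otimes> (b' * \<beta>) \<otimes> h"
  by (simp add: tgt_mult_def)

lemma src_mult_tensor [simp]: "src_mult \<beta> (b \<otimes> r) = (\<beta> * b) \<otimes> r"
  by (simp add: src_mult_def)

lemma csubspace_bal_model [simp]: "csubspace bal_model"
  by (simp add: bal_model_def)

text \<open>On simple tensors one relator suffices, because
  \<open>b \<otimes> b' \<otimes> h\<close> is \<open>tgt_mult b'\<close> of
  \<open>b \<otimes> 1 \<otimes> h\<close>.\<close>

lemma bal_nf_bal_model: "z - bal_nf z \<in> bal_model"
proof -
  have "m \<otimes> n - bal_nf (m \<otimes> n) \<in> bal_model" for m n :: "'a \<otimes> 'a \<otimes> 'b"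
  proof (rule tensor_in_subspace[of bal_model "\<lambda>m. m \<otimes> n - bal_nf (m \<otimes> n)"], simp, simp)
    fix b :: 'a and r :: "'a \<otimes> 'b"
    show "(b \<otimes> r) \<otimes> n - bal_nf ((b \<otimes> r) \<otimes> n) \<in> bal_model"
    proof (rule tensor_in_subspace[of bal_model "\<lambda>r. (b \<otimes> r) \<otimes> n - bal_nf ((b \<otimes> r) \<otimes> n)"], simp,
        simp)
      fix b' h
      have "(b \<otimes> b' \<otimes> h) \<otimes> n - bal_nf ((b \<otimes> b' \<otimes> h) \<otimes> n)
          = tgt_mult b' (b \<otimes> 1 \<otimes> h) \<otimes> n - (b \<otimes> 1 \<otimes> h) \<otimes> src_mult b' n"
        by (simp add: bal_nf_def tfold_tensor_left)
      also have "\<dots> \<in> bal_model" unfolding bal_model_def by (rule cvec.span_base) blast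
      finally show "(b \<otimes> b' \<otimes> h) \<otimes> n - bal_nf ((b \<otimes> b' \<otimes> h) \<otimes> n) \<in> bal_model" .
    qed
  qed
  then show ?thesis
    by - (rule tensor_in_subspace[of bal_model "\<lambda>z. z - bal_nf z"], simp_all)
qed

lemma src_mult_src_mult: "src_mult \<alpha> (src_mult \<beta> m) = src_mult (\<alpha> * \<beta>) m"
  by (simp add: src_mult_def tfold_tfold mult.assoc)

lemma bal_nf_relator: "bal_nf (tgt_mult \<beta> m \<otimes> n) = bal_nf (m \<otimes> src_mult \<beta> n)"
  by (simp add: bal_nf_def tgt_mult_def tfold_tfold src_mult_src_mult)

lemma bal_nf_zero_bal_model: "z \<in> bal_model \<Longrightarrow> bal_nf z = 0"
  unfolding bal_model_def
  by (rule linear_span_zero[of bal_nf]) (use clinear_bal_nf[OF clinear_ident] in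
      \<open>auto simp: clinear_diff bal_nf_relator\<close>)

text \<open>Turns congruence modulo the balancing relations into an equation that rewriting can
  settle.\<close>

lemma bal_model_iff: "z \<in> bal_model \<longleftrightarrow> bal_nf z = 0"
  using bal_nf_zero_bal_model bal_nf_bal_model[of z] by fastforce

context hopf_algebra
begin

text \<open>This is \<open>a\<^sub>0 \<otimes> \<tau>(a\<^sub>1) \<otimes> a'\<close> for
  \<open>a = b j(h\<^sub>1)\<close> and \<open>a' = b' j\<^sup>-\<^sup>1(h\<^sub>2)\<close>. As
  \<open>\<tau>(h) = j\<^sup>-\<^sup>1(h\<^sub>1) \<otimes> j(h\<^sub>2)\<close>, the inner legs
  carry the coefficient 1.\<close>

definition model_cop :: "'b::complex_algebra \<otimes> 'b \<otimes> 'h \<Rightarrow> ('b \<otimes> 'b \<otimes> 'h) \<otimes> ('b \<otimes> 'b \<otimes> 'h)" where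
  "model_cop m = tfold m (\<lambda>b r. tfold r (\<lambda>b' h. sw h (\<lambda>x y. (b \<otimes> 1 \<otimes> x) \<otimes> (1 \<otimes> b' \<otimes> y))))"

text \<open>The product of the two legs,
  \<open>b j(h\<^sub>1) b' j\<^sup>-\<^sup>1(h\<^sub>2)\<close>, after \<open>j\<close> and its
  inverse have cancelled.\<close>

definition model_cou :: "'b::complex_algebra \<otimes> 'b \<otimes> 'h \<Rightarrow> 'b" where
  "model_cou m = tfold m (\<lambda>b r. tfold r (\<lambda>b' h. \<epsilon> h *\<^sub>C (b * b')))"

lemma clinear_model_cop [linear_intros, simp]:
  "clinear f \<Longrightarrow> clinear (\<lambda>x. model_cop (f x))"
  "clinear g \<Longrightarrow> clinear (\<lambda>x. model_cou (g x))"
  by (simp_all add: model_cop_def model_cou_def)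

lemma model_cop_tensor: "model_cop (b \<otimes> b' \<otimes> h) = sw h (\<lambda>x y. (b \<otimes> 1 \<otimes> x) \<otimes> (1 \<otimes> b' \<otimes> y))"
  by (simp add: model_cop_def)

lemma model_cou_tensor: "model_cou (b \<otimes> b' \<otimes> h) = \<epsilon> h *\<^sub>C (b * b')"
  by (simp add: model_cou_def)

lemma coact_right_eq: "coact_right \<Delta> X = tfold X (\<lambda>b h. sw h (\<lambda>x y. (b \<otimes> x) \<otimes> y))"
  by (simp add: coact_right_def sw2_eq sum_list_simple)

lemma clinear_coact_right [linear_intros, simp]: "clinear f \<Longrightarrow> clinear (\<lambda>x. coact_right \<Delta> (f x))"
  by (simp add: coact_right_eq)

end

context central_cocycle
begin

definition model_mult where
  "model_mult m n = tfold m (\<lambda>b r. tfold r (\<lambda>b' h. tfold n (\<lambda>c q. tfold q (\<lambda>c' g.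
    sw h (\<lambda>h1 s. sw s (\<lambda>h2 h3. sw g (\<lambda>g1 t. sw t (\<lambda>g2 g3.
      sigma_mult h1 g1 (b * c) \<otimes> sigma_inv_mult h3 g3 (c' * b') \<otimes> (h2 * g2)))))))))"

lemma clinear_model_mult [linear_intros, simp]:
  "clinear f \<Longrightarrow> clinear (\<lambda>x. model_mult (f x) m)"
  "clinear g \<Longrightarrow> clinear (\<lambda>x. model_mult m (g x))"
  by (simp_all add: model_mult_def)

lemma model_mult_tensor:
  "model_mult (b \<otimes> b' \<otimes> h) (c \<otimes> c' \<otimes> g) = sw h (\<lambda>h1 s. sw s (\<lambda>h2 h3. sw g (\<lambda>g1 t. sw t (\<lambda>g2 g3.
      sigma_mult h1 g1 (b * c) \<otimes> sigma_inv_mult h3 g3 (c' * b') \<otimes> (h2 * g2)))))"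
  by (simp add: model_mult_def)

section \<open>The translation map and the coinvariants\<close>

definition crossed_ext :: "('b \<otimes> 'h, 'b, 'h) extension" where
  "crossed_ext = \<lparr>amul = crossed_mult, aone = 1 \<otimes> 1, coact = coact_right \<Delta>, incl = (\<lambda>b. b \<otimes> 1)\<rparr>"

lemma crossed_ext_simps [simp]:
  "amul crossed_ext = crossed_mult"
  "aone crossed_ext = 1 \<otimes> 1"
  "coact crossed_ext = coact_right \<Delta>"
  "incl crossed_ext = (\<lambda>b. b \<otimes> 1)"
  by (simp_all add: crossed_ext_def)

text \<open>
  The canonical map before passing to the quotient \<open>A \<otimes>\<^sub>B A\<close>.
\<close>

definition chi where
  "chi w = tfold w (\<lambda>a z. tfold z (\<lambda>b h. sw h (\<lambda>x y. crossed_mult a (b \<otimes> x) \<otimes> y)))"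

lemma clinear_chi [linear_intros, simp]: "clinear f \<Longrightarrow> clinear (\<lambda>x. chi (f x))"
  by (simp add: chi_def)

lemma canonical_map_eq: "canonical_map crossed_ext Z = chi (SOME z. z \<in> Z)"
  by (simp add: canonical_map_def chi_def sum_list_simple coact_right_eq tfold_tfold)

lemma chi_relator: "chi (crossed_mult x (b \<otimes> 1) \<otimes> y) = chi (x \<otimes> crossed_mult (b \<otimes> 1) y)"
  by (simp add: chi_def crossed_mult_assoc crossed_mult_incl_left tfold_tfold)

lemma csubspace_ext_bal [simp]: "csubspace (ext_bal crossed_ext)"
  by (simp add: ext_bal_def)

lemma chi_ext_bal: "z \<in> ext_bal crossed_ext \<Longrightarrow> chi z = 0"
  unfolding ext_bal_def
  by (rule linear_span_zero[of chi]) (use clinear_chi[OF clinear_ident] in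
      \<open>auto simp: clinear_diff chi_relator\<close>)

text \<open>Sends \<open>a \<otimes> h\<close> to \<open>a\<close> times the expected translation
  map at \<open>h\<close>; it inverts \<open>chi\<close> modulo \<open>ext_bal\<close>.\<close>

definition chi_inv :: "('b \<otimes> 'h) \<otimes> 'h \<Rightarrow> ('b \<otimes> 'h) \<otimes> ('b \<otimes> 'h)" where
  "chi_inv t = tfold t (\<lambda>a h. sw h (\<lambda>x y. crossed_mult a (cleft_inv 1 x) \<otimes> (1 \<otimes> y)))"

lemma clinear_chi_inv [linear_intros, simp]: "clinear f \<Longrightarrow> clinear (\<lambda>x. chi_inv (f x))"
  by (simp add: chi_inv_def)

text \<open>For a second leg \<open>b \<otimes> h\<close> the first leg ends in
  \<open>b j(h\<^sub>1) j\<^sup>-\<^sup>1(h\<^sub>2)\<close>, which contracts to \<open>b\<close>.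
  The result differs from the original tensor by the single relator that moves \<open>b\<close>
  across.\<close>

lemma chi_inv_chi: "chi_inv (chi z) - z \<in> ext_bal crossed_ext"
proof (rule tensor_in_subspace[of _ "\<lambda>z. chi_inv (chi z) - z"], simp, simp)
  fix a y
  show "chi_inv (chi (a \<otimes> y)) - a \<otimes> y \<in> ext_bal crossed_ext"
  proof (rule tensor_in_subspace[of _ "\<lambda>y. chi_inv (chi (a \<otimes> y)) - a \<otimes> y"], simp, simp)
    fix b h
    have "chi_inv (chi (a \<otimes> b \<otimes> h)) = sw h (\<lambda>x z. crossed_mult a
        (sw x (\<lambda>x y. crossed_mult (b \<otimes> x) (cleft_inv 1 y))) \<otimes> 1 \<otimes> z)"
      by (simp add: chi_inv_def chi_def crossed_mult_assoc tag_start[of h _ 0] sigma_mult_nf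
          crossed_mult_out)
    also have "\<dots> = crossed_mult a (b \<otimes> 1) \<otimes> 1 \<otimes> h"
      by (simp add: cleft_inv_mult_right crossed_mult_out scaleC_out counits)
    finally have "chi_inv (chi (a \<otimes> b \<otimes> h)) - a \<otimes> b \<otimes> h
        = crossed_mult a (b \<otimes> 1) \<otimes> (1 \<otimes> h) - a \<otimes> crossed_mult (b \<otimes> 1) (1 \<otimes> h)"
      by (simp add: crossed_mult_incl_left)
    also have "\<dots> \<in> ext_bal crossed_ext" unfolding ext_bal_def by (rule cvec.span_base) auto
    finally show "chi_inv (chi (a \<otimes> b \<otimes> h)) - a \<otimes> b \<otimes> h \<in> ext_bal crossed_ext" .
  qed
qed

text \<open>This is injectivity of the canonical map. It replaces arguments about cosets in
  \<open>A \<otimes>\<^sub>B A\<close> by equations between values of \<open>chi\<close>.\<close>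

lemma ext_bal_iff: "z \<in> ext_bal crossed_ext \<longleftrightarrow> chi z = 0"
proof
  assume "chi z = 0"
  then have "- z \<in> ext_bal crossed_ext"
    using chi_inv_chi[of z] clinear_zero[OF clinear_chi_inv[OF clinear_ident]] by simp
  then show "z \<in> ext_bal crossed_ext"
    using cvec.subspace_neg[OF csubspace_ext_bal, of "- z"] by simp
qed (rule chi_ext_bal)

lemma chi_diff: "chi (x - y) = chi x - chi y"
  by (rule clinear_diff) simp

lemma chi_some_coset: "chi (SOME z. z \<in> coset (ext_bal crossed_ext) w) = chi w"
proof -
  have "(SOME z. z \<in> coset (ext_bal crossed_ext) w) \<in> coset (ext_bal crossed_ext) w"
    by (rule someI[where x = w]) (simp add: in_coset_self)
  then show ?thesis by (simp add: coset_def ext_bal_iff chi_diff)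
qed

text \<open>The translation map as an honest element of \<open>A \<otimes> A\<close>, linear in
  \<open>h\<close>, in contrast to the chosen representatives.\<close>

definition tau_rep :: "'h \<Rightarrow> ('b \<otimes> 'h) \<otimes> ('b \<otimes> 'h)" where
  "tau_rep h = sw h (\<lambda>x y. cleft_inv 1 x \<otimes> (1 \<otimes> y))"

lemma clinear_tau_rep [linear_intros, simp]: "clinear f \<Longrightarrow> clinear (\<lambda>x. tau_rep (f x))"
  by (simp add: tau_rep_def)

lemma chi_tau_rep: "chi (tau_rep h) = (1 \<otimes> 1) \<otimes> h"
proof -
  have "chi (tau_rep h) = sw h (\<lambda>m z. sw m (\<lambda>x y. crossed_mult (cleft_inv 1 x) (1 \<otimes> y)) \<otimes> z)"
    by (simp add: tau_rep_def chi_def tag_start[of h _ 0] sigma_mult_nf)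
  also have "\<dots> = (1 \<otimes> 1) \<otimes> h"
    by (simp add: cleft_inv_mult_left scaleC_out counits)
  finally show ?thesis .
qed

text \<open>\<open>inv_into\<close> returns this coset because the canonical map is injective on
  cosets and takes the right value on it.\<close>

lemma translation_eq: "translation crossed_ext h = coset (ext_bal crossed_ext) (tau_rep h)"
proof -
  have "inj_on (canonical_map crossed_ext) (range (coset (ext_bal crossed_ext)))"
    by (auto simp: inj_on_def canonical_map_eq chi_some_coset ext_bal_iff chi_diff intro!:
        coset_eqI)
  then show ?thesis
    using inv_into_f_f[of "canonical_map crossed_ext" "range (coset (ext_bal crossed_ext))" "coset
        (ext_bal crossed_ext) (tau_rep h)"]
    by (simp add: translation_def canonical_map_eq chi_some_coset chi_tau_rep)
qed

text \<open>
  The representative of \<open>\<tau>(h)\<close> used by \<open>tau\<close>. It comes from a choice and is linear in \<open>h\<close>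
  only modulo \<open>ext_bal\<close>, hence it is always compared with \<open>tau_rep\<close>.
\<close>

definition tau_some where "tau_some h = (SOME z. z \<in> translation crossed_ext h)"

lemma tau_eq: "(\<Sum>(x, y)\<leftarrow>tau crossed_ext h. f x y) = tfold (tau_some h) f"
  by (simp add: tau_def tau_some_def tfold_def)

lemma tau_some_tau_rep: "tau_some h - tau_rep h \<in> ext_bal crossed_ext"
  by (simp add: tau_some_def translation_eq ext_bal_iff chi_diff chi_some_coset)

abbreviation bal_right :: "(('b \<otimes> 'h) \<otimes> ('b \<otimes> 'h) \<otimes> ('b \<otimes> 'h)) set" where
  "bal_right \<equiv> cspan {x \<otimes> z | x z. z \<in> ext_bal crossed_ext}"

text \<open>
  The two sides of the equation that defines \<open>es_carrier\<close>, with \<open>\<tau>\<close> replaced by \<open>tau_rep\<close>. A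
  retraction of both sides to \<open>A \<otimes> A\<close> is given by \<open>a \<otimes> u \<otimes> v \<mapsto> a \<otimes> u (id \<otimes> \<epsilon>)(v)\<close>.
\<close>

definition carrier_right :: "('b \<otimes> 'h) \<otimes> ('b \<otimes> 'h) \<Rightarrow> ('b \<otimes> 'h) \<otimes> ('b \<otimes> 'h) \<otimes> ('b \<otimes> 'h)" where
  "carrier_right w = tfold w (\<lambda>a a'. a \<otimes> a' \<otimes> (1 \<otimes> 1))"

definition carrier_left where
  "carrier_left w = tfold w (\<lambda>a a'. tfold (coact_right \<Delta> a)
      (\<lambda>a0 a1. tfold (tau_rep a1) (\<lambda>u v. a0 \<otimes> u \<otimes> crossed_mult v a')))"

lemma clinear_carrier [linear_intros, simp]:
  "clinear f \<Longrightarrow> clinear (\<lambda>x. carrier_right (f x))"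
  "clinear f \<Longrightarrow> clinear (\<lambda>x. carrier_left (f x))"
  by (simp_all add: carrier_right_def carrier_left_def)

text \<open>Right multiplication on the second leg is well defined on
  \<open>A \<otimes>\<^sub>B A\<close>, by associativity.\<close>

lemma ext_bal_mult_right:
  assumes "z \<in> ext_bal crossed_ext" shows "tfold z (\<lambda>u v. u \<otimes> crossed_mult v a) \<in> ext_bal
      crossed_ext"
proof (rule linear_span_in[OF _ csubspace_ext_bal _ assms[unfolded ext_bal_def]])
  show "clinear (\<lambda>z. tfold z (\<lambda>u v. u \<otimes> crossed_mult v a))" by simp
  fix w assume "w \<in> {amul crossed_ext x (incl crossed_ext b) \<otimes> y - x \<otimes> amul crossed_ext
      (incl crossed_ext b) y | x b y. True}"
  then obtain x b y where "w = crossed_mult x (b \<otimes> 1) \<otimes> y - x \<otimes> crossed_mult (b \<otimes> 1) y" by auto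
  then have "tfold w (\<lambda>u v. u \<otimes> crossed_mult v a)
      = crossed_mult x (b \<otimes> 1) \<otimes> crossed_mult y a - x \<otimes> crossed_mult (b \<otimes> 1) (crossed_mult y a)"
    by (simp add: clinear_diff[of "\<lambda>z. tfold z (\<lambda>u v. u \<otimes> crossed_mult v a)"] crossed_mult_assoc)
  then show "tfold w (\<lambda>u v. u \<otimes> crossed_mult v a) \<in> ext_bal crossed_ext"
    by (simp add: ext_bal_iff chi_diff chi_relator)
qed

text \<open>The chosen representatives of the translation map differ from \<open>tau_rep\<close> by
  elements of \<open>ext_bal\<close>. These stay there after multiplication by the second leg, so
  the congruence is unchanged and its left side becomes linear in \<open>w\<close>.\<close>

lemma es_carrier_iff: "w \<in> es_carrier crossed_ext \<longleftrightarrow> carrier_left w - carrier_right w \<in> bal_right"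
proof -
  let ?carrier = "tfold w (\<lambda>a a'. tfold (coact_right \<Delta> a)
      (\<lambda>a0 a1. tfold (tau_some a1) (\<lambda>u v. a0 \<otimes> u \<otimes> crossed_mult v a')))"
  have sub: "csubspace bal_right" by simp
  have "a0 \<otimes> tfold (tau_some a1) (\<lambda>u v. u \<otimes> crossed_mult v a') - a0 \<otimes> tfold (tau_rep a1)
      (\<lambda>u v. u \<otimes> crossed_mult v a') \<in> bal_right" for a0 a1 a'
  proof -
    have "tfold (tau_some a1) (\<lambda>u v. u \<otimes> crossed_mult v a') - tfold (tau_rep a1)
        (\<lambda>u v. u \<otimes> crossed_mult v a')
      = tfold (tau_some a1 - tau_rep a1) (\<lambda>u v. u \<otimes> crossed_mult v a')"
      by (rule clinear_diff[symmetric]) simp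
    then have "tfold (tau_some a1) (\<lambda>u v. u \<otimes> crossed_mult v a') - tfold (tau_rep a1)
        (\<lambda>u v. u \<otimes> crossed_mult v a') \<in> ext_bal crossed_ext"
      using ext_bal_mult_right[OF tau_some_tau_rep[of a1], of a'] by simp
    then have "a0 \<otimes> (tfold (tau_some a1) (\<lambda>u v. u \<otimes> crossed_mult v a') - tfold (tau_rep a1)
        (\<lambda>u v. u \<otimes> crossed_mult v a')) \<in> bal_right"
      by (intro cvec.span_base) blast
    then show ?thesis by (simp add: clinear_diff[of "\<lambda>x. a0 \<otimes> x"])
  qed
  then have "?carrier - carrier_left w \<in> bal_right"
    unfolding carrier_left_def tfold_diff[symmetric] tfold_tensor_right[symmetric]
    by (intro tfold_in_subspace[OF sub])
  then have "?carrier - carrier_right w \<in> bal_right \<longleftrightarrow> carrier_left w - carrier_right w \<in> bal_right"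
    using cvec.subspace_add[OF sub, of "carrier_left w - carrier_right w" "?carrier - carrier_left
        w"] cvec.subspace_diff[OF sub, of "?carrier - carrier_right w" "?carrier - carrier_left w"]
    by auto
  then show ?thesis
    by (simp add: es_carrier_def sum_list_simple tau_eq carrier_right_def)
qed

lemma crossed_mult_incl_incl: "crossed_mult (b \<otimes> 1) (c \<otimes> 1) = (b * c) \<otimes> 1"
  by (simp add: crossed_mult_incl_left)

definition carrier_retract :: "('b \<otimes> 'h) \<otimes> ('b \<otimes> 'h) \<otimes> ('b \<otimes> 'h) \<Rightarrow> ('b \<otimes> 'h) \<otimes> ('b \<otimes> 'h)" where
  "carrier_retract t = tfold t (\<lambda>a r. tfold r (\<lambda>u v. a \<otimes> crossed_mult u (base_proj v \<otimes> 1)))"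

lemma clinear_carrier_retract [linear_intros, simp]:
  "clinear f \<Longrightarrow> clinear (\<lambda>x. carrier_retract (f x))"
  by (simp add: carrier_retract_def)

lemma carrier_retract_bal_right: "z \<in> bal_right \<Longrightarrow> carrier_retract z = 0"
proof (rule linear_span_zero[of carrier_retract])
  show "clinear carrier_retract" using clinear_carrier_retract[OF clinear_ident] .
  fix x :: "('b \<otimes> 'h) \<otimes> ('b \<otimes> 'h) \<otimes> ('b \<otimes> 'h)" assume "x \<in> {x \<otimes> z | x z. z \<in> ext_bal crossed_ext}"
  then obtain y z where x: "x = y \<otimes> z" and z: "z \<in> ext_bal crossed_ext" by blast
  have "tfold z (\<lambda>u v. y \<otimes> crossed_mult u (base_proj v \<otimes> 1)) = 0"
    using z unfolding ext_bal_def
    by (rule linear_span_zero[rotated 2])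
      (auto simp: clinear_diff[of "\<lambda>z. tfold z (\<lambda>u v. y \<otimes> crossed_mult u (base_proj v \<otimes> 1))"]
          base_proj_mult_incl crossed_mult_assoc crossed_mult_incl_incl)
  then show "carrier_retract x = 0" by (simp add: x carrier_retract_def)
qed

lemma carrier_retract_carrier_right: "carrier_retract (carrier_right w) = w"
  by (rule tensor_ext[of "\<lambda>w. carrier_retract (carrier_right w)" "\<lambda>w. w"])
      (simp_all add: carrier_right_def carrier_retract_def counit_one)

text \<open>The retraction multiplies \<open>j\<^sup>-\<^sup>1(h\<^sub>2)\<close> by the base
  component of \<open>j(h\<^sub>3) z\<close>. That component is the middle entry computed by
  \<open>Phi_inv\<close>, and the remaining legs rebuild \<open>\<Phi>\<close>.\<close>

lemma carrier_retract_carrier_left: "carrier_retract (carrier_left w) = \<Phi> (Phi_inv w)"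
proof -
  have "carrier_retract (carrier_left ((b \<otimes> h) \<otimes> z)) = \<Phi> (Phi_inv ((b \<otimes> h) \<otimes> z))" for b h z
    by (simp add: carrier_left_def carrier_retract_def Phi_inv_def \<Phi>_def coact_right_eq tau_rep_def
        cleft_inv_incl_right tag_start[of h _ 0] sigma_mult_nf)
  then have "carrier_retract (carrier_left (a \<otimes> z)) = \<Phi> (Phi_inv (a \<otimes> z))" for a z
    by (rule tensor_ext[of "\<lambda>a. carrier_retract (carrier_left (a \<otimes> z))" "\<lambda>a. \<Phi> (Phi_inv (a \<otimes> z))",
        rotated 2]) simp_all
  then show ?thesis
    by (rule tensor_ext[of "\<lambda>a. carrier_retract (carrier_left a)" "\<lambda>a. \<Phi> (Phi_inv a)", rotated 2])
        simp_all
qed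

text \<open>The last leg of \<open>carrier_left\<close> is
  \<open>j(h\<^sub>3) b' j\<^sup>-\<^sup>1(h\<^sub>4)\<close>, which contracts to \<open>b'\<close>;
  moving \<open>b'\<close> across the balanced tensor sign gives
  \<open>carrier_right\<close>.\<close>

lemma carrier_Phi: "carrier_left (\<Phi> m) - carrier_right (\<Phi> m) \<in> bal_right"
proof (rule tensor_in_subspace[of _ "\<lambda>m. carrier_left (\<Phi> m) - carrier_right (\<Phi> m)"], simp, simp)
  fix b r show "carrier_left (\<Phi> (b \<otimes> r)) - carrier_right (\<Phi> (b \<otimes> r)) \<in> bal_right"
  proof (rule tensor_in_subspace[of _ "\<lambda>r. carrier_left (\<Phi> (b \<otimes> r)) - carrier_right (\<Phi> (b \<otimes> r))"],
      simp, simp)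
    fix b' h
    have "carrier_left (\<Phi> (b \<otimes> b' \<otimes> h)) = sw h
        (\<lambda>x r. sw r (\<lambda>y s. (b \<otimes> x) \<otimes> cleft_inv 1 y \<otimes> sw s
        (\<lambda>z w. crossed_mult (1 \<otimes> z) (cleft_inv b' w))))"
      by (simp add: carrier_left_def \<Phi>_def coact_right_eq tau_rep_def tag_start[of h _ 0]
          sigma_mult_nf)
    also have "\<dots> = sw h (\<lambda>x y. (b \<otimes> x) \<otimes> cleft_inv 1 y \<otimes> (b' \<otimes> 1))"
      by (simp add: cleft_inv_mult_right scaleC_out counits)
    finally have "carrier_left (\<Phi> (b \<otimes> b' \<otimes> h)) - carrier_right (\<Phi> (b \<otimes> b' \<otimes> h))
      = sw h (\<lambda>x y. (b \<otimes> x) \<otimes> cleft_inv 1 y \<otimes> crossed_mult (b' \<otimes> 1) (1 \<otimes> 1) - (b \<otimes> x) \<otimes>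
          crossed_mult (cleft_inv 1 y) (b' \<otimes> 1) \<otimes> 1 \<otimes> 1)"
      by (simp add: carrier_right_def \<Phi>_def tfold_tfold tfold_diff cleft_inv_incl_right)
    also have "\<dots> \<in> bal_right"
    proof (rule tfold_in_subspace)
      fix x y
      have "cleft_inv 1 y \<otimes> crossed_mult (b' \<otimes> 1) (1 \<otimes> 1) - crossed_mult (cleft_inv 1 y) (b' \<otimes> 1) \<otimes>
          1 \<otimes> 1 \<in> ext_bal crossed_ext"
        by (simp only: ext_bal_iff chi_diff chi_relator)  simp
      then have "(b \<otimes> x) \<otimes> (cleft_inv 1 y \<otimes> crossed_mult (b' \<otimes> 1) (1 \<otimes> 1) - crossed_mult
          (cleft_inv 1 y) (b' \<otimes> 1) \<otimes> 1 \<otimes> 1) \<in> bal_right"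
        by (intro cvec.span_base) blast
      then show "(b \<otimes> x) \<otimes> cleft_inv 1 y \<otimes> crossed_mult (b' \<otimes> 1) (1 \<otimes> 1) - (b \<otimes> x) \<otimes> crossed_mult
          (cleft_inv 1 y) (b' \<otimes> 1) \<otimes> 1 \<otimes> 1 \<in> bal_right"
        by (simp only: clinear_diff[of "\<lambda>z. (b \<otimes> x) \<otimes> z", OF
            clinear_tensor_right[OF clinear_ident]])
    qed simp
    finally show "carrier_left (\<Phi> (b \<otimes> b' \<otimes> h)) - carrier_right (\<Phi> (b \<otimes> b' \<otimes> h)) \<in> bal_right" .
  qed
qed

text \<open>Applying the retraction to the defining congruence of the carrier turns it into
  \<open>w = \<Phi> (Phi_inv w)\<close>.\<close>

lemma es_carrier_eq: "es_carrier crossed_ext = range \<Phi>"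
proof (intro equalityI subsetI)
  fix w assume "w \<in> es_carrier crossed_ext"
  then have "carrier_retract (carrier_left w - carrier_right w)
      = 0" unfolding es_carrier_iff by (rule carrier_retract_bal_right)
  then have "w = \<Phi> (Phi_inv w)"
    by (simp add: clinear_diff[of carrier_retract, OF clinear_carrier_retract[OF clinear_ident]]
        carrier_retract_carrier_right carrier_retract_carrier_left)
  then show "w \<in> range \<Phi>" by (metis rangeI)
qed (use carrier_Phi in \<open>auto simp: es_carrier_iff\<close>)

section \<open>Product, unit and counit of the coinvariants\<close>

lemma env_mult_eq: "env_mult m w w' = tfold w (\<lambda>a a'. tfold w' (\<lambda>c c'. m a c \<otimes> m c' a'))"
  by (simp add: env_mult_def sum_list_simple)

lemma clinear_env_mult [linear_intros, simp]:
  "clinear f \<Longrightarrow> clinear (\<lambda>x. env_mult crossed_mult (f x) w)"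
  "clinear f \<Longrightarrow> clinear (\<lambda>x. env_mult crossed_mult w (f x))"
  by (simp_all add: env_mult_eq)

text \<open>The opposite product in the second leg produces the inverse at \<open>g\<close> times
  the inverse at \<open>h\<close>, which is the order handled by \<open>cleft_inv_cleft_inv\<close>.
  The first leg contributes \<open>\<sigma>\<close> on the first legs of \<open>h\<close> and
  \<open>g\<close>, the second leg \<open>\<sigma>i\<close> on the last ones.\<close>

lemma Phi_mult: "env_mult crossed_mult (\<Phi> m) (\<Phi> n) = \<Phi> (model_mult m n)"
proof -
  have "env_mult crossed_mult (\<Phi> (b \<otimes> b' \<otimes> h)) (\<Phi> (c \<otimes> c' \<otimes> g))
      = \<Phi> (model_mult (b \<otimes> b' \<otimes> h) (c \<otimes> c' \<otimes> g))" for b b' h c c' g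
    by (simp add: \<Phi>_def model_mult_def env_mult_eq cleft_inv_cleft_inv crossed_mult_tensor
        cleft_inv2_def tag_start[of h _ 0] tag_start[of g _ 1] sigma_mult_nf)
  then have "env_mult crossed_mult (\<Phi> (b \<otimes> b' \<otimes> h)) (\<Phi> n)
      = \<Phi> (model_mult (b \<otimes> b' \<otimes> h) n)" for b b' h
    by - (rule tensor3_ext[of "\<lambda>n. env_mult crossed_mult (\<Phi> (b \<otimes> b' \<otimes> h)) (\<Phi> n)" "\<lambda>n. \<Phi>
        (model_mult (b \<otimes> b' \<otimes> h) n)"], simp_all)
  then show ?thesis
    by - (rule tensor3_ext[of "\<lambda>m. env_mult crossed_mult (\<Phi> m) (\<Phi> n)" "\<lambda>m. \<Phi> (model_mult m n)"],
        simp_all)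
qed

lemma env_mult_assoc:
  "env_mult crossed_mult (env_mult crossed_mult u v) w
      = env_mult crossed_mult u (env_mult crossed_mult v w)"
  by (simp add: env_mult_eq tfold_tfold crossed_mult_assoc)

text \<open>Pulled back along the injective \<open>\<Phi>\<close>, which avoids a computation with
  six values of the cocycle and its inverse.\<close>

lemma model_mult_assoc: "model_mult (model_mult m n) q = model_mult m (model_mult n q)"
proof -
  have "\<Phi> (model_mult (model_mult m n) q) = \<Phi> (model_mult m (model_mult n q))"
    by (simp add: Phi_mult[symmetric] env_mult_assoc)
  then show ?thesis by (metis Phi_inv_Phi)
qed

lemma Phi_one: "\<Phi> (1 \<otimes> 1 \<otimes> 1) = (1 \<otimes> 1) \<otimes> (1 \<otimes> 1)"
  by (simp add: \<Phi>_def cleft_inv_def sw_one sigma_inv_mult_one counit_one)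

lemma Phi_mult_fold: "tfold (\<Phi> m) crossed_mult = model_cou m \<otimes> 1"
  by (rule tensor3_ext[of "\<lambda>m. tfold (\<Phi> m) crossed_mult" "\<lambda>m. model_cou m \<otimes> 1"])
    (simp_all add: \<Phi>_def model_cou_def tfold_tfold cleft_inv_mult_right scaleC_out)

lemma inv_incl: "inv (\<lambda>b. b \<otimes> 1) (b \<otimes> (1::'h)) = (b :: 'b)"
proof (rule inv_f_f, rule injI)
  fix x y :: 'b assume "x \<otimes> (1::'h) = y \<otimes> 1"
  then have "base_proj (x \<otimes> 1) = base_proj (y \<otimes> 1)" by simp
  then show "x = y" by (simp add: counit_one)
qed

end

section \<open>The coproduct\<close>

definition map_tensor where "map_tensor f z = tfold z (\<lambda>m n. f m \<otimes> f n)"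

lemma clinear_map_tensor:
  assumes "clinear f" "clinear g" shows "clinear (\<lambda>x. map_tensor f (g x))"
  unfolding map_tensor_def
  by (intro linear_intros assms(2) clinear_compose[OF assms(1)])

lemma map_tensor_tensor: "clinear f \<Longrightarrow> map_tensor f (m \<otimes> n) = f m \<otimes> f n"
  unfolding map_tensor_def by (rule tfold_tensor) (intro linear_intros; assumption)

lemma map_tensor_map_tensor:
  assumes "clinear f" "\<And>m. f (g m) = m" shows "map_tensor f (map_tensor g z) = z"
proof -
  have "map_tensor f (map_tensor g z) = tfold z (\<lambda>m n. map_tensor f (g m \<otimes> g n))"
    unfolding map_tensor_def[of g] by (rule tfold_push)
        (rule clinear_map_tensor[OF assms(1) clinear_ident])
  then show ?thesis by (simp add: map_tensor_tensor[OF assms(1)] assms(2))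
qed

lemma map_tensor_in_span: "map_tensor f z \<in> cspan {x \<otimes> y | x y. x \<in> range f \<and> y \<in> range f}"
  unfolding map_tensor_def by (rule tfold_in_subspace) (auto intro!: cvec.span_base)

lemma map_tensor_retract:
  assumes "clinear f" "clinear g" "\<And>m. g (f m) = m"
    and "z \<in> cspan {x \<otimes> y | x y. x \<in> range f \<and> y \<in> range f}"
  shows "map_tensor f (map_tensor g z) = z"
proof -
  have "map_tensor f (map_tensor g z) - z = 0"
  proof (rule linear_span_zero[OF _ _ assms(4)])
    show "clinear (\<lambda>z. map_tensor f (map_tensor g z) - z)"
      by (intro linear_intros clinear_map_tensor assms)
  qed (auto simp: map_tensor_tensor assms)
  then show ?thesis by simp
qed

text \<open>
  \<open>L\<close> is the image under \<open>\<phi>\<close> of the model given by \<open>\<sigma>\<close>. The left inverse \<open>\<rho>\<close> is linear on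
  all of the ambient type, but meaningless outside of \<open>lcar L\<close>.
\<close>

locale modelled = central_cocycle \<Delta> \<epsilon> S \<sigma> \<sigma>i
  for \<Delta> :: "'h::complex_algebra \<Rightarrow> 'h \<otimes> 'h" and \<epsilon> :: "'h \<Rightarrow> complex" and S :: "'h \<Rightarrow> 'h"
    and \<sigma> \<sigma>i :: "'h \<Rightarrow> 'h \<Rightarrow> 'b::complex_algebra" +
  fixes L :: "('l::complex_vector, 'b) bialgebroid" and \<phi> :: "'b \<otimes> 'b \<otimes> 'h \<Rightarrow> 'l"
    and \<rho> :: "'l \<Rightarrow> 'b \<otimes> 'b \<otimes> 'h"
  assumes clinear_phi: "clinear \<phi>" and clinear_rho: "clinear \<rho>"
    and rho_phi [simp]: "\<rho> (\<phi> m) = m"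
    and lcar_eq: "lcar L = range \<phi>"
    and lmul_eq: "lmul L (\<phi> m) (\<phi> n) = \<phi> (model_mult m n)"
    and lone_eq: "lone L = \<phi> (1 \<otimes> 1 \<otimes> 1)"
    and leta_eq: "leta L p = \<phi> (tfold p (\<lambda>b b'. b \<otimes> b' \<otimes> 1))"
    and lcou_eq: "lcou L (\<phi> m) = model_cou m"
    and lcop_eq: "lcop L (\<phi> m) = coset (bal L) (map_tensor \<phi> (model_cop m))"

context central_cocycle
begin

abbreviation "crossed_env \<equiv> es_env_ring crossed_ext"

lemma crossed_env_simps [simp]:
  "lcar crossed_env = range \<Phi>"
  "lmul crossed_env = env_mult crossed_mult"
  "lone crossed_env = \<Phi> (1 \<otimes> 1 \<otimes> 1)"
  "leta crossed_env p = \<Phi> (tfold p (\<lambda>b b'. b \<otimes> b' \<otimes> 1))"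
proof -
  have "cleft_inv b 1 = b \<otimes> 1" for b
    by (simp add: cleft_inv_def sw_one sigma_inv_mult_one counit_one)
  then have "(b \<otimes> 1) \<otimes> (b' \<otimes> 1) = \<Phi> (b \<otimes> b' \<otimes> 1)" for b b'
    by (simp add: \<Phi>_def sw_one)
  then show "leta crossed_env p = \<Phi> (tfold p (\<lambda>b b'. b \<otimes> b' \<otimes> 1))"
    by (simp add: es_env_ring_def sum_list_simple
        tfold_push[of \<Phi>, OF clinear_Phi[OF clinear_ident]])
qed (simp_all add: es_env_ring_def es_carrier_eq Phi_one)

lemma env_mult_src:
  "lmul crossed_env (src crossed_env \<beta>) w = tfold w (\<lambda>a z. crossed_mult (\<beta> \<otimes> 1) a \<otimes> z)"
  by (simp add: src_def Phi_tensor sw_one cleft_inv_def sigma_inv_mult_one counit_one env_mult_eq)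

lemma env_mult_tgt:
  "lmul crossed_env (tgt crossed_env \<beta>) w = tfold w (\<lambda>a z. a \<otimes> crossed_mult z (\<beta> \<otimes> 1))"
  by (simp add: tgt_def Phi_tensor sw_one cleft_inv_def sigma_inv_mult_one counit_one env_mult_eq)

lemma csubspace_middle [simp]: "csubspace (es_middle_bal crossed_ext)"
  by (simp add: es_middle_bal_def)

lemma csubspace_bal [simp]: "csubspace (bal K)"
  by (simp add: bal_def)

text \<open>The target multiplies the second leg on the right and the source multiplies the first
  leg on the left. Hence a relator of \<open>L \<otimes>\<^sub>B L\<close> is a sum of relators
  between the two inner legs.\<close>

lemma bal_middle: "bal crossed_env \<subseteq> es_middle_bal crossed_ext"
proof
  fix z assume "z \<in> bal crossed_env"
  then show "z \<in> es_middle_bal crossed_ext"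
    unfolding bal_def
  proof (rule linear_span_in[OF clinear_ident csubspace_middle, rotated])
    fix w assume "w \<in> {lmul crossed_env (tgt crossed_env b) x \<otimes> y - x \<otimes> lmul crossed_env
        (src crossed_env b) y | x y b. x \<in> lcar crossed_env \<and> y \<in> lcar crossed_env}"
    then obtain b x y where w: "w = lmul crossed_env (tgt crossed_env b) x \<otimes> y - x \<otimes> lmul
        crossed_env (src crossed_env b) y" by blast
    have "w = tfold x (\<lambda>a z. tfold y (\<lambda>a' z'. (a \<otimes> crossed_mult z (b \<otimes> 1)) \<otimes> (a' \<otimes> z') - (a \<otimes> z) \<otimes>
        (crossed_mult (b \<otimes> 1) a' \<otimes> z')))"
      unfolding w env_mult_src env_mult_tgt
      by (simp add: tfold_diff tfold_tensor_left[symmetric] tfold_tensor_right[symmetric])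
    also have "\<dots> \<in> es_middle_bal crossed_ext"
    proof (intro tfold_in_subspace csubspace_middle)
      fix a z a' z'
      show "(a \<otimes> crossed_mult z (b \<otimes> 1)) \<otimes> (a' \<otimes> z') - (a \<otimes> z) \<otimes> (crossed_mult (b \<otimes> 1) a' \<otimes> z') \<in>
          es_middle_bal crossed_ext"
        unfolding es_middle_bal_def crossed_ext_simps by (rule cvec.span_base) blast
    qed
    finally show "w \<in> es_middle_bal crossed_ext" .
  qed
qed

text \<open>Together with \<open>Phi_inv_left\<close> this holds on all of
  \<open>A \<otimes> A\<close>, because \<open>base_proj\<close> commutes with multiplication by the
  base on either side. Relators of \<open>es_middle_bal\<close>, whose legs are arbitrary, are
  thereby carried to relators of the model.\<close>

lemma Phi_inv_right: "Phi_inv (x \<otimes> crossed_mult y (\<beta> \<otimes> 1)) = tgt_mult \<beta> (Phi_inv (x \<otimes> y))"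
proof (rule tensor_ext[of "\<lambda>x. Phi_inv (x \<otimes> crossed_mult y (\<beta> \<otimes> 1))" "\<lambda>x. tgt_mult \<beta>
    (Phi_inv (x \<otimes> y))"])
  fix b h
  show "Phi_inv ((b \<otimes> h) \<otimes> crossed_mult y (\<beta> \<otimes> 1)) = tgt_mult \<beta> (Phi_inv ((b \<otimes> h) \<otimes> y))"
    by (simp add: Phi_inv_def crossed_mult_assoc[symmetric] base_proj_mult_incl
        tfold_push[of "tgt_mult \<beta>"] clinear_tgt_mult(2)[OF clinear_ident])
qed simp_all

lemma Phi_inv_left: "Phi_inv (crossed_mult (\<beta> \<otimes> 1) x \<otimes> y) = src_mult \<beta> (Phi_inv (x \<otimes> y))"
proof (rule tensor_ext[of "\<lambda>x. Phi_inv (crossed_mult (\<beta> \<otimes> 1) x \<otimes> y)" "\<lambda>x. src_mult \<beta>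
    (Phi_inv (x \<otimes> y))"])
  fix b h
  show "Phi_inv (crossed_mult (\<beta> \<otimes> 1) (b \<otimes> h) \<otimes> y) = src_mult \<beta> (Phi_inv ((b \<otimes> h) \<otimes> y))"
    by (simp add: Phi_inv_def crossed_mult_incl_left tfold_push[of "src_mult \<beta>"]
        clinear_tgt_mult(4)[OF clinear_ident])
qed simp_all

lemma clinear_map_tensor_Phi_inv [linear_intros, simp]:
  "clinear f \<Longrightarrow> clinear (\<lambda>x. map_tensor Phi_inv (f x))"
  "clinear g \<Longrightarrow> clinear (\<lambda>x. map_tensor \<Phi> (g x))"
  by (intro clinear_map_tensor linear_intros; assumption)+

lemma map_tensor_Phi_inv_tensor [simp]:
  "map_tensor Phi_inv (w \<otimes> w') = Phi_inv w \<otimes> Phi_inv w'"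
  "map_tensor \<Phi> (m \<otimes> m') = \<Phi> m \<otimes> \<Phi> m'"
  by (intro map_tensor_tensor linear_intros)+

text \<open>
  This makes \<open>L \<otimes>\<^sub>B L \<rightarrow> A \<otimes> (A \<otimes>\<^sub>B A) \<otimes> A\<close> injective, which is needed for the definite
  description in \<open>es_coproduct\<close>.
\<close>

lemma bal_nf_middle:
  assumes "z \<in> es_middle_bal crossed_ext" shows "bal_nf (map_tensor Phi_inv z) = 0"
  using assms unfolding es_middle_bal_def
proof (rule linear_span_zero[rotated 2])
  show lin: "clinear (\<lambda>z. bal_nf (map_tensor Phi_inv z))" by simp
  fix w :: "(('b \<otimes> 'h) \<otimes> ('b \<otimes> 'h)) \<otimes> (('b \<otimes> 'h) \<otimes> ('b \<otimes> 'h))" assume "w \<in>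
      {(x \<otimes> amul crossed_ext y (incl crossed_ext b)) \<otimes> (x' \<otimes> y') - (x \<otimes> y) \<otimes>
      (amul crossed_ext (incl crossed_ext b) x' \<otimes> y') | x y b x' y'. True}"
  then show "bal_nf (map_tensor Phi_inv w) = 0"
    by (auto simp: clinear_diff[OF lin] Phi_inv_left Phi_inv_right bal_nf_relator)
qed

lemma model_mult_tgt: "model_mult (1 \<otimes> \<beta> \<otimes> 1) m = tgt_mult \<beta> m"
  by (rule tensor3_ext[of "\<lambda>m. model_mult (1 \<otimes> \<beta> \<otimes> 1) m"])
      (simp_all add: model_mult_def sw_one sigma_mult_one sigma_inv_mult_one counit_one scaleC_out
      tfold_scale counits)

lemma model_mult_src: "model_mult (\<beta> \<otimes> 1 \<otimes> 1) m = src_mult \<beta> m"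
  by (rule tensor3_ext[of "\<lambda>n. model_mult (\<beta> \<otimes> 1 \<otimes> 1) n"])
      (simp_all add: model_mult_def sw_one sigma_mult_one sigma_inv_mult_one counit_one scaleC_out
      tfold_scale counits)

lemma bal_crossed_env_iff: "map_tensor \<Phi> z \<in> bal crossed_env \<longleftrightarrow> bal_nf z = 0"
proof
  assume "map_tensor \<Phi> z \<in> bal crossed_env"
  then have "bal_nf (map_tensor Phi_inv (map_tensor \<Phi> z))
      = 0" using bal_middle bal_nf_middle by blast
  then show "bal_nf z = 0"
    by (simp add: map_tensor_map_tensor[of Phi_inv \<Phi>] clinear_Phi_inv[OF clinear_ident])
next
  assume "bal_nf z = 0"
  then have "z \<in> bal_model" by (simp add: bal_model_iff)
  then show "map_tensor \<Phi> z \<in> bal crossed_env"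
    unfolding bal_model_def
  proof (rule linear_span_in[rotated 3])
    show lin: "clinear (map_tensor \<Phi>)" using clinear_map_tensor_Phi_inv(2)[OF clinear_ident] .
    fix w :: "('b \<otimes> 'b \<otimes> 'h) \<otimes> ('b \<otimes> 'b \<otimes> 'h)" assume "w \<in> {tgt_mult \<beta> m \<otimes> n - m \<otimes> src_mult \<beta> n | \<beta>
        m n. True}"
    then obtain \<beta> m n where w: "w = tgt_mult \<beta> m \<otimes> n - m \<otimes> src_mult \<beta> n" by blast
    have "map_tensor \<Phi> w = lmul crossed_env (tgt crossed_env \<beta>) (\<Phi> m) \<otimes> \<Phi> n - \<Phi> m \<otimes> lmul
        crossed_env (src crossed_env \<beta>) (\<Phi> n)"
      by (simp add: w clinear_diff[OF lin] tgt_def src_def Phi_mult model_mult_tgt model_mult_src)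
    also have "\<dots> \<in> bal crossed_env" unfolding bal_def by (rule cvec.span_base) auto
    finally show "map_tensor \<Phi> w \<in> bal crossed_env" .
  qed simp
qed

text \<open>With \<open>tau_rep\<close> in place of the chosen representatives the two terms are
  equal; the choice contributes relators between the inner legs only.\<close>

lemma coproduct_middle:
  "map_tensor \<Phi> (model_cop m) - tfold (\<Phi> m) (\<lambda>a a'. tfold (coact_right \<Delta> a)
      (\<lambda>a0 a1. tfold (tau_some a1) (\<lambda>u v. (a0 \<otimes> u) \<otimes> (v \<otimes> a')))) \<in> es_middle_bal crossed_ext"
proof -
  have "map_tensor \<Phi> (model_cop m) = tfold (\<Phi> m)
      (\<lambda>a a'. tfold (coact_right \<Delta> a) (\<lambda>a0 a1. tfold (tau_rep a1) (\<lambda>u v. (a0 \<otimes> u) \<otimes> (v \<otimes> a'))))"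
  proof (rule tensor3_ext[of "\<lambda>m. map_tensor \<Phi> (model_cop m)"])
    fix b b' h
    show "map_tensor \<Phi> (model_cop (b \<otimes> b' \<otimes> h)) = tfold (\<Phi> (b \<otimes> b' \<otimes> h))
        (\<lambda>a a'. tfold (coact_right \<Delta> a) (\<lambda>a0 a1. tfold (tau_rep a1) (\<lambda>u v. (a0 \<otimes> u) \<otimes> (v \<otimes> a'))))"
      by (simp add: model_cop_def map_tensor_def \<Phi>_def coact_right_eq tau_rep_def
          tag_start[of h _ 0] sigma_mult_nf)
  qed simp_all
  moreover have "tfold (tau_rep a1) (\<lambda>u v. (a0 \<otimes> u) \<otimes> (v \<otimes> a')) - tfold (tau_some a1)
      (\<lambda>u v. (a0 \<otimes> u) \<otimes> (v \<otimes> a')) \<in> es_middle_bal crossed_ext" for a0 a1 a'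
  proof -
    have "tfold (tau_rep a1) (\<lambda>u v. (a0 \<otimes> u) \<otimes> (v \<otimes> a')) - tfold (tau_some a1)
        (\<lambda>u v. (a0 \<otimes> u) \<otimes> (v \<otimes> a'))
      = tfold (tau_rep a1 - tau_some a1) (\<lambda>u v. (a0 \<otimes> u) \<otimes> (v \<otimes> a'))"
      by (rule clinear_diff[symmetric]) simp
    also have "\<dots> \<in> es_middle_bal crossed_ext"
    proof (rule linear_span_in[of "\<lambda>z. tfold z (\<lambda>u v. (a0 \<otimes> u) \<otimes> (v \<otimes> a'))", OF _ csubspace_middle])
      show lin: "clinear (\<lambda>z. tfold z (\<lambda>u v. (a0 \<otimes> u) \<otimes> (v \<otimes> a')))" by simp
      show "tau_rep a1 - tau_some a1 \<in> cspan {amul crossed_ext x (incl crossed_ext b) \<otimes> y - x \<otimes>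
          amul crossed_ext (incl crossed_ext b) y | x b y. True}"
        using cvec.subspace_neg[OF csubspace_ext_bal tau_some_tau_rep[of a1]]
        by (simp add: ext_bal_def)
      fix w assume "w \<in> {amul crossed_ext x (incl crossed_ext b) \<otimes> y - x \<otimes> amul crossed_ext
          (incl crossed_ext b) y | x b y. True}"
      then obtain x b y where "w = crossed_mult x (b \<otimes> 1) \<otimes> y - x \<otimes> crossed_mult (b \<otimes> 1) y" by auto
      then have "tfold w (\<lambda>u v. (a0 \<otimes> u) \<otimes> (v \<otimes> a'))
        = (a0 \<otimes> crossed_mult x (b \<otimes> 1)) \<otimes> (y \<otimes> a') - (a0 \<otimes> x) \<otimes> (crossed_mult (b \<otimes> 1) y \<otimes> a')"
        by (simp add: clinear_diff[OF lin])
      also have "\<dots> \<in> es_middle_bal crossed_ext"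
        unfolding es_middle_bal_def crossed_ext_simps by (rule cvec.span_base) blast
      finally show "tfold w (\<lambda>u v. (a0 \<otimes> u) \<otimes> (v \<otimes> a')) \<in> es_middle_bal crossed_ext" .
    qed
    finally show ?thesis .
  qed
  ultimately show ?thesis
    unfolding tfold_diff[symmetric] by (auto intro!: tfold_in_subspace simp: tfold_diff[symmetric])
qed

text \<open>Existence in the definite description is \<open>coproduct_middle\<close>. For
  uniqueness, two elements of \<open>L \<otimes> L\<close> that agree modulo
  \<open>es_middle_bal\<close> have preimages with the same normal form by
  \<open>bal_nf_middle\<close>, hence agree modulo \<open>bal\<close> by
  \<open>bal_crossed_env_iff\<close>.\<close>

lemma es_coproduct_eq:
  "es_coproduct crossed_ext (\<Phi> m) = coset (bal crossed_env) (map_tensor \<Phi> (model_cop m))"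
proof -
  define X where "X = tfold (\<Phi> m) (\<lambda>a a'. tfold (coact_right \<Delta> a)
      (\<lambda>a0 a1. tfold (tau_some a1) (\<lambda>u v. (a0 \<otimes> u) \<otimes> (v \<otimes> a'))))"
  have X: "map_tensor \<Phi> (model_cop m) - X \<in> es_middle_bal crossed_ext"
    unfolding X_def by (rule coproduct_middle)
  have "es_coproduct crossed_ext (\<Phi> m) = (THE Z. Z \<in> btensor crossed_env \<and> Z \<subseteq> coset
      (es_middle_bal crossed_ext) X)"
    by (simp add: es_coproduct_def X_def sum_list_simple tau_eq)
  also have "\<dots> = coset (bal crossed_env) (map_tensor \<Phi> (model_cop m))"
  proof (rule the_equality)
    have "z - X \<in> es_middle_bal crossed_ext" if "z - map_tensor \<Phi> (model_cop m) \<in> bal crossed_env"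
        for z
      using cvec.subspace_add[OF csubspace_middle subsetD[OF bal_middle that] X] by simp
    then show "coset (bal crossed_env) (map_tensor \<Phi> (model_cop m)) \<in> btensor crossed_env \<and> coset
        (bal crossed_env) (map_tensor \<Phi> (model_cop m)) \<subseteq> coset (es_middle_bal crossed_ext) X"
      unfolding btensor_def crossed_env_simps using map_tensor_in_span by (auto simp: coset_def)
  next
    fix Z assume Z: "Z \<in> btensor crossed_env \<and> Z \<subseteq> coset (es_middle_bal crossed_ext) X"
    then obtain z where "z \<in> cspan {x \<otimes> y | x y. x \<in> range \<Phi> \<and> y \<in> range \<Phi>}" and Zz: "Z
        = coset (bal crossed_env) z"
      unfolding btensor_def crossed_env_simps by blast
    \<comment> \<open>\<open>Phi_inv\<close> is a two-sided inverse here because \<open>z\<close>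
      lies in the span of tensors of coinvariants.\<close>
    then have z: "z = map_tensor \<Phi> (map_tensor Phi_inv z)"
      using map_tensor_retract[of \<Phi> Phi_inv z] clinear_Phi[OF clinear_ident]
          clinear_Phi_inv[OF clinear_ident]
      by simp
    have "z - X \<in> es_middle_bal crossed_ext"
      using Z Zz in_coset_self[OF csubspace_bal, of z crossed_env] by (auto simp: coset_def)
    then have "(z - X) - (map_tensor \<Phi> (model_cop m) - X) \<in> es_middle_bal crossed_ext"
      using X by (rule cvec.subspace_diff[OF csubspace_middle])
    then have "map_tensor \<Phi> (map_tensor Phi_inv z - model_cop m) \<in> es_middle_bal crossed_ext"
      using z clinear_diff[of "map_tensor \<Phi>", OF clinear_map_tensor_Phi_inv(2)[OF clinear_ident]]
      by simp
    then have "bal_nf (map_tensor Phi_inv (map_tensor \<Phi> (map_tensor Phi_inv z - model_cop m)))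
        = 0" by (rule bal_nf_middle)
    then have "bal_nf (map_tensor Phi_inv z - model_cop m) = 0"
      by (simp add: map_tensor_map_tensor[of Phi_inv \<Phi>] clinear_Phi_inv[OF clinear_ident])
    then have "map_tensor \<Phi> (map_tensor Phi_inv z - model_cop m) \<in> bal crossed_env" by
        (simp add: bal_crossed_env_iff)
    then have "z - map_tensor \<Phi> (model_cop m) \<in> bal crossed_env"
      using z clinear_diff[of "map_tensor \<Phi>", OF clinear_map_tensor_Phi_inv(2)[OF clinear_ident]]
      by simp
    then show "Z = coset (bal crossed_env) (map_tensor \<Phi> (model_cop m))"
      unfolding Zz by (rule coset_eqI[OF csubspace_bal])
  qed
  finally show ?thesis .
qed

lemma es_modelled: "modelled \<Delta> \<epsilon> S \<sigma> \<sigma>i (es_bialgebroid crossed_ext) \<Phi> Phi_inv"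
proof (intro modelled.intro modelled_axioms.intro central_cocycle_axioms)
  have eb: "env_ring.extend crossed_env \<lparr>lcop = c, lcou = d\<rparr> = \<lparr>lcar = lcar crossed_env, lmul
      = lmul crossed_env, lone = lone crossed_env, leta = leta crossed_env, lcop = c, lcou
      = d\<rparr>" for c d
    by (simp add: env_ring.defs)
  show "lcou (es_bialgebroid crossed_ext) (\<Phi> m) = model_cou m" for m
    by (simp add: es_bialgebroid_def eb sum_list_simple Phi_mult_fold inv_incl)
  have bal: "bal (es_bialgebroid crossed_ext) = bal crossed_env"
    by (simp add: es_bialgebroid_def eb bal_def src_def tgt_def)
  show "lcop (es_bialgebroid crossed_ext) (\<Phi> m)
      = coset (bal (es_bialgebroid crossed_ext)) (map_tensor \<Phi> (model_cop m))" for m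
    unfolding bal by (simp add: es_bialgebroid_def eb es_coproduct_eq)
  show "clinear \<Phi>" "clinear Phi_inv" using clinear_Phi[OF clinear_ident]
      clinear_Phi_inv[OF clinear_ident] .
qed (simp_all add: es_bialgebroid_def env_ring.defs Phi_mult)

end

section \<open>The model is a left bialgebroid\<close>

lemma tfold_sum_list: "tfold t (\<lambda>u v. \<Sum>z\<leftarrow>xs. f u v z) = (\<Sum>z\<leftarrow>xs. tfold t (\<lambda>u v. f u v z))"
  unfolding tfold_def split_def by (rule sum_list_map_swap)

lemma sum_list_cong2:
  assumes "set xs \<subseteq> A \<times> B" "\<And>x y. x \<in> A \<Longrightarrow> y \<in> B \<Longrightarrow> f x y = g x y"
  shows "(\<Sum>(x, y)\<leftarrow>xs. f x y) = (\<Sum>(x, y)\<leftarrow>xs. g x y)"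
  using assms by (intro arg_cong[where f=sum_list] map_cong) auto

text \<open>Bilinear maps that factor through the tensor product over the base, so that their sums
  over a coproduct do not depend on the representative.\<close>

definition balanced where
  "balanced G \<longleftrightarrow> cbilinear G \<and> (\<forall>\<beta> m n. G (tgt_mult \<beta> m) n = G m (src_mult \<beta> n))"

lemma tgt_mult_tgt_mult: "tgt_mult \<alpha> (tgt_mult \<beta> m) = tgt_mult (\<beta> * \<alpha>) m"
  by (simp add: tgt_mult_def tfold_tfold mult.assoc)

lemma tgt_mult_src_mult: "tgt_mult \<alpha> (src_mult \<beta> m) = src_mult \<beta> (tgt_mult \<alpha> m)"
  by (simp add: tgt_mult_def src_mult_def tfold_tfold)

lemma balanced_bilinear: "balanced G \<Longrightarrow> cbilinear G"
  by (simp add: balanced_def)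

lemma balanced_bal_nf:
  assumes "balanced G" shows "tfold (bal_nf z) G = tfold z G"
proof -
  have lin: "clinear (\<lambda>z. tfold z G)"
    using assms by (intro linear_intros balanced_bilinear)
  have "tfold (z - bal_nf z) G = 0"
    using bal_nf_bal_model[of z] unfolding bal_model_def
  proof (rule linear_span_zero[OF lin, rotated])
    fix w :: "('a \<otimes> 'a \<otimes> 'b) \<otimes> ('a \<otimes> 'a \<otimes> 'b)" assume "w \<in> {tgt_mult \<beta> m \<otimes> n - m \<otimes> src_mult \<beta> n | \<beta>
        m n. True}"
    then show "tfold w G = 0"
      using assms by (auto simp: clinear_diff[OF lin] balanced_def)
  qed
  then show ?thesis by (simp add: clinear_diff[OF lin])
qed

lemma balanced_bal_nf_tensor: "balanced (\<lambda>m n. bal_nf (m \<otimes> n))"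
  by (simp add: balanced_def bal_nf_relator)

context central_cocycle
begin

lemma model_mult_one:
  "model_mult (1 \<otimes> 1 \<otimes> 1) m = m"
  "model_mult m (1 \<otimes> 1 \<otimes> 1) = m"
proof -
  show "model_mult (1 \<otimes> 1 \<otimes> 1) m = m"
    unfolding model_mult_src by (simp add: src_mult_def)
  show "model_mult m (1 \<otimes> 1 \<otimes> 1) = m"
    by (rule tensor3_ext[of "\<lambda>m. model_mult m (1 \<otimes> 1 \<otimes> 1)" "\<lambda>m. m"])
        (simp_all add: model_mult_def sw_one sigma_mult_one sigma_inv_mult_one counit_one
        scaleC_out tfold_scale counits)
qed

lemma tgt_mult_model_mult:
  "model_mult (tgt_mult \<beta> m) n = tgt_mult \<beta> (model_mult m n)"
  and src_mult_model_mult: "model_mult (src_mult \<beta> m) n = src_mult \<beta> (model_mult m n)"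
  by (simp_all only: model_mult_tgt[symmetric] model_mult_src[symmetric] model_mult_assoc)

lemma model_cou_tgt_mult: "model_cou (tgt_mult \<beta> m) = model_cou m * \<beta>"
  by (simp add: model_cou_def tgt_mult_def tfold_tfold tfold_mult_left scaleC_out mult.assoc)

lemma model_cou_src_mult: "model_cou (src_mult \<beta> m) = \<beta> * model_cou m"
  by (simp add: model_cou_def src_mult_def tfold_tfold tfold_mult_right scaleC_out mult.assoc)

text \<open>The counit removes the middle legs \<open>h2 * g2\<close>, whereupon
  \<open>\<sigma>\<close> on the first legs cancels \<open>\<sigma>i\<close> on the last
  ones.\<close>

lemma model_cou_model_mult_tensor:
  "model_cou (model_mult (b \<otimes> b' \<otimes> h) (c \<otimes> c' \<otimes> g)) = \<epsilon> h *\<^sub>C \<epsilon> g *\<^sub>C (b * c * c' * b')"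
proof -
  have "model_cou (model_mult (b \<otimes> b' \<otimes> h) (c \<otimes> c' \<otimes> g))
      = sw h (\<lambda>h1 h2. sw g (\<lambda>g1 g2. sigma_mult h1 g1 (sigma_inv_mult h2 g2 (b * c * c' * b'))))"
    by (simp add: model_mult_def model_cou_def tfold_tfold tfold_scale tfold_scale_left
        counit_simps counits sigma_mult_left sigma_mult_right sigma_mult_commute mult.assoc)
  then show ?thesis by (simp add: sigma_mult_cancel)
qed

lemma model_mult_scale:
  "model_mult m (c *\<^sub>C n) = c *\<^sub>C model_mult m n"
  "model_cou (c *\<^sub>C m) = c *\<^sub>C model_cou m"
  by (rule clinear_scaleC, simp)+

lemma model_cou_model_mult:
  "model_cou (model_mult m (model_cou n \<otimes> 1 \<otimes> 1)) = model_cou (model_mult m n)"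
  "model_cou (model_mult m (1 \<otimes> model_cou n \<otimes> 1)) = model_cou (model_mult m n)"
proof -
  have "model_cou (model_mult (b \<otimes> b' \<otimes> h) (model_cou n \<otimes> 1 \<otimes> 1))
      = model_cou (model_mult (b \<otimes> b' \<otimes> h) n)" for b b' h
    by (rule tensor3_ext[of "\<lambda>n. model_cou (model_mult (b \<otimes> b' \<otimes> h) (model_cou n \<otimes> 1 \<otimes> 1))" "\<lambda>n.
        model_cou (model_mult (b \<otimes> b' \<otimes> h) n)"])
      (simp_all add: model_cou_model_mult_tensor model_cou_tensor counit_one scaleC_out
          model_mult_scale mult.assoc cvec.scale_left_commute)
  then show "model_cou (model_mult m (model_cou n \<otimes> 1 \<otimes> 1)) = model_cou (model_mult m n)"
    by - (rule tensor3_ext[of "\<lambda>m. model_cou (model_mult m (model_cou n \<otimes> 1 \<otimes> 1))" "\<lambda>m. model_cou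
        (model_mult m n)"], simp_all)
  have "model_cou (model_mult (b \<otimes> b' \<otimes> h) (1 \<otimes> model_cou n \<otimes> 1))
      = model_cou (model_mult (b \<otimes> b' \<otimes> h) n)" for b b' h
    by (rule tensor3_ext[of "\<lambda>n. model_cou (model_mult (b \<otimes> b' \<otimes> h) (1 \<otimes> model_cou n \<otimes> 1))" "\<lambda>n.
        model_cou (model_mult (b \<otimes> b' \<otimes> h) n)"])
      (simp_all add: model_cou_model_mult_tensor model_cou_tensor counit_one scaleC_out
          model_mult_scale mult.assoc cvec.scale_left_commute)
  then show "model_cou (model_mult m (1 \<otimes> model_cou n \<otimes> 1)) = model_cou (model_mult m n)"
    by - (rule tensor3_ext[of "\<lambda>m. model_cou (model_mult m (1 \<otimes> model_cou n \<otimes> 1))" "\<lambda>m. model_cou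
        (model_mult m n)"], simp_all)
qed

lemma model_mult_tgt_right:
  "model_mult m (1 \<otimes> \<beta> \<otimes> 1) = tfold m (\<lambda>b r. tfold r (\<lambda>b' h. b \<otimes> (\<beta> * b') \<otimes> h))"
  by (rule tensor3_ext[of "\<lambda>m. model_mult m (1 \<otimes> \<beta> \<otimes> 1)"])
      (simp_all add: model_mult_def sw_one sigma_mult_one sigma_inv_mult_one counit_one scaleC_out
      tfold_scale counits)

lemma model_mult_src_right: "model_mult m (\<beta> \<otimes> 1 \<otimes> 1) = tfold m (\<lambda>b r. (b * \<beta>) \<otimes> r)"
  by (rule tensor3_ext[of "\<lambda>m. model_mult m (\<beta> \<otimes> 1 \<otimes> 1)"])
      (simp_all add: model_mult_def sw_one sigma_mult_one sigma_inv_mult_one counit_one scaleC_out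
      tfold_scale counits)

text \<open>The inner entries of \<open>model_cop\<close> are 1, so the two multiplications place
  \<open>\<beta>\<close> alone in one of them; the normal form moves it from the left inner entry to
  the right one.\<close>

lemma model_cop_takeuchi:
  "tfold (model_cop m) (\<lambda>p q. bal_nf (model_mult p (1 \<otimes> \<beta> \<otimes> 1) \<otimes> q))
      = tfold (model_cop m) (\<lambda>p q. bal_nf (p \<otimes> model_mult q (\<beta> \<otimes> 1 \<otimes> 1)))"
  by (rule tensor3_ext[of "\<lambda>m. tfold (model_cop m) (\<lambda>p q. bal_nf (model_mult p (1 \<otimes> \<beta> \<otimes> 1) \<otimes> q))"])
    (simp_all add: model_cop_def tfold_tfold model_mult_tgt_right model_mult_src_right bal_nf_def)

lemma model_mult_inner_tgt:
  "model_mult m (tgt_mult \<beta> n) = model_mult (model_mult m (1 \<otimes> \<beta> \<otimes> 1)) n"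
  "model_mult m (src_mult \<beta> n) = model_mult (model_mult m (\<beta> \<otimes> 1 \<otimes> 1)) n"
  by (simp_all only: model_mult_tgt[symmetric] model_mult_src[symmetric] model_mult_assoc)

text \<open>
  The expression is balanced in \<open>p', q'\<close> only after the sum over \<open>p, q\<close>, by the Takeuchi
  condition.
\<close>

lemma model_cop_mult_balanced:
  "balanced (\<lambda>p' q'. tfold (model_cop m) (\<lambda>p q. bal_nf (model_mult p p' \<otimes> model_mult q q')))"
  unfolding balanced_def
proof (intro conjI allI)
  fix \<beta> :: 'b and n n' :: "'b \<otimes> 'b \<otimes> 'h"
  let ?G = "\<lambda>p q. bal_nf (model_mult p n \<otimes> model_mult q n')"
  let ?tgt_mult = "tfold (model_cop m) (\<lambda>p q. model_mult p (1 \<otimes> \<beta> \<otimes> 1) \<otimes> q)" and ?src_mult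
      = "tfold (model_cop m) (\<lambda>p q. p \<otimes> model_mult q (\<beta> \<otimes> 1 \<otimes> 1))"
  have G: "balanced ?G"
    by (simp add: balanced_def tgt_mult_model_mult src_mult_model_mult bal_nf_relator)
  \<comment> \<open>The two tensors agree only after normalisation, but the balanced
    \<open>?G\<close> cannot tell a tensor from its normal form.\<close>
  have "bal_nf ?tgt_mult = bal_nf ?src_mult"
    using model_cop_takeuchi[of m \<beta>]
    by (simp add: tfold_push[of bal_nf] clinear_bal_nf[OF clinear_ident])
  then have "tfold ?tgt_mult ?G = tfold ?src_mult ?G"
    by (metis balanced_bal_nf[OF G])
  then show "tfold (model_cop m) (\<lambda>p q. bal_nf (model_mult p (tgt_mult \<beta> n) \<otimes> model_mult q n'))
      = tfold (model_cop m) (\<lambda>p q. bal_nf (model_mult p n \<otimes> model_mult q (src_mult \<beta> n')))"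
    by (simp add: tfold_tfold model_mult_inner_tgt)
qed simp

text \<open>The factorwise product has a \<open>\<sigma>i\<close> in the second entry of its left
  factor and a \<open>\<sigma>\<close> in the first entry of its right factor. The normal form
  brings them together and they cancel, leaving the cocycle values at the outer legs that
  \<open>model_mult\<close> has.\<close>

lemma model_cop_mult:
  "tfold (model_cop m) (\<lambda>p q. tfold (model_cop n)
      (\<lambda>p' q'. bal_nf (model_mult p p' \<otimes> model_mult q q'))) = bal_nf (model_cop (model_mult m n))"
proof -
  have "tfold (model_cop (b \<otimes> b' \<otimes> h)) (\<lambda>p q. tfold (model_cop (c \<otimes> c' \<otimes> g))
      (\<lambda>p' q'. bal_nf (model_mult p p' \<otimes> model_mult q q')))
      = bal_nf (model_cop (model_mult (b \<otimes> b' \<otimes> h) (c \<otimes> c' \<otimes> g)))" for b b' h c c' g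
  proof -
    have "tfold (model_cop (b \<otimes> b' \<otimes> h)) (\<lambda>p q. tfold (model_cop (c \<otimes> c' \<otimes> g))
        (\<lambda>p' q'. bal_nf (model_mult p p' \<otimes> model_mult q q')))
     = sw h (\<lambda>h1 r. sw r (\<lambda>h2 r. sw r (\<lambda>h3 r. sw r
         (\<lambda>h4 h5. sw g (\<lambda>g1 r. sw r (\<lambda>g2 r. sw r (\<lambda>g3 r. sw r (\<lambda>g4 g5.
       (sigma_mult h1 g1 (b * c) \<otimes> 1 \<otimes> (h2 * g2)) \<otimes> (sw h3
           (\<lambda>x y. sw g3 (\<lambda>u v. sigma_inv_mult x u (sigma_mult y v 1))) \<otimes> sigma_inv_mult h5 g5
           (c' * b') \<otimes> (h4 * g4))))))))))"
      by (simp add: model_cop_def model_mult_def bal_nf_def src_mult_def tag_start[of h _ 0]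
          tag_start[of g _ 1] sigma_mult_nf)
    also have "\<dots> = bal_nf (model_cop (model_mult (b \<otimes> b' \<otimes> h) (c \<otimes> c' \<otimes> g)))"
      apply (simp add: sigma_inv_mult_cancel tensor_nf counits)
      apply (simp add: model_cop_def model_mult_def bal_nf_def src_mult_def tag_start[of h _ 0]
          tag_start[of g _ 1] sigma_mult_nf)
      done
    finally show ?thesis .
  qed
  then have "tfold (model_cop (b \<otimes> b' \<otimes> h)) (\<lambda>p q. tfold (model_cop n)
      (\<lambda>p' q'. bal_nf (model_mult p p' \<otimes> model_mult q q')))
      = bal_nf (model_cop (model_mult (b \<otimes> b' \<otimes> h) n))" for b b' h
    by - (rule tensor3_ext[of "\<lambda>n. tfold (model_cop (b \<otimes> b' \<otimes> h))
        (\<lambda>p q. tfold (model_cop n) (\<lambda>p' q'. bal_nf (model_mult p p' \<otimes> model_mult q q')))" "\<lambda>n.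
        bal_nf (model_cop (model_mult (b \<otimes> b' \<otimes> h) n))"], simp_all)
  then show ?thesis
    by - (rule tensor3_ext[of "\<lambda>m. tfold (model_cop m) (\<lambda>p q. tfold (model_cop n)
        (\<lambda>p' q'. bal_nf (model_mult p p' \<otimes> model_mult q q')))" "\<lambda>m. bal_nf
        (model_cop (model_mult m n))"], simp_all)
qed

end

text \<open>Normalises from left to right: the second entry of the first factor is pushed into the
  second factor before the last two are normalised by \<open>bal_nf\<close>. The relators are
  respected because source and target multiplications commute.\<close>

definition bal3_nf :: "('b \<otimes> 'b \<otimes> 'h) \<otimes> ('b \<otimes> 'b \<otimes> 'h) \<otimes> ('b \<otimes> 'b \<otimes> 'h) \<Rightarrow>
    ('b::complex_algebra \<otimes> 'b \<otimes> 'h::complex_vector) \<otimes> ('b \<otimes> 'b \<otimes> 'h) \<otimes> ('b \<otimes> 'b \<otimes> 'h)" where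
  "bal3_nf w = tfold w (\<lambda>m z. tfold m (\<lambda>b r. tfold r
      (\<lambda>b' h. (b \<otimes> 1 \<otimes> h) \<otimes> bal_nf (tfold z (\<lambda>n p. src_mult b' n \<otimes> p)))))"

lemma clinear_bal3_nf [linear_intros, simp]: "clinear g \<Longrightarrow> clinear (\<lambda>x. bal3_nf (g x))"
  by (simp add: bal3_nf_def)

lemma bal3_nf_relators:
  "bal3_nf (tgt_mult \<beta> m \<otimes> n \<otimes> p) = bal3_nf (m \<otimes> src_mult \<beta> n \<otimes> p)"
  "bal3_nf (m \<otimes> tgt_mult \<beta> n \<otimes> p) = bal3_nf (m \<otimes> n \<otimes> src_mult \<beta> p)"
  by (simp_all add: bal3_nf_def tgt_mult_def[of \<beta> m] tfold_tfold src_mult_src_mult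
      tgt_mult_src_mult[symmetric] bal_nf_relator)

definition map_tensor3 where "map_tensor3 f w = tfold w (\<lambda>m z. f m \<otimes> map_tensor f z)"

lemma clinear_map_tensor3:
  assumes "clinear f" "clinear g" shows "clinear (\<lambda>x. map_tensor3 f (g x))"
  unfolding map_tensor3_def
  by (intro linear_intros assms(2) clinear_compose[OF assms(1)] clinear_map_tensor[OF assms(1)])

lemma map_tensor3_tensor: "clinear f \<Longrightarrow> map_tensor3 f (m \<otimes> n \<otimes> p) = f m \<otimes> f n \<otimes> f p"
  unfolding map_tensor3_def map_tensor_tensor[symmetric]
  by (rule tfold_tensor) (intro linear_intros clinear_map_tensor; assumption)

context modelled
begin

lemma clinear_phi_rho [linear_intros, simp]:
  "clinear f \<Longrightarrow> clinear (\<lambda>x. \<phi> (f x))"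
  "clinear g \<Longrightarrow> clinear (\<lambda>x. \<rho> (g x))"
  "clinear f' \<Longrightarrow> clinear (\<lambda>x. map_tensor \<phi> (f' x))"
  "clinear g' \<Longrightarrow> clinear (\<lambda>x. map_tensor \<rho> (g' x))"
  "clinear f'' \<Longrightarrow> clinear (\<lambda>x. map_tensor3 \<phi> (f'' x))"
  by (rule clinear_compose[OF clinear_phi] clinear_compose[OF clinear_rho]
      clinear_map_tensor[OF clinear_phi] clinear_map_tensor[OF clinear_rho]
      clinear_map_tensor3[OF clinear_phi]; assumption)+

lemma map_tensor_phi_tensor [simp]:
  "map_tensor \<phi> (m \<otimes> n) = \<phi> m \<otimes> \<phi> n"
  "map_tensor \<rho> (x \<otimes> y) = \<rho> x \<otimes> \<rho> y"  "map_tensor3 \<phi> (m \<otimes> n \<otimes> p) = \<phi> m \<otimes> \<phi> n \<otimes> \<phi> p"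
  by (rule map_tensor_tensor map_tensor3_tensor, rule clinear_phi clinear_rho)+

lemma src_eq:
  "src L \<beta> = \<phi> (\<beta> \<otimes> 1 \<otimes> 1)"
  and tgt_eq: "tgt L \<beta> = \<phi> (1 \<otimes> \<beta> \<otimes> 1)"
  by (simp_all add: src_def tgt_def leta_eq)

lemma lmul_src:
  "lmul L (src L \<beta>) (\<phi> m) = \<phi> (src_mult \<beta> m)"
  and lmul_tgt: "lmul L (tgt L \<beta>) (\<phi> m) = \<phi> (tgt_mult \<beta> m)"
  by (simp_all add: src_eq tgt_eq lmul_eq model_mult_src model_mult_tgt)

lemma bal_eq: "bal L = cspan {\<phi> (tgt_mult \<beta> m) \<otimes> \<phi> n - \<phi> m \<otimes> \<phi> (src_mult \<beta> n) | \<beta> m n. True}"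
proof -
  have "{lmul L (tgt L b) x \<otimes> y - x \<otimes> lmul L (src L b) y | x y b. x \<in> range \<phi> \<and> y \<in> range \<phi>}
    = {lmul L (tgt L \<beta>) (\<phi> m) \<otimes> \<phi> n - \<phi> m \<otimes> lmul L (src L \<beta>) (\<phi> n) | \<beta> m n. True}"
    by blast
  then show ?thesis by (simp only: bal_def lcar_eq lmul_src lmul_tgt)
qed

lemma bal_iff: "map_tensor \<phi> z \<in> bal L \<longleftrightarrow> bal_nf z = 0"
proof
  have "bal_nf (map_tensor \<rho> w) = 0" if "w \<in> bal L" for w
    using that unfolding bal_eq
    by (rule linear_span_zero[rotated 2]) (auto simp:
        clinear_diff[of "\<lambda>w. bal_nf (map_tensor \<rho> w)"] bal_nf_relator)
  from this[of "map_tensor \<phi> z"] show "map_tensor \<phi> z \<in> bal L \<Longrightarrow> bal_nf z = 0"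
    by (simp add: map_tensor_map_tensor[of \<rho> \<phi>] clinear_rho)
next
  assume "bal_nf z = 0"
  then have "z \<in> bal_model" by (simp add: bal_model_iff)
  then show "map_tensor \<phi> z \<in> bal L"
    unfolding bal_model_def
  proof (rule linear_span_in[rotated 3])
    fix w :: "('b \<otimes> 'b \<otimes> 'h) \<otimes> ('b \<otimes> 'b \<otimes> 'h)" assume "w \<in> {tgt_mult \<beta> m \<otimes> n - m \<otimes> src_mult \<beta> n | \<beta>
        m n. True}"
    then obtain \<beta> m n where "w = tgt_mult \<beta> m \<otimes> n - m \<otimes> src_mult \<beta> n" by blast
    then have "map_tensor \<phi> w = \<phi> (tgt_mult \<beta> m) \<otimes> \<phi> n - \<phi> m \<otimes> \<phi> (src_mult \<beta> n)"
      by (simp add: clinear_diff[of "\<lambda>w. map_tensor \<phi> w"])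
    also have "\<dots> \<in> bal L" unfolding bal_eq by (rule cvec.span_base) blast
    finally show "map_tensor \<phi> w \<in> bal L" .
  qed (simp_all add: clinear_phi_rho(3)[OF clinear_ident])
qed

lemma lcop_memI: "bal_nf z = bal_nf (model_cop m) \<Longrightarrow> map_tensor \<phi> z \<in> lcop L (\<phi> m)"
  using bal_iff[of "z - model_cop m"]
  by (simp add: lcop_eq coset_def clinear_diff[of "\<lambda>w. map_tensor \<phi> w"]
      clinear_diff[of "\<lambda>w. bal_nf w"])

lemma csw2_spec:
  "set (csw2 L (\<phi> m)) \<subseteq> range \<phi> \<times> range \<phi> \<and> (\<Sum>(x, y)\<leftarrow>csw2 L (\<phi> m). x \<otimes> y) \<in> lcop L (\<phi> m)"
proof -
  let ?xs = "map (\<lambda>(x, y). (\<phi> x, \<phi> y)) (simple (model_cop m))"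
  have "set ?xs \<subseteq> lcar L \<times> lcar L \<and> (\<Sum>(x, y)\<leftarrow>?xs. x \<otimes> y) \<in> lcop L (\<phi> m)"
    using lcop_memI[of "model_cop m" m, OF refl]
    by (auto simp: lcar_eq comp_def split_def map_tensor_def tfold_def)
  then show ?thesis
    unfolding csw2_def by (rule someI2) (simp add: lcar_eq)
qed

text \<open>
  A sum over the unspecified representative \<open>csw2\<close> of a balanced expression is a sum over
  \<open>model_cop\<close>.
\<close>

lemma csw2_eval:
  assumes G: "balanced G" and H: "\<And>m n. H (\<phi> m) (\<phi> n) = G m n"
  shows "(\<Sum>(x, y)\<leftarrow>csw2 L (\<phi> m). H x y) = tfold (model_cop m) G"
proof -
  let ?z = "\<Sum>(x, y)\<leftarrow>csw2 L (\<phi> m). x \<otimes> y"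
  have bil: "cbilinear (\<lambda>x y. G (\<rho> x) (\<rho> y))"
    by (rule cbilinearI) (rule clinear_bilinear_right clinear_bilinear_left, rule
        balanced_bilinear[OF G], simp)+
  then have lin: "clinear (\<lambda>z. tfold z (\<lambda>x y. G (\<rho> x) (\<rho> y)))"
    by (rule clinear_tfold_left)
  have "(\<Sum>(x, y)\<leftarrow>csw2 L (\<phi> m). H x y) = (\<Sum>(x, y)\<leftarrow>csw2 L (\<phi> m). G (\<rho> x) (\<rho> y))"
    using csw2_spec[of m] by (intro sum_list_cong2[of _ "range \<phi>" "range \<phi>"]) (auto simp: H)
  also have "\<dots> = tfold ?z (\<lambda>x y. G (\<rho> x) (\<rho> y))"
    by (rule tfold_unique[OF bil refl])
  also have "\<dots> = tfold (map_tensor \<phi> (model_cop m)) (\<lambda>x y. G (\<rho> x) (\<rho> y))"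
  proof -
    have "?z - map_tensor \<phi> (model_cop m) \<in> bal L"
      using csw2_spec[of m] by (simp add: lcop_eq coset_def)
    then have "tfold (?z - map_tensor \<phi> (model_cop m)) (\<lambda>x y. G (\<rho> x) (\<rho> y)) = 0"
      unfolding bal_eq
      by (rule linear_span_zero[OF lin, rotated])
        (use G bil in \<open>auto simp: clinear_diff[OF lin] balanced_def\<close>)
    then show ?thesis by (simp add: clinear_diff[OF lin])
  qed
  also have "\<dots> = tfold (model_cop m) G"
    by (simp add: map_tensor_def tfold_tfold[OF bil] tfold_tensor[OF bil])
  finally show ?thesis .
qed

lemma csw2_map_tensor:
  assumes "\<And>m n. H (\<phi> m) (\<phi> n) = map_tensor \<psi> (G m n)"
  shows "(\<Sum>(x, y)\<leftarrow>csw2 L (\<phi> m). H x y) = (\<Sum>(x, y)\<leftarrow>csw2 L (\<phi> m). map_tensor \<psi> (G (\<rho> x) (\<rho> y)))"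
  using csw2_spec[of m] by (intro sum_list_cong2[of _ "range \<phi>" "range \<phi>"]) (auto simp: assms)

lemma phi_add:
  "\<phi> m + \<phi> n = \<phi> (m + n)"
  and phi_scale: "c *\<^sub>C \<phi> m = \<phi> (c *\<^sub>C m)"
  and phi_diff: "\<phi> m - \<phi> n = \<phi> (m - n)"
  by (simp_all add: clinear_add[OF clinear_phi] clinear_scaleC[OF clinear_phi]
      clinear_diff[OF clinear_phi])

lemma model_mult_linear:
  "model_mult (m + m') n = model_mult m n + model_mult m' n"
  "model_mult m (n + n') = model_mult m n + model_mult m n'"
  "model_mult (c *\<^sub>C m) n = c *\<^sub>C model_mult m n"
  by (rule clinear_add clinear_scaleC, simp)+

lemma model_cou_add: "model_cou (m + n) = model_cou m + model_cou n"
  by (rule clinear_add) simp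

lemma leta_mult: "leta L (env_mult (*) p q) = lmul L (leta L p) (leta L q)"
  by (simp add: leta_eq lmul_eq env_mult_def sum_list_simple model_mult_def tfold_tfold sw_one
      sigma_mult_one sigma_inv_mult_one counit_one)

lemma eta_is_linear: "clinear (leta L)"
  unfolding leta_eq[abs_def] by simp

lemma lcop_add: "(\<Sum>(x, y)\<leftarrow>csw2 L (\<phi> m). x \<otimes> y) + (\<Sum>(x, y)\<leftarrow>csw2 L (\<phi> n). x \<otimes> y) \<in> lcop L (\<phi> (m + n))"
proof -
  let ?s = "\<lambda>m. \<Sum>(x, y)\<leftarrow>csw2 L (\<phi> m). x \<otimes> y"
  have "?s m - map_tensor \<phi> (model_cop m) + (?s n - map_tensor \<phi> (model_cop n)) \<in> bal L"
    using csw2_spec[of m] csw2_spec[of n]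
    by (intro cvec.subspace_add[OF csubspace_bal]) (simp_all add: lcop_eq coset_def)
  moreover have "map_tensor \<phi> (model_cop (m + n))
      = map_tensor \<phi> (model_cop m) + map_tensor \<phi> (model_cop n)"
    by (rule clinear_add) simp
  ultimately show ?thesis by (simp add: lcop_eq coset_def algebra_simps)
qed

text \<open>A sum over \<open>csw2\<close> with values in a tensor square depends on the choice of
  representatives, hence the existential \<open>w\<close>. Only its normal form is determined, and
  this is what membership in a coproduct coset requires.\<close>

lemma csw2_lcop_memI:
  assumes H: "\<And>m n. H (\<phi> m) (\<phi> n) = map_tensor \<psi> (G m n)" and "clinear \<psi>"
    and G: "balanced (\<lambda>m n. bal_nf (G m n))" and eq: "tfold (model_cop m) (\<lambda>p q. bal_nf (G p q))
        = z"
  shows "\<exists>w. (\<Sum>(x, y)\<leftarrow>csw2 L (\<phi> m). H x y) = map_tensor \<psi> w \<and> bal_nf w = z"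
proof (intro exI conjI)
  let ?w = "\<Sum>(x, y)\<leftarrow>csw2 L (\<phi> m). G (\<rho> x) (\<rho> y)"
  show "(\<Sum>(x, y)\<leftarrow>csw2 L (\<phi> m). H x y) = map_tensor \<psi> ?w"
    unfolding csw2_map_tensor[of H \<psi> G, OF H]
    using assms(2)
    by (simp add: split_def clinear_sum_list[of "map_tensor \<psi>"]
        clinear_map_tensor[OF _ clinear_ident])
  have "bal_nf ?w = (\<Sum>(x, y)\<leftarrow>csw2 L (\<phi> m). bal_nf (G (\<rho> x) (\<rho> y)))"
    by (simp add: split_def clinear_sum_list[of bal_nf] clinear_bal_nf[OF clinear_ident])
  also have "\<dots> = tfold (model_cop m) (\<lambda>p q. bal_nf (G p q))"
    by (rule csw2_eval[OF G]) simp
  finally show "bal_nf ?w = z" by (simp add: eq)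
qed

end

context central_cocycle
begin

text \<open>Bilinearity of the coproduct over the base. In the model it holds for the tensors
  themselves, not just modulo balancing, so any bilinear \<open>F\<close> may be applied.\<close>

lemma model_cop_shift:
  "cbilinear F \<Longrightarrow> tfold (model_cop (tgt_mult \<beta> m)) F
      = tfold (model_cop m) (\<lambda>p q. F p (tgt_mult \<beta> q))"
  "cbilinear F \<Longrightarrow> tfold (model_cop (src_mult \<beta> m)) F
      = tfold (model_cop m) (\<lambda>p q. F (src_mult \<beta> p) q)"
proof -
  assume F: "cbilinear F"
  note [simp] = F clinear_bilinear_left[OF F] clinear_bilinear_right[OF F]
  show "tfold (model_cop (tgt_mult \<beta> m)) F = tfold (model_cop m) (\<lambda>p q. F p (tgt_mult \<beta> q))"
    by (rule tensor3_ext[of "\<lambda>m. tfold (model_cop (tgt_mult \<beta> m)) F" "\<lambda>m. tfold (model_cop m)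
        (\<lambda>p q. F p (tgt_mult \<beta> q))"]) (simp_all add: model_cop_tensor tfold_tfold)
  show "tfold (model_cop (src_mult \<beta> m)) F = tfold (model_cop m) (\<lambda>p q. F (src_mult \<beta> p) q)"
    by (rule tensor3_ext[of "\<lambda>m. tfold (model_cop (src_mult \<beta> m)) F" "\<lambda>m. tfold (model_cop m)
        (\<lambda>p q. F (src_mult \<beta> p) q)"]) (simp_all add: model_cop_tensor tfold_tfold)
qed

text \<open>In both iterated coproducts all entries other than the outermost two are 1, so the
  identity is coassociativity of the Hopf algebra.\<close>

lemma model_cop_coassoc:
  "tfold (model_cop m) (\<lambda>p q. tfold (model_cop p) (\<lambda>u v. bal3_nf (u \<otimes> v \<otimes> q)))
      = tfold (model_cop m) (\<lambda>p q. tfold (model_cop q) (\<lambda>u v. bal3_nf (p \<otimes> u \<otimes> v)))"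
  by (rule tensor3_ext[of "\<lambda>m. tfold (model_cop m)
      (\<lambda>p q. tfold (model_cop p) (\<lambda>u v. bal3_nf (u \<otimes> v \<otimes> q)))"])
    (simp_all add: model_cop_tensor tfold_tfold tricoassoc)

end

context modelled
begin

lemma cop_bimodule_phi:
  "(\<Sum>(x, y)\<leftarrow>csw2 L (\<phi> m). lmul L (src L b) x \<otimes> lmul L (tgt L b') y) \<in> lcop L
      (\<phi> (src_mult b (tgt_mult b' m)))"
proof -
  have "\<exists>w. (\<Sum>(x, y)\<leftarrow>csw2 L (\<phi> m). lmul L (src L b) x \<otimes> lmul L (tgt L b') y)
      = map_tensor \<phi> w \<and> bal_nf w = bal_nf (model_cop (src_mult b (tgt_mult b' m)))"
  proof (rule csw2_lcop_memI[where G = "\<lambda>m n. src_mult b m \<otimes> tgt_mult b' n"])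
    show "tfold (model_cop m) (\<lambda>p q. bal_nf (src_mult b p \<otimes> tgt_mult b' q))
        = bal_nf (model_cop (src_mult b (tgt_mult b' m)))"
      by (rule tensor3_ext[of "\<lambda>m. tfold (model_cop m)
          (\<lambda>p q. bal_nf (src_mult b p \<otimes> tgt_mult b' q))"])
        (simp_all add: model_cop_tensor tfold_tfold tfold_push[of bal_nf]
            clinear_bal_nf[OF clinear_ident])
  qed (simp_all add: lmul_src lmul_tgt clinear_phi balanced_def tgt_mult_src_mult[symmetric]
      bal_nf_relator)
  then show ?thesis using lcop_memI by fastforce
qed

lemma csw2_push:
  assumes "clinear f" "\<And>m n. H (\<phi> m) (\<phi> n) = f (G m n)"
  shows "(\<Sum>(x, y)\<leftarrow>csw2 L (\<phi> m). H x y) = f (\<Sum>(x, y)\<leftarrow>csw2 L (\<phi> m). G (\<rho> x) (\<rho> y))"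
proof -
  have "(\<Sum>(x, y)\<leftarrow>csw2 L (\<phi> m). H x y) = (\<Sum>(x, y)\<leftarrow>csw2 L (\<phi> m). f (G (\<rho> x) (\<rho> y)))"
    using csw2_spec[of m] by (intro sum_list_cong2[of _ "range \<phi>" "range \<phi>"]) (auto simp: assms(2))
  then show ?thesis by (simp add: split_def clinear_sum_list[OF assms(1)])
qed

lemma bal3_eq:
  "bal3 L = cspan ({\<phi> (tgt_mult \<beta> m) \<otimes> \<phi> n \<otimes> \<phi> p - \<phi> m \<otimes> \<phi> (src_mult \<beta> n) \<otimes> \<phi> p | \<beta> m n p. True}
   \<union> {\<phi> m \<otimes> \<phi> (tgt_mult \<beta> n) \<otimes> \<phi> p - \<phi> m \<otimes> \<phi> n \<otimes> \<phi> (src_mult \<beta> p) | \<beta> m n p. True})"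
proof -
  have 1: "{lmul L (tgt L b) x \<otimes> y \<otimes> z - x \<otimes> lmul L (src L b) y \<otimes> z | x y z b. x \<in> range \<phi> \<and> y \<in>
      range \<phi> \<and> z \<in> range \<phi>}
    = {lmul L (tgt L \<beta>) (\<phi> m) \<otimes> \<phi> n \<otimes> \<phi> p - \<phi> m \<otimes> lmul L (src L \<beta>) (\<phi> n) \<otimes> \<phi> p | \<beta> m n p. True}"
    by blast
  have 2: "{x \<otimes> lmul L (tgt L b) y \<otimes> z - x \<otimes> y \<otimes> lmul L (src L b) z | x y z b. x \<in> range \<phi> \<and> y \<in>
      range \<phi> \<and> z \<in> range \<phi>}
    = {\<phi> m \<otimes> lmul L (tgt L \<beta>) (\<phi> n) \<otimes> \<phi> p - \<phi> m \<otimes> \<phi> n \<otimes> lmul L (src L \<beta>) (\<phi> p) | \<beta> m n p. True}"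
    by blast
  show ?thesis unfolding bal3_def lcar_eq 1 2 lmul_src lmul_tgt ..
qed

lemma csubspace_bal3: "csubspace (bal3 L)"
  by (simp add: bal3_def)

text \<open>On simple tensors the reduction consists of one relator between the first two factors,
  which moves \<open>b'\<close>, and the reduction by \<open>bal_nf\<close> of the last two, which
  uses relators of the second kind.\<close>

lemma map_tensor3_bal3_nf: "map_tensor3 \<phi> (w - bal3_nf w) \<in> bal3 L"
proof (rule tensor_in_subspace[of _ "\<lambda>w. map_tensor3 \<phi> (w - bal3_nf w)"], rule csubspace_bal3, simp)
  fix m z
  show "map_tensor3 \<phi> (m \<otimes> z - bal3_nf (m \<otimes> z)) \<in> bal3 L"
  proof (rule tensor_in_subspace[of _ "\<lambda>z. map_tensor3 \<phi> (m \<otimes> z - bal3_nf (m \<otimes> z))"], rule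
      csubspace_bal3, simp)
    fix n p
    show "map_tensor3 \<phi> (m \<otimes> n \<otimes> p - bal3_nf (m \<otimes> n \<otimes> p)) \<in> bal3 L"
    proof (rule tensor_in_subspace[of _ "\<lambda>m. map_tensor3 \<phi> (m \<otimes> n \<otimes> p - bal3_nf (m \<otimes> n \<otimes> p))"],
        rule csubspace_bal3, simp)
      fix b r
      show "map_tensor3 \<phi> ((b \<otimes> r) \<otimes> n \<otimes> p - bal3_nf ((b \<otimes> r) \<otimes> n \<otimes> p)) \<in> bal3 L"
      proof (rule tensor_in_subspace[of _ "\<lambda>r. map_tensor3 \<phi>
          ((b \<otimes> r) \<otimes> n \<otimes> p - bal3_nf ((b \<otimes> r) \<otimes> n \<otimes> p))"], rule csubspace_bal3, simp)
        fix b' and h :: 'h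
        let ?m = "b \<otimes> 1 \<otimes> h" and ?z = "src_mult b' n \<otimes> p"
        note lin = clinear_phi_rho(5)[OF clinear_ident]
        have "map_tensor3 \<phi> (?m \<otimes> (?z - bal_nf ?z)) \<in> bal3 L"
          using bal_nf_bal_model[of ?z] unfolding bal_model_def
        proof (rule linear_span_in[of "\<lambda>z. map_tensor3 \<phi> (?m \<otimes> z)", OF _ csubspace_bal3, rotated 2])
          fix w :: "('b \<otimes> 'b \<otimes> 'h) \<otimes> ('b \<otimes> 'b \<otimes> 'h)" assume "w \<in> {tgt_mult \<beta> m \<otimes> n - m \<otimes> src_mult \<beta>
              n | \<beta> m n. True}"
          then obtain \<beta> m' n' where "w = tgt_mult \<beta> m' \<otimes> n' - m' \<otimes> src_mult \<beta> n'" by blast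
          then have "map_tensor3 \<phi> (?m \<otimes> w) = \<phi> ?m \<otimes> \<phi> (tgt_mult \<beta> m') \<otimes> \<phi> n' - \<phi> ?m \<otimes> \<phi> m' \<otimes> \<phi>
              (src_mult \<beta> n')"
            by (simp add: clinear_diff[of "\<lambda>w. map_tensor3 \<phi> (?m \<otimes> w)"])
          also have "\<dots> \<in> bal3 L"
            unfolding bal3_eq by (rule cvec.span_base) blast
          finally show "map_tensor3 \<phi> (?m \<otimes> w) \<in> bal3 L" .
        qed simp
        moreover have "\<phi> (tgt_mult b' ?m) \<otimes> \<phi> n \<otimes> \<phi> p - \<phi> ?m \<otimes> \<phi> (src_mult b' n) \<otimes> \<phi> p \<in> bal3 L"
          unfolding bal3_eq by (rule cvec.span_base) blast
        moreover have "map_tensor3 \<phi> ((b \<otimes> b' \<otimes> h) \<otimes> n \<otimes> p - bal3_nf ((b \<otimes> b' \<otimes> h) \<otimes> n \<otimes> p))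
          = map_tensor3 \<phi> (?m \<otimes> (?z - bal_nf ?z)) +
              (\<phi> (tgt_mult b' ?m) \<otimes> \<phi> n \<otimes> \<phi> p - \<phi> ?m \<otimes> \<phi> (src_mult b' n) \<otimes> \<phi> p)"
          by (simp add: clinear_diff[OF lin] bal3_nf_def clinear_diff[of "\<lambda>w. ?m \<otimes> w"])
        ultimately show "map_tensor3 \<phi> ((b \<otimes> b' \<otimes> h) \<otimes> n \<otimes> p - bal3_nf ((b \<otimes> b' \<otimes> h) \<otimes> n \<otimes> p)) \<in>
            bal3 L"
          using cvec.subspace_add[OF csubspace_bal3] by simp
      qed
    qed
  qed
qed

text \<open>The two sums run over unrelated chosen representatives. Each is congruent to its normal
  form modulo \<open>bal3\<close>, and the normal forms can be evaluated with
  \<open>model_cop\<close>, where they agree.\<close>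

lemma cop_coassoc_phi:
  "(\<Sum>(x, y)\<leftarrow>csw2 L (\<phi> m). \<Sum>(u, v)\<leftarrow>csw2 L x. u \<otimes> v \<otimes> y)
        - (\<Sum>(x, y)\<leftarrow>csw2 L (\<phi> m). \<Sum>(u, v)\<leftarrow>csw2 L y. x \<otimes> u \<otimes> v) \<in> bal3 L"
proof -
  note lin = clinear_phi_rho(5)[OF clinear_ident]
  let ?A = "\<lambda>m n. \<Sum>(u, v)\<leftarrow>csw2 L (\<phi> m). \<rho> u \<otimes> \<rho> v \<otimes> n"
  let ?B = "\<lambda>m n. \<Sum>(u, v)\<leftarrow>csw2 L (\<phi> n). m \<otimes> \<rho> u \<otimes> \<rho> v"
  let ?SA = "\<Sum>(x, y)\<leftarrow>csw2 L (\<phi> m). ?A (\<rho> x) (\<rho> y)" and ?SB = "\<Sum>(x, y)\<leftarrow>csw2 L (\<phi> m). ?B (\<rho> x) (\<rho> y)"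
  have A: "(\<Sum>(x, y)\<leftarrow>csw2 L (\<phi> m). \<Sum>(u, v)\<leftarrow>csw2 L x. u \<otimes> v \<otimes> y) = map_tensor3 \<phi> ?SA"
    by (rule csw2_push[OF lin], rule csw2_push[OF lin]) simp
  have B: "(\<Sum>(x, y)\<leftarrow>csw2 L (\<phi> m). \<Sum>(u, v)\<leftarrow>csw2 L y. x \<otimes> u \<otimes> v) = map_tensor3 \<phi> ?SB"
    by (rule csw2_push[OF lin], rule csw2_push[OF lin]) simp
  have nfA: "bal3_nf (?A p q) = tfold (model_cop p) (\<lambda>u v. bal3_nf (u \<otimes> v \<otimes> q))" for p q
    using csw2_eval[of "\<lambda>u v. bal3_nf (u \<otimes> v \<otimes> q)" "\<lambda>u v. bal3_nf (\<rho> u \<otimes> \<rho> v \<otimes> q)" p]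
    by (simp add: balanced_def bal3_nf_relators split_def
        clinear_sum_list[of bal3_nf, OF clinear_bal3_nf[OF clinear_ident]])
  have nfB: "bal3_nf (?B p q) = tfold (model_cop q) (\<lambda>u v. bal3_nf (p \<otimes> u \<otimes> v))" for p q
    using csw2_eval[of "\<lambda>u v. bal3_nf (p \<otimes> u \<otimes> v)" "\<lambda>u v. bal3_nf (p \<otimes> \<rho> u \<otimes> \<rho> v)" q]
    by (simp add: balanced_def bal3_nf_relators split_def
        clinear_sum_list[of bal3_nf, OF clinear_bal3_nf[OF clinear_ident]])
  have "bal3_nf ?SA = (\<Sum>(x, y)\<leftarrow>csw2 L (\<phi> m). bal3_nf (?A (\<rho> x) (\<rho> y)))"
    by (simp only: split_def clinear_sum_list[of bal3_nf, OF clinear_bal3_nf[OF clinear_ident]])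
  also have "\<dots> = tfold (model_cop m) (\<lambda>p q. tfold (model_cop p) (\<lambda>u v. bal3_nf (u \<otimes> v \<otimes> q)))"
    by (rule csw2_eval) (simp_all only: nfA rho_phi, simp add: balanced_def model_cop_shift
        bal3_nf_relators)
  also have "\<dots> = tfold (model_cop m) (\<lambda>p q. tfold (model_cop q) (\<lambda>u v. bal3_nf (p \<otimes> u \<otimes> v)))"
    by (rule model_cop_coassoc)
  also have "\<dots> = (\<Sum>(x, y)\<leftarrow>csw2 L (\<phi> m). bal3_nf (?B (\<rho> x) (\<rho> y)))"
    by (rule csw2_eval[symmetric]) (simp_all only: nfB rho_phi, simp add: balanced_def
        model_cop_shift bal3_nf_relators)
  also have "\<dots> = bal3_nf ?SB"
    by (simp only: split_def clinear_sum_list[of bal3_nf, OF clinear_bal3_nf[OF clinear_ident]])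
  finally have eq: "bal3_nf ?SA = bal3_nf ?SB" .
  have "map_tensor3 \<phi> (?SA - bal3_nf ?SA) - map_tensor3 \<phi> (?SB - bal3_nf ?SB) \<in> bal3 L"
    by (intro cvec.subspace_diff[OF csubspace_bal3] map_tensor3_bal3_nf)
  then have "map_tensor3 \<phi> ?SA - map_tensor3 \<phi> ?SB \<in> bal3 L"
    by (simp only: eq clinear_diff[OF lin]) simp
  then show ?thesis unfolding A B .
qed

lemma cou_left_phi: "(\<Sum>(x, y)\<leftarrow>csw2 L (\<phi> m). lmul L (src L (lcou L x)) y) = \<phi> m"
proof -
  have "(\<Sum>(x, y)\<leftarrow>csw2 L (\<phi> m). lmul L (src L (lcou L x)) y)
      = tfold (model_cop m) (\<lambda>p q. \<phi> (src_mult (model_cou p) q))"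
    by (rule csw2_eval) (simp_all add: balanced_def lcou_eq lmul_src model_cou_tgt_mult
        src_mult_src_mult)
  also have "\<dots> = \<phi> m"
    by (rule tensor3_ext[of "\<lambda>m. tfold (model_cop m) (\<lambda>p q. \<phi> (src_mult (model_cou p) q))" \<phi>])
      (simp_all add: clinear_phi model_cop_tensor model_cou_tensor tfold_tfold phi_scale[symmetric]
          clinear_scaleC[of "\<lambda>c. src_mult c _"] counits scaleC_out)
  finally show ?thesis .
qed

lemma cou_right_phi: "(\<Sum>(x, y)\<leftarrow>csw2 L (\<phi> m). lmul L (tgt L (lcou L y)) x) = \<phi> m"
proof -
  have "(\<Sum>(x, y)\<leftarrow>csw2 L (\<phi> m). lmul L (tgt L (lcou L y)) x)
      = tfold (model_cop m) (\<lambda>p q. \<phi> (tgt_mult (model_cou q) p))"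
    by (rule csw2_eval) (simp_all add: balanced_def lcou_eq lmul_tgt model_cou_src_mult
        tgt_mult_tgt_mult)
  also have "\<dots> = \<phi> m"
    by (rule tensor3_ext[of "\<lambda>m. tfold (model_cop m) (\<lambda>p q. \<phi> (tgt_mult (model_cou q) p))" \<phi>])
      (simp_all add: clinear_phi model_cop_tensor model_cou_tensor tfold_tfold phi_scale[symmetric]
          clinear_scaleC[of "\<lambda>c. tgt_mult c _"] counits scaleC_out)
  finally show ?thesis .
qed

lemma cop_takeuchi_phi:
  "(\<Sum>(x, y)\<leftarrow>csw2 L (\<phi> m). lmul L x (tgt L b) \<otimes> y) - (\<Sum>(x, y)\<leftarrow>csw2 L (\<phi> m). x \<otimes> lmul L y (src L b))
      \<in> bal L"
proof -
  obtain v where v: "(\<Sum>(x, y)\<leftarrow>csw2 L (\<phi> m). lmul L x (tgt L b) \<otimes> y) = map_tensor \<phi> v"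
    "bal_nf v = tfold (model_cop m) (\<lambda>p q. bal_nf (model_mult p (1 \<otimes> b \<otimes> 1) \<otimes> q))"
    using csw2_lcop_memI[of "\<lambda>x y. lmul L x (tgt L b) \<otimes> y" \<phi> "\<lambda>p q. model_mult p (1 \<otimes> b \<otimes> 1) \<otimes> q"
        m, OF _ clinear_phi _ refl]
    by (auto simp: tgt_eq lmul_eq balanced_def tgt_mult_model_mult bal_nf_relator)
  obtain w where w: "(\<Sum>(x, y)\<leftarrow>csw2 L (\<phi> m). x \<otimes> lmul L y (src L b)) = map_tensor \<phi> w"
    "bal_nf w = tfold (model_cop m) (\<lambda>p q. bal_nf (p \<otimes> model_mult q (b \<otimes> 1 \<otimes> 1)))"
    using csw2_lcop_memI[of "\<lambda>x y. x \<otimes> lmul L y (src L b)" \<phi> "\<lambda>p q. p \<otimes> model_mult q (b \<otimes> 1 \<otimes> 1)"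
        m, OF _ clinear_phi _ refl]
    by (auto simp: src_eq lmul_eq balanced_def src_mult_model_mult bal_nf_relator)
  have "bal_nf (v - w) = 0"
    by (simp add: clinear_diff[of bal_nf, OF clinear_bal_nf[OF clinear_ident]] v w
        model_cop_takeuchi)
  then have "map_tensor \<phi> (v - w) \<in> bal L" by (simp add: bal_iff)
  then show ?thesis by (simp add: v w clinear_diff[of "map_tensor \<phi>", OF
      clinear_phi_rho(3)[OF clinear_ident]])
qed

text \<open>The sum over the coproduct of \<open>m\<close> is balanced term by term, the one over
  the coproduct of \<open>n\<close> only after the other has been carried out. The order of
  summation is therefore exchanged between the two evaluations.\<close>

lemma cop_mult_phi:
  "(\<Sum>(x, y)\<leftarrow>csw2 L (\<phi> m). \<Sum>(x', y')\<leftarrow>csw2 L (\<phi> n). lmul L x x' \<otimes> lmul L y y') \<in> lcop L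
      (\<phi> (model_mult m n))"
proof -
  let ?G = "\<lambda>p q. \<Sum>(x', y')\<leftarrow>csw2 L (\<phi> n). model_mult p (\<rho> x') \<otimes> model_mult q (\<rho> y')"
  have nfG: "bal_nf (?G p q) = (\<Sum>(x', y')\<leftarrow>csw2 L (\<phi> n). bal_nf
      (model_mult p (\<rho> x') \<otimes> model_mult q (\<rho> y')))" for p q
    by (simp add: split_def clinear_sum_list[of bal_nf, OF clinear_bal_nf[OF clinear_ident]])
  have "\<exists>w. (\<Sum>(x, y)\<leftarrow>csw2 L (\<phi> m). \<Sum>(x', y')\<leftarrow>csw2 L (\<phi> n). lmul L x x' \<otimes> lmul L y y')
      = map_tensor \<phi> w
     \<and> bal_nf w = bal_nf (model_cop (model_mult m n))"
  proof (rule csw2_lcop_memI[where G = ?G])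
    show "(\<Sum>(x', y')\<leftarrow>csw2 L (\<phi> n). lmul L (\<phi> p) x' \<otimes> lmul L (\<phi> q) y')
        = map_tensor \<phi> (?G p q)" for p q
      by (rule csw2_push[OF clinear_phi_rho(3)[OF clinear_ident]]) (simp add: lmul_eq)
    show "clinear \<phi>" by (rule clinear_phi)
    have "balanced (\<lambda>p q. \<Sum>(x', y')\<leftarrow>csw2 L (\<phi> n). bal_nf
        (model_mult p (\<rho> x') \<otimes> model_mult q (\<rho> y')))"
      unfolding split_def by (simp add: balanced_def tgt_mult_model_mult src_mult_model_mult
          bal_nf_relator)
    then show "balanced (\<lambda>p q. bal_nf (?G p q))"
      by (simp only: nfG)
    have "tfold (model_cop m) (\<lambda>p q. bal_nf (?G p q)) = tfold (model_cop m)
        (\<lambda>p q. \<Sum>(x', y')\<leftarrow>csw2 L (\<phi> n). bal_nf (model_mult p (\<rho> x') \<otimes> model_mult q (\<rho> y')))"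
      by (simp only: nfG)
    also have "\<dots> = (\<Sum>(x', y')\<leftarrow>csw2 L (\<phi> n). tfold (model_cop m)
        (\<lambda>p q. bal_nf (model_mult p (\<rho> x') \<otimes> model_mult q (\<rho> y'))))"
      unfolding split_def by (rule tfold_sum_list)
    also have "\<dots> = tfold (model_cop n) (\<lambda>p' q'. tfold (model_cop m)
        (\<lambda>p q. bal_nf (model_mult p p' \<otimes> model_mult q q')))"
      by (rule csw2_eval[OF model_cop_mult_balanced]) simp
    also have "\<dots> = bal_nf (model_cop (model_mult m n))"
      by (subst tfold_swap) (rule model_cop_mult)
    finally show "tfold (model_cop m) (\<lambda>p q. bal_nf (?G p q))
        = bal_nf (model_cop (model_mult m n))" .
  qed
  then show ?thesis using lcop_memI by fastforce
qed

lemma lmul_src_right: "lmul L (\<phi> m) (src L \<beta>) = \<phi> (model_mult m (\<beta> \<otimes> 1 \<otimes> 1))"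
  and lmul_tgt_right: "lmul L (\<phi> m) (tgt L \<beta>) = \<phi> (model_mult m (1 \<otimes> \<beta> \<otimes> 1))"
  by (simp_all add: src_eq tgt_eq lmul_eq)

lemma is_left_bialgebroid: "left_bialgebroid L"
proof (rule left_bialgebroid.intro, unfold lcar_eq)
  show "csubspace (range \<phi>)"
    by (rule cvec.subspaceI) (auto simp: phi_add phi_scale image_iff, metis phi_scale
        cvec.scale_zero_left)
  show "\<And>a. a \<in> range \<phi> \<Longrightarrow> lcop L a \<in> btensor L"
    using map_tensor_in_span[of \<phi>] by (auto simp: btensor_def lcar_eq lcop_eq)
  show "clinear (leta L)" by (rule eta_is_linear)
  show "leta L (env_mult (*) p q) = lmul L (leta L p) (leta L q)" for p q by (rule leta_mult)
  show "lone L \<otimes> lone L \<in> lcop L (lone L)"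
    using lcop_memI[of "(1 \<otimes> 1 \<otimes> 1) \<otimes> (1 \<otimes> 1 \<otimes> 1)" "1 \<otimes> 1 \<otimes> 1"]
    by (simp add: lone_eq model_cop_tensor sw_one)
qed (auto simp: lmul_eq lone_eq phi_add phi_scale model_mult_linear model_mult_scale
    model_mult_assoc model_mult_one lmul_src lmul_tgt lcop_add
   cop_bimodule_phi lcou_eq model_cou_add model_cou_src_mult model_cou_tgt_mult cop_coassoc_phi
       cou_left_phi cou_right_phi cop_takeuchi_phi cop_mult_phi
   lmul_src_right lmul_tgt_right model_cou_model_mult leta_eq model_cou_tensor counit_one
       mult.assoc)

end

text \<open>No computation with the cocycle is left: all structure maps of \<open>L\<close> and
  \<open>L'\<close> are given by the same formulas in the common model.\<close>

lemma modelled_isomorphism: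
  assumes "modelled \<Delta> \<epsilon> S \<sigma> \<sigma>i L \<phi> \<rho>" and "modelled \<Delta> \<epsilon> S \<sigma> \<sigma>i L' \<phi>' \<rho>'"
  shows "bialgebroid_isomorphism L L' (\<lambda>x. \<phi>' (\<rho> x))"
proof -
  interpret dom: modelled \<Delta> \<epsilon> S \<sigma> \<sigma>i L \<phi> \<rho> by (rule assms(1))
  interpret cod: modelled \<Delta> \<epsilon> S \<sigma> \<sigma>i L' \<phi>' \<rho>' by (rule assms(2))
  have comult: "(\<Sum>(x, y)\<leftarrow>csw2 L (\<phi> m). \<phi>' (\<rho> x) \<otimes> \<phi>' (\<rho> y)) \<in> lcop L' (\<phi>' m)" for m
  proof -
    have "\<exists>w. (\<Sum>(x, y)\<leftarrow>csw2 L (\<phi> m). \<phi>' (\<rho> x) \<otimes> \<phi>' (\<rho> y)) = map_tensor \<phi>' w \<and> bal_nf w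
        = bal_nf (dom.model_cop m)"
      by (rule dom.csw2_lcop_memI[where G = "\<lambda>m n. m \<otimes> n"])
        (simp_all add: cod.clinear_phi balanced_bal_nf_tensor tfold_linear_tensor
            clinear_bal_nf[OF clinear_ident])
    then show ?thesis using cod.lcop_memI by fastforce
  qed
  show ?thesis
  proof (intro bialgebroid_isomorphism.intro bialgebroid_morphism.intro dom.is_left_bialgebroid
      cod.is_left_bialgebroid
      bialgebroid_morphism_axioms.intro bialgebroid_isomorphism_axioms.intro, unfold dom.lcar_eq
          cod.lcar_eq)
    show "bij_betw (\<lambda>x. \<phi>' (\<rho> x)) (range \<phi>) (range \<phi>')"
      by (rule bij_betw_byWitness[of _ "\<lambda>x. \<phi> (\<rho>' x)"]) auto
  qed (auto simp: dom.phi_add cod.phi_add dom.lmul_src dom.lmul_tgt cod.lmul_src cod.lmul_tgt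
      comult dom.lcou_eq cod.lcou_eq
     dom.lone_eq cod.lone_eq dom.lmul_eq cod.lmul_eq)
qed

section \<open>Cocycles and twists in the model\<close>

text \<open>The formula for the cocycle with an arbitrary \<open>F\<close> in place of
  \<open>\<sigma>\<close>. It also covers \<open>\<sigma>i\<close>, the unit of the convolution
  algebra, and convolution inverses not yet known to have central values, for which the position of
  \<open>F\<close> in the product matters.\<close>

definition pairing :: "('h::complex_vector \<Rightarrow> 'h \<Rightarrow> 'b::complex_algebra) \<Rightarrow> 'b \<otimes> 'b \<otimes> 'h \<Rightarrow> 'b \<otimes> 'b \<otimes>
    'h \<Rightarrow> 'b" where
  "pairing F m n = tfold m (\<lambda>b r. tfold r (\<lambda>b' h. tfold n
      (\<lambda>c q. tfold q (\<lambda>c' g. b * c * F h g * c' * b'))))"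

lemma clinear_pairing [linear_intros, simp]:
  assumes "cbilinear F"
  shows "clinear f \<Longrightarrow> clinear (\<lambda>x. pairing F (f x) n)" "clinear f \<Longrightarrow> clinear (\<lambda>x. pairing F m (f x))"
proof -
  note [simp] = clinear_bilinear_left[OF assms] clinear_bilinear_right[OF assms]
  show "clinear f \<Longrightarrow> clinear (\<lambda>x. pairing F (f x) n)" "clinear f \<Longrightarrow> clinear (\<lambda>x. pairing F m (f x))"
    by (simp_all add: pairing_def)
qed

lemma pairing_tensor:
  assumes "cbilinear F" shows "pairing F (b \<otimes> b' \<otimes> h) (c \<otimes> c' \<otimes> g) = b * c * F h g * c' * b'"
proof -
  note [simp] = clinear_bilinear_left[OF assms] clinear_bilinear_right[OF assms]
  show ?thesis by (simp add: pairing_def)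
qed

lemma pairing_bimodule:
  assumes "cbilinear F"
  shows "pairing F (tgt_mult \<beta> m) n = pairing F m n * \<beta>" "pairing F (src_mult \<beta> m) n
      = \<beta> * pairing F m n"
proof -
  note [simp] = clinear_bilinear_left[OF assms] clinear_bilinear_right[OF assms]
  show "pairing F (tgt_mult \<beta> m) n = pairing F m n * \<beta>" "pairing F (src_mult \<beta> m) n
      = \<beta> * pairing F m n"
    by (simp_all add: pairing_def tgt_mult_def src_mult_def tfold_tfold tfold_mult_left
        tfold_mult_right mult.assoc)
qed

lemma tensor3_ext2:
  assumes "cbilinear f" "cbilinear g" "\<And>b b' h c c' k. f (b \<otimes> b' \<otimes> h) (c \<otimes> c' \<otimes> k)
      = g (b \<otimes> b' \<otimes> h) (c \<otimes> c' \<otimes> k)"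
  shows "f m n = g m n"
proof (rule tensor3_ext[of "\<lambda>m. f m n" "\<lambda>m. g m n"])
  show "clinear (\<lambda>m. f m n)" "clinear (\<lambda>m. g m n)" using assms by (simp_all add: cbilinear_def)
  show "f (b \<otimes> b' \<otimes> h) n = g (b \<otimes> b' \<otimes> h) n" for b b' h
    by (rule tensor3_ext[of "f (b \<otimes> b' \<otimes> h)" "g (b \<otimes> b' \<otimes> h)"])
        (use assms in \<open>simp_all add: cbilinear_def\<close>)
qed

context hopf_algebra
begin

definition triv :: "'h \<Rightarrow> 'h \<Rightarrow> 'b::complex_algebra" where "triv h k = (\<epsilon> h * \<epsilon> k) *\<^sub>C 1"

lemma triv_central_cocycle: "central_cocycle \<Delta> \<epsilon> S (triv :: 'h \<Rightarrow> 'h \<Rightarrow> 'b::complex_algebra) triv"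
proof (intro central_cocycle.intro central_cocycle_axioms.intro hopf_algebra_axioms)
  show "cbilinear (triv :: 'h \<Rightarrow> 'h \<Rightarrow> 'b)" "cbilinear (triv :: 'h \<Rightarrow> 'h \<Rightarrow> 'b)"
    by (simp_all add: triv_def[abs_def] counit_simps)
qed (simp_all add: triv_def scaleC_out counit_simps counits tfold_scale cvec.scale_left_commute)

end

context modelled
begin

text \<open>The asymmetry of the two balancing hypotheses is that of the Takeuchi condition: in
  \<open>p'\<close> and \<open>q'\<close> balancing is available only after summation over the first
  coproduct.\<close>

lemma csw2_double_eval:
  assumes H: "\<And>p q p' q'. H (\<phi> p) (\<phi> q) (\<phi> p') (\<phi> q') = K p q p' q'"
    and lin: "\<And>p' q'. cbilinear (\<lambda>p q. K p q p' q')" "\<And>p q. cbilinear (\<lambda>p' q'. K p q p' q')"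
    and bal: "\<And>p q p' q' \<beta>. K (tgt_mult \<beta> p) q p' q' = K p (src_mult \<beta> q) p' q'"
    and bal': "\<And>b b' h p' q' \<beta>. tfold (model_cop (b \<otimes> b' \<otimes> h)) (\<lambda>p q. K p q (tgt_mult \<beta> p') q')
        = tfold (model_cop (b \<otimes> b' \<otimes> h)) (\<lambda>p q. K p q p' (src_mult \<beta> q'))"
  shows "(\<Sum>(x, y)\<leftarrow>csw2 L (\<phi> m). \<Sum>(x', y')\<leftarrow>csw2 L (\<phi> n). H x y x' y')
    = tfold (model_cop m) (\<lambda>p q. tfold (model_cop n) (\<lambda>p' q'. K p q p' q'))"
proof -
  have "(\<Sum>(x, y)\<leftarrow>csw2 L (\<phi> m). \<Sum>(x', y')\<leftarrow>csw2 L (\<phi> n). H x y x' y')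
    = tfold (model_cop m) (\<lambda>p q. \<Sum>(x', y')\<leftarrow>csw2 L (\<phi> n). K p q (\<rho> x') (\<rho> y'))"
  proof (rule csw2_eval)
    show "balanced (\<lambda>p q. \<Sum>(x', y')\<leftarrow>csw2 L (\<phi> n). K p q (\<rho> x') (\<rho> y'))"
      unfolding split_def balanced_def using lin(1) bal by
          (auto intro!: linear_intros simp: cbilinear_def)
    show "(\<Sum>(x', y')\<leftarrow>csw2 L (\<phi> n). H (\<phi> p) (\<phi> q) x' y')
        = (\<Sum>(x', y')\<leftarrow>csw2 L (\<phi> n). K p q (\<rho> x') (\<rho> y'))" for p q
      by (rule csw2_push[OF clinear_ident]) (simp add: H)
  qed
  also have "\<dots> = (\<Sum>(x', y')\<leftarrow>csw2 L (\<phi> n). tfold (model_cop m) (\<lambda>p q. K p q (\<rho> x') (\<rho> y')))"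
    unfolding split_def by (rule tfold_sum_list)
  also have "\<dots> = tfold (model_cop n) (\<lambda>p' q'. tfold (model_cop m) (\<lambda>p q. K p q p' q'))"
  proof (rule csw2_eval)
    have "tfold (model_cop m) (\<lambda>p q. K p q (tgt_mult \<beta> p') q')
        = tfold (model_cop m) (\<lambda>p q. K p q p' (src_mult \<beta> q'))" for \<beta> p' q'
      by (rule tensor3_ext[of "\<lambda>m. tfold (model_cop m) (\<lambda>p q. K p q (tgt_mult \<beta> p') q')" "\<lambda>m. tfold
          (model_cop m) (\<lambda>p q. K p q p' (src_mult \<beta> q'))"])
       (use lin(1) bal' in simp_all)
    moreover have "cbilinear (\<lambda>p' q'. tfold (model_cop m) (\<lambda>p q. K p q p' q'))"
      using lin(2) by (auto intro!: linear_intros simp: cbilinear_def)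
    ultimately show "balanced (\<lambda>p' q'. tfold (model_cop m) (\<lambda>p q. K p q p' q'))"
      by (simp add: balanced_def)
  qed simp
  also have "\<dots> = tfold (model_cop m) (\<lambda>p q. tfold (model_cop n) (\<lambda>p' q'. K p q p' q'))"
    by (rule tfold_swap)
  finally show ?thesis .
qed

lemma csw3_eq:
  "(\<Sum>(x, y, z)\<leftarrow>csw3 L a. H x y z) = (\<Sum>(x, w)\<leftarrow>csw2 L a. \<Sum>(y, z)\<leftarrow>csw2 L w. H x y z
      :: 'v::complex_vector)"
  by (simp add: csw3_def split_def sum_list_concat_map comp_def)

lemma csw3_cong:
  fixes H :: "'l \<Rightarrow> 'l \<Rightarrow> 'l \<Rightarrow> 'v::complex_vector"
  assumes H: "\<And>p q s. H (\<phi> p) (\<phi> q) (\<phi> s) = G p q s"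
  shows "(\<Sum>(x, y, z)\<leftarrow>csw3 L (\<phi> m). H x y z) = (\<Sum>(x, y, z)\<leftarrow>csw3 L (\<phi> m). G (\<rho> x) (\<rho> y) (\<rho> z))"
proof -
  let ?G = "\<lambda>p r. \<Sum>(y, z)\<leftarrow>csw2 L (\<phi> r). G p (\<rho> y) (\<rho> z)"
  have "(\<Sum>(x, y, z)\<leftarrow>csw3 L (\<phi> m). H x y z) = (\<Sum>(x, w)\<leftarrow>csw2 L (\<phi> m). ?G (\<rho> x) (\<rho> w))"
    unfolding csw3_eq by (rule csw2_push[OF clinear_ident], rule csw2_push[OF clinear_ident])
        (rule H)
  moreover have "(\<Sum>(x, y, z)\<leftarrow>csw3 L (\<phi> m). G (\<rho> x) (\<rho> y) (\<rho> z))
      = (\<Sum>(x, w)\<leftarrow>csw2 L (\<phi> m). ?G (\<rho> x) (\<rho> w))"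
    unfolding csw3_eq by (rule csw2_push[OF clinear_ident]) simp
  ultimately show ?thesis by simp
qed

lemma csw3_eval:
  assumes H: "\<And>p q s. H (\<phi> p) (\<phi> q) (\<phi> s) = G p q s"
    and lin: "\<And>s. cbilinear (\<lambda>p q. G p q s)" "\<And>p. cbilinear (\<lambda>q s. G p q s)"
    and bal: "\<And>p q s \<beta>. G (tgt_mult \<beta> p) q s = G p (src_mult \<beta> q) s" "\<And>p q s \<beta>. G p (tgt_mult \<beta> q)
        s = G p q (src_mult \<beta> s)"
  shows "(\<Sum>(x, y, z)\<leftarrow>csw3 L (\<phi> m). H x y z) = tfold (model_cop m)
      (\<lambda>p r. tfold (model_cop r) (\<lambda>q s. G p q s))"
proof -
  have "(\<Sum>(x, y, z)\<leftarrow>csw3 L (\<phi> m). H x y z)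
      = (\<Sum>(x, w)\<leftarrow>csw2 L (\<phi> m). \<Sum>(y, z)\<leftarrow>csw2 L w. H x y z)"
    by (rule csw3_eq)
  also have "\<dots> = tfold (model_cop m) (\<lambda>p r. tfold (model_cop r) (\<lambda>q s. G p q s))"
  proof (rule csw2_eval)
    show "balanced (\<lambda>p r. tfold (model_cop r) (\<lambda>q s. G p q s))"
      unfolding balanced_def
    proof (intro conjI allI)
      show "cbilinear (\<lambda>p r. tfold (model_cop r) (\<lambda>q s. G p q s))"
        using lin by (intro linear_intros) (auto simp: cbilinear_def)
      show "tfold (model_cop r) (\<lambda>q s. G (tgt_mult \<beta> p) q s)
          = tfold (model_cop (src_mult \<beta> r)) (\<lambda>q s. G p q s)" for \<beta> p r
        using lin(2) by (simp add: model_cop_shift bal)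
    qed
    show "(\<Sum>(y, z)\<leftarrow>csw2 L (\<phi> r). H (\<phi> p) y z) = tfold (model_cop r) (\<lambda>q s. G p q s)" for p r
      by (rule csw2_eval) (use lin(2) in \<open>simp_all add: H balanced_def bal\<close>)
  qed
  finally show ?thesis .
qed

end

text \<open>Two cocycles occur side by side: constants prefixed with \<open>triv\<close> belong to
  the trivial one, which models \<open>L\<close>; those of \<open>central_cocycle\<close> without
  prefix belong to \<open>\<sigma>\<close>.\<close>

locale cocycle_twist = central_cocycle \<Delta> \<epsilon> S \<sigma> \<sigma>i +
    triv: modelled \<Delta> \<epsilon> S "hopf_algebra.triv \<epsilon>" "hopf_algebra.triv \<epsilon>" L \<phi> \<rho>
  for \<Delta> :: "'h::complex_algebra \<Rightarrow> 'h \<otimes> 'h" and \<epsilon> :: "'h \<Rightarrow> complex" and S :: "'h \<Rightarrow> 'h"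
    and \<sigma> \<sigma>i :: "'h \<Rightarrow> 'h \<Rightarrow> 'b::complex_algebra"
    and L :: "('l::complex_vector, 'b) bialgebroid" and \<phi> :: "'b \<otimes> 'b \<otimes> 'h \<Rightarrow> 'l"
    and \<rho> :: "'l \<Rightarrow> 'b \<otimes> 'b \<otimes> 'h"
begin

lemma triv_sigma_mult:
  "triv.sigma_mult h k b = \<epsilon> h *\<^sub>C \<epsilon> k *\<^sub>C b"
  "triv.sigma_inv_mult h k b = \<epsilon> h *\<^sub>C \<epsilon> k *\<^sub>C b"
  by (simp_all add: triv.sigma_mult_def triv.sigma_inv_mult_def triv_def scaleC_out counit_simps)

lemma triv_model_mult: "triv.model_mult (b \<otimes> b' \<otimes> h) (c \<otimes> c' \<otimes> g) = (b * c) \<otimes> (c' * b') \<otimes> (h * g)"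
  by (simp add: triv.model_mult_tensor triv_sigma_mult scaleC_out tfold_scale counits)

lemma pairing_balanced:
  assumes "cbilinear F"
  shows "pairing F (triv.model_mult m (b \<otimes> b' \<otimes> 1)) n
      = pairing F m (triv.model_mult (b \<otimes> b' \<otimes> 1) n)"
  by (rule tensor3_ext2[of "\<lambda>m n. pairing F (triv.model_mult m (b \<otimes> b' \<otimes> 1)) n" "\<lambda>m n. pairing F m
      (triv.model_mult (b \<otimes> b' \<otimes> 1) n)"])
    (simp_all add: assms pairing_tensor triv_model_mult mult.assoc)

lemma pairing_bihom:
  assumes F: "cbilinear F" and f: "\<And>m n. f (\<phi> m) (\<phi> n) = pairing F m n"
  shows "bihom L f"
proof -
  have add: "pairing F (m + m') n = pairing F m n + pairing F m' n" "pairing F m (n + n')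
      = pairing F m n + pairing F m n'" for m m' n n'
    by (rule clinear_add, simp add: F)+
  have "pairing F (triv.model_mult m (tfold p (\<lambda>b b'. b \<otimes> b' \<otimes> 1))) n
      = pairing F m (triv.model_mult (tfold p (\<lambda>b b'. b \<otimes> b' \<otimes> 1)) n)" for m n p
    by (rule tensor_ext[of "\<lambda>p. pairing F (triv.model_mult m (tfold p (\<lambda>b b'. b \<otimes> b' \<otimes> 1))) n" "\<lambda>p.
        pairing F m (triv.model_mult (tfold p (\<lambda>b b'. b \<otimes> b' \<otimes> 1)) n)"])
      (simp_all add: F pairing_balanced)
  then show ?thesis
    by (auto simp: bihom_def triv.lcar_eq triv.phi_add f add triv.leta_eq triv.lmul_eq
        triv.lmul_src triv.lmul_tgt pairing_bimodule[OF F] mult.assoc)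
qed

text \<open>
  The converse of \<open>pairing_bihom\<close>; it gives uniqueness of convolution inverses, hence access
  to \<open>conv_inv\<close>.
\<close>

lemma bihom_pairing:
  assumes f: "bihom L f"
  obtains F where "cbilinear F" "\<And>m n. f (\<phi> m) (\<phi> n) = pairing F m n"
proof -
  have add: "f (\<phi> (m + m')) (\<phi> n) = f (\<phi> m) (\<phi> n) + f (\<phi> m') (\<phi> n)" "f (\<phi> m) (\<phi> (n + n'))
      = f (\<phi> m) (\<phi> n) + f (\<phi> m) (\<phi> n')" for m m' n n'
    using f by (auto simp: bihom_def triv.lcar_eq triv.phi_add[symmetric])
  have bim: "f (\<phi> (src_mult b (tgt_mult b' m))) (\<phi> n) = b * f (\<phi> m) (\<phi> n) * b'" for b b' m n
    using f by (auto simp: bihom_def triv.lcar_eq triv.lmul_src[symmetric] triv.lmul_tgt[symmetric])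
  have bal: "f (\<phi> (triv.model_mult m (b \<otimes> b' \<otimes> 1))) (\<phi> n)
      = f (\<phi> m) (\<phi> (triv.model_mult (b \<otimes> b' \<otimes> 1) n))" for b b' m n
    using f triv.leta_eq[of "b \<otimes> b'"] unfolding bihom_def triv.lcar_eq
    by (simp add: triv.lmul_eq[symmetric]) metis
  \<comment> \<open>\<open>bihom\<close> only provides additivity. Homogeneity in the first argument
    follows from bilinearity over the base, since a scalar acts through the source.\<close>
  have scale: "c *\<^sub>C m = src_mult (c *\<^sub>C 1) (tgt_mult 1 m)" for c and m :: "'b \<otimes> 'b \<otimes> 'h"
    by (rule tensor3_ext[of "\<lambda>m. c *\<^sub>C m" "\<lambda>m. src_mult (c *\<^sub>C 1) (tgt_mult 1 m)"])
        (simp_all add: scaleC_out)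
  have s1: "f (\<phi> (c *\<^sub>C m)) (\<phi> n) = c *\<^sub>C f (\<phi> m) (\<phi> n)" for c m n
    unfolding scale bim by (simp add: scaleC_out)
  \<comment> \<open>For the second argument the scalar is carried over to the first one by the
    balancing condition.\<close>
  have "triv.model_mult m ((c *\<^sub>C 1) \<otimes> 1 \<otimes> 1) = c *\<^sub>C m" "triv.model_mult ((c *\<^sub>C 1) \<otimes> 1 \<otimes> 1) m
      = c *\<^sub>C m" for c m
    by (simp_all add: scaleC_out triv.model_mult_scale triv.model_mult_linear triv.model_mult_one)
  then have s2: "f (\<phi> m) (\<phi> (c *\<^sub>C n)) = c *\<^sub>C f (\<phi> m) (\<phi> n)" for c m n
    using bal[of m "c *\<^sub>C 1" 1 n] by (simp add: s1)
  have bil: "cbilinear (\<lambda>m n. f (\<phi> m) (\<phi> n))"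
    by (intro cbilinearI clinearI) (simp_all add: add s1 s2)
  let ?F = "\<lambda>h k. f (\<phi> (1 \<otimes> 1 \<otimes> h)) (\<phi> (1 \<otimes> 1 \<otimes> k))"
  have F: "cbilinear ?F"
    by (intro cbilinearI clinear_bilinear_left[OF bil] clinear_bilinear_right[OF bil] linear_intros)
  have "f (\<phi> (b \<otimes> b' \<otimes> h)) (\<phi> (c \<otimes> c' \<otimes> k)) = pairing ?F (b \<otimes> b' \<otimes> h) (c \<otimes> c' \<otimes> k)" for b b' h c c'
      k
  proof -
    have "f (\<phi> (b \<otimes> b' \<otimes> h)) (\<phi> (c \<otimes> c' \<otimes> k)) = b * f (\<phi> (1 \<otimes> 1 \<otimes> h)) (\<phi> (c \<otimes> c' \<otimes> k)) * b'"
      using bim[of b b' "1 \<otimes> 1 \<otimes> h" "c \<otimes> c' \<otimes> k"] by simp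
    also have "f (\<phi> (1 \<otimes> 1 \<otimes> h)) (\<phi> (c \<otimes> c' \<otimes> k)) = f (\<phi> (c \<otimes> c' \<otimes> h)) (\<phi> (1 \<otimes> 1 \<otimes> k))"
      using bal[of "1 \<otimes> 1 \<otimes> h" c c' "1 \<otimes> 1 \<otimes> k"] by (simp add: triv_model_mult)
    also have "\<dots> = c * ?F h k * c'"
      using bim[of c c' "1 \<otimes> 1 \<otimes> h" "1 \<otimes> 1 \<otimes> k"] by simp
    finally show ?thesis by (simp add: pairing_tensor[OF F] mult.assoc)
  qed
  then have "f (\<phi> m) (\<phi> n) = pairing ?F m n" for m n
    by (rule tensor3_ext2[OF bil, rotated]) (intro cbilinearI clinear_pairing F linear_intros)
  with F show thesis by (rule that)
qed

section \<open>Convolution inverses\<close>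

definition hopf_conv :: "('h \<Rightarrow> 'h \<Rightarrow> 'b) \<Rightarrow> ('h \<Rightarrow> 'h \<Rightarrow> 'b) \<Rightarrow> 'h \<Rightarrow> 'h \<Rightarrow> 'b" where
  "hopf_conv F G h k = sw h (\<lambda>x y. sw k (\<lambda>u v. F x u * G y v))"

text \<open>The inner entries of \<open>model_cop\<close> are 1, so nothing separates
  \<open>F x u\<close> from \<open>G y v\<close>. Convolution over the bialgebroid is thereby
  reduced to convolution of bilinear maps on the Hopf algebra, with unit \<open>triv\<close> by
  \<open>lcou_pairing\<close>.\<close>

lemma conv_pairing:
  assumes F: "cbilinear F" and G: "cbilinear G" and f: "\<And>m n. f (\<phi> m) (\<phi> n) = pairing F m n"
    and g: "\<And>m n. g (\<phi> m) (\<phi> n) = pairing G m n"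
  shows "conv L f g (\<phi> m) (\<phi> n) = pairing (hopf_conv F G) m n"
proof -
  note [simp] = F G clinear_bilinear_left[OF F] clinear_bilinear_right[OF F]
      clinear_bilinear_left[OF G] clinear_bilinear_right[OF G]
  have hopf_conv: "cbilinear (hopf_conv F G)" by (simp add: hopf_conv_def[abs_def])
  have "conv L f g (\<phi> m) (\<phi> n) = tfold (model_cop m)
      (\<lambda>p q. tfold (model_cop n) (\<lambda>p' q'. pairing F p p' * pairing G q q'))"
    unfolding conv_def
  proof (rule triv.csw2_double_eval)
    have "pairing F (b \<otimes> 1 \<otimes> x) (tgt_mult \<beta> n) * pairing G (1 \<otimes> b' \<otimes> y) n'
        = pairing F (b \<otimes> 1 \<otimes> x) n * pairing G (1 \<otimes> b' \<otimes> y) (src_mult \<beta> n')" for b b' x y \<beta> n n'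
      by (rule tensor3_ext2[of "\<lambda>n n'. pairing F (b \<otimes> 1 \<otimes> x) (tgt_mult \<beta> n) * pairing G
          (1 \<otimes> b' \<otimes> y) n'" "\<lambda>n n'. pairing F (b \<otimes> 1 \<otimes> x) n * pairing G (1 \<otimes> b' \<otimes> y)
          (src_mult \<beta> n')"])
        (simp_all add: pairing_tensor mult.assoc)
    then show "tfold (model_cop (b \<otimes> b' \<otimes> h)) (\<lambda>p q. pairing F p (tgt_mult \<beta> p') * pairing G q q')
        = tfold (model_cop (b \<otimes> b' \<otimes> h)) (\<lambda>p q. pairing F p p' * pairing G q (src_mult \<beta> q'))" for
        b b' h \<beta> p' q'
      by (simp add: model_cop_tensor tfold_tfold)
  qed (simp_all add: f g pairing_bimodule mult.assoc)
  also have "\<dots> = pairing (hopf_conv F G) m n"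
    by (rule tensor3_ext2[of "\<lambda>m n. tfold (model_cop m) (\<lambda>p q. tfold (model_cop n)
        (\<lambda>p' q'. pairing F p p' * pairing G q q'))" "pairing (hopf_conv F G)"])
     (simp_all add: model_cop_tensor tfold_tfold pairing_tensor hopf_conv
         pairing_tensor[OF hopf_conv] hopf_conv_def tfold_mult_left tfold_mult_right mult.assoc)
  finally show ?thesis .
qed

lemma triv_bilinear: "cbilinear (triv :: 'h \<Rightarrow> 'h \<Rightarrow> 'b)"
  by (simp add: triv_def[abs_def] counit_simps)

lemma lcou_pairing: "lcou L (lmul L (\<phi> m) (\<phi> n)) = pairing triv m n"
  unfolding triv.lmul_eq triv.lcou_eq
  by (rule tensor3_ext2[of "\<lambda>m n. model_cou (triv.model_mult m n)" "pairing triv"])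
    (simp_all add: triv_model_mult model_cou_tensor pairing_tensor[OF triv_bilinear] triv_bilinear
        triv_def counit_simps scaleC_out mult.assoc)

lemma hopf_conv_sigma:
  "hopf_conv \<sigma> \<sigma>i = triv"
  "hopf_conv \<sigma>i \<sigma> = triv"
  by (simp_all add: fun_eq_iff hopf_conv_def triv_def sigma_inverse_left sigma_inverse_right)

definition \<sigma>' where "\<sigma>' x y = pairing \<sigma> (\<rho> x) (\<rho> y)"

definition \<sigma>i' where "\<sigma>i' x y = pairing \<sigma>i (\<rho> x) (\<rho> y)"

lemma sigma'_phi:
  "\<sigma>' (\<phi> m) (\<phi> n) = pairing \<sigma> m n"
  "\<sigma>i' (\<phi> m) (\<phi> n) = pairing \<sigma>i m n"
  by (simp_all add: \<sigma>'_def \<sigma>i'_def)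

lemma conv_inverse_sigma': "conv_inverse L \<sigma>' \<sigma>i'"
  unfolding conv_inverse_def triv.lcar_eq
  by (auto simp: conv_pairing[OF sigma_bilin sigma_inv_bilin sigma'_phi]
      conv_pairing[OF sigma_inv_bilin sigma_bilin sigma'_phi(2,1)]
     hopf_conv_sigma lcou_pairing pairing_bihom[OF sigma_inv_bilin sigma'_phi(2)])

lemma hopf_conv_assoc:
  assumes F: "cbilinear F" and G: "cbilinear G" and K: "cbilinear K"
  shows "hopf_conv (hopf_conv F G) K h k = hopf_conv F (hopf_conv G K) h k"
proof -
  note [simp] = clinear_bilinear_left[OF F] clinear_bilinear_right[OF F]
      clinear_bilinear_left[OF G] clinear_bilinear_right[OF G] clinear_bilinear_left[OF K]
      clinear_bilinear_right[OF K]
  show ?thesis by (simp add: hopf_conv_def tag_start[of h _ 0] tag_start[of k _ 1] sweedler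
      mult.assoc)
qed

lemma hopf_conv_triv:
  assumes F: "cbilinear F"
  shows "hopf_conv triv F h k = F h k"
  "hopf_conv F triv h k = F h k"
proof -
  note [simp] = clinear_bilinear_left[OF F] clinear_bilinear_right[OF F]
  show "hopf_conv triv F h k = F h k" "hopf_conv F triv h k = F h k"
    by (simp_all add: hopf_conv_def triv_def scaleC_out counit_simps tfold_scale counits)
qed

text \<open>The inverse picked by \<open>conv_inv\<close> is unknown but has the form
  \<open>pairing G\<close>. Evaluation at \<open>1 \<otimes> 1 \<otimes> h\<close> shows that
  \<open>G\<close> is a right convolution inverse of \<open>\<sigma>\<close>, so it equals the left
  inverse \<open>\<sigma>i\<close>.\<close>

lemma conv_inv_sigma': "conv_inv L \<sigma>' (\<phi> m) (\<phi> n) = pairing \<sigma>i m n"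
proof -
  have inv: "conv_inverse L \<sigma>' (conv_inv L \<sigma>')"
    unfolding conv_inv_def by (rule someI[where P = "conv_inverse L \<sigma>'"]) (rule conv_inverse_sigma')
  then obtain G where G: "cbilinear G" and g: "\<And>m n. conv_inv L \<sigma>' (\<phi> m) (\<phi> n) = pairing G m n"
    using bihom_pairing[of "conv_inv L \<sigma>'"] by (auto simp: conv_inverse_def)
  note [simp] = clinear_bilinear_left[OF G] clinear_bilinear_right[OF G]
  have bil: "cbilinear (hopf_conv \<sigma> G)" by (simp add: hopf_conv_def[abs_def])
  have "pairing (hopf_conv \<sigma> G) m n = pairing triv m n" for m n
    using inv conv_pairing[OF sigma_bilin G sigma'_phi(1) g, of m n]
    by (simp add: conv_inverse_def triv.lcar_eq lcou_pairing)
  from this[of "1 \<otimes> 1 \<otimes> _" "1 \<otimes> 1 \<otimes> _"] have "hopf_conv \<sigma> G h k = triv h k" for h k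
    by (simp add: pairing_tensor bil triv_bilinear)
  then have eq: "hopf_conv \<sigma> G = triv" by (simp add: fun_eq_iff)
  have "G h k = \<sigma>i h k" for h k
    using hopf_conv_assoc[OF sigma_inv_bilin sigma_bilin G, of h k]
    by (simp only: hopf_conv_sigma eq hopf_conv_triv[OF G] hopf_conv_triv[OF sigma_inv_bilin])
  then have "G = \<sigma>i" by (simp add: fun_eq_iff)
  then show ?thesis by (simp add: g)
qed

text \<open>The one-sided twisted product that occurs on both sides of the cocycle condition,
  transported to the model.\<close>

definition cocycle_mult where
  "cocycle_mult m n = tfold (model_cop m) (\<lambda>p q. tfold (model_cop n)
      (\<lambda>p' q'. src_mult (pairing \<sigma> p p') (triv.model_mult q q')))"

lemmas [simp] = sigma_bilin sigma_inv_bilin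

lemma clinear_cocycle_mult [linear_intros, simp]:
  "clinear f \<Longrightarrow> clinear (\<lambda>x. cocycle_mult (f x) m)" "clinear f \<Longrightarrow> clinear (\<lambda>x. cocycle_mult m (f x))"
  by (simp_all add: cocycle_mult_def)

lemma triv_model_mult_shift:
  "triv.model_mult (1 \<otimes> b' \<otimes> h) (src_mult \<beta> n) = src_mult \<beta> (triv.model_mult (1 \<otimes> b' \<otimes> h) n)"
  "triv.model_mult (b \<otimes> 1 \<otimes> h) (tgt_mult \<beta> n) = tgt_mult \<beta> (triv.model_mult (b \<otimes> 1 \<otimes> h) n)"
  "pairing \<sigma> (b \<otimes> 1 \<otimes> h) (tgt_mult \<beta> n) = pairing \<sigma> (b \<otimes> 1 \<otimes> h) n * \<beta>"
  "pairing \<sigma>i (1 \<otimes> b' \<otimes> h) (src_mult \<beta> n) = \<beta> * pairing \<sigma>i (1 \<otimes> b' \<otimes> h) n"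
proof -
  show "triv.model_mult (1 \<otimes> b' \<otimes> h) (src_mult \<beta> n) = src_mult \<beta> (triv.model_mult (1 \<otimes> b' \<otimes> h) n)"
    by (rule tensor3_ext[of "\<lambda>n. triv.model_mult (1 \<otimes> b' \<otimes> h) (src_mult \<beta> n)"])
        (simp_all add: triv_model_mult)
  show "triv.model_mult (b \<otimes> 1 \<otimes> h) (tgt_mult \<beta> n) = tgt_mult \<beta> (triv.model_mult (b \<otimes> 1 \<otimes> h) n)"
    by (rule tensor3_ext[of "\<lambda>n. triv.model_mult (b \<otimes> 1 \<otimes> h) (tgt_mult \<beta> n)"])
        (simp_all add: triv_model_mult)
  show "pairing \<sigma> (b \<otimes> 1 \<otimes> h) (tgt_mult \<beta> n) = pairing \<sigma> (b \<otimes> 1 \<otimes> h) n * \<beta>"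
    by (rule tensor3_ext[of "\<lambda>n. pairing \<sigma> (b \<otimes> 1 \<otimes> h) (tgt_mult \<beta> n)"])
        (simp_all add: pairing_tensor mult.assoc)
  show "pairing \<sigma>i (1 \<otimes> b' \<otimes> h) (src_mult \<beta> n) = \<beta> * pairing \<sigma>i (1 \<otimes> b' \<otimes> h) n"
    by (rule tensor3_ext[of "\<lambda>n. pairing \<sigma>i (1 \<otimes> b' \<otimes> h) (src_mult \<beta> n)"])
        (simp_all add: pairing_tensor mult.assoc)
qed

lemma csw2_cocycle_mult:
  "(\<Sum>(x, y)\<leftarrow>csw2 L (\<phi> m). \<Sum>(x', y')\<leftarrow>csw2 L (\<phi> n). lmul L (src L (\<sigma>' x x')) (lmul L y y'))
      = \<phi> (cocycle_mult m n)"
proof -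
  have "(\<Sum>(x, y)\<leftarrow>csw2 L (\<phi> m). \<Sum>(x', y')\<leftarrow>csw2 L (\<phi> n). lmul L (src L (\<sigma>' x x')) (lmul L y y'))
    = tfold (model_cop m) (\<lambda>p q. tfold (model_cop n)
        (\<lambda>p' q'. \<phi> (src_mult (pairing \<sigma> p p') (triv.model_mult q q'))))"
    by (rule triv.csw2_double_eval)
      (simp_all add: sigma'_phi triv.lmul_eq triv.lmul_src pairing_bimodule
          triv.src_mult_model_mult src_mult_src_mult model_cop_tensor tfold_tfold
          triv_model_mult_shift)
  then show ?thesis by (simp add: cocycle_mult_def tfold_push[of \<phi>] triv.clinear_phi)
qed

lemma pairing_sigma_mult: "pairing \<sigma> (b \<otimes> b' \<otimes> h) (c \<otimes> c' \<otimes> k) = sigma_mult h k (b * c * c' * b')"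
  "pairing \<sigma>i (b \<otimes> b' \<otimes> h) (c \<otimes> c' \<otimes> k) = sigma_inv_mult h k (b * c * c' * b')"
proof -
  have "sigma_mult h k 1 = \<sigma> h k" "sigma_inv_mult h k 1
      = \<sigma>i h k" by (simp_all add: sigma_mult_def sigma_inv_mult_def)
  then show "pairing \<sigma> (b \<otimes> b' \<otimes> h) (c \<otimes> c' \<otimes> k) = sigma_mult h k (b * c * c' * b')"
    "pairing \<sigma>i (b \<otimes> b' \<otimes> h) (c \<otimes> c' \<otimes> k) = sigma_inv_mult h k (b * c * c' * b')"
    using sigma_mult_right[of "b * c" h k 1] by (simp_all add: pairing_tensor sigma_mult_left)
qed

lemma cocycle_mult_tensor:
  "cocycle_mult (b \<otimes> b' \<otimes> h) (c \<otimes> c' \<otimes> k) = sw h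
      (\<lambda>x y. sw k (\<lambda>u v. sigma_mult x u (b * c) \<otimes> (c' * b') \<otimes> (y * v)))"
  by (simp add: cocycle_mult_def model_cop_tensor tfold_tfold pairing_sigma_mult triv_model_mult
      sigma_mult_left)

text \<open>The base entries nest to the same word \<open>b * c * d * d' * c' * b'\<close> on both
  sides, and central values can be pulled out of it; what remains is the cocycle identity for
  \<open>\<sigma>\<close>.\<close>

lemma pairing_cocycle: "pairing \<sigma> m (cocycle_mult n q) = pairing \<sigma> (cocycle_mult m n) q"
proof -
  have "pairing \<sigma> (b \<otimes> b' \<otimes> h) (cocycle_mult (c \<otimes> c' \<otimes> k) (d \<otimes> d' \<otimes> l))
      = pairing \<sigma> (cocycle_mult (b \<otimes> b' \<otimes> h) (c \<otimes> c' \<otimes> k)) (d \<otimes> d' \<otimes> l)" for b b' h c c' k d d' l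
  proof -
    have "pairing \<sigma> (b \<otimes> b' \<otimes> h) (cocycle_mult (c \<otimes> c' \<otimes> k) (d \<otimes> d' \<otimes> l))
        = sw k (\<lambda>x y. sw l (\<lambda>u v. sigma_mult x u
        (sigma_mult h (y * v) (b * c * d * d' * c' * b'))))"
      by (simp add: cocycle_mult_tensor tfold_push[of "pairing \<sigma> (b \<otimes> b' \<otimes> h)"]
          clinear_pairing(2)[OF sigma_bilin clinear_ident] pairing_sigma_mult sigma_mult_left
          sigma_mult_right sigma_mult_commute mult.assoc)
    also have "\<dots> = sw h (\<lambda>x y. sw k (\<lambda>u v. sigma_mult x u
        (sigma_mult (y * v) l (b * c * d * d' * c' * b'))))"
      by (rule sigma_mult_cocycle)
    also have "\<dots> = pairing \<sigma> (cocycle_mult (b \<otimes> b' \<otimes> h) (c \<otimes> c' \<otimes> k)) (d \<otimes> d' \<otimes> l)"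
      by (simp add: cocycle_mult_tensor tfold_push[of "\<lambda>m. pairing \<sigma> m (d \<otimes> d' \<otimes> l)"]
          pairing_sigma_mult sigma_mult_left sigma_mult_right sigma_mult_commute mult.assoc)
    finally show ?thesis .
  qed
  then have "pairing \<sigma> (b \<otimes> b' \<otimes> h) (cocycle_mult n q)
      = pairing \<sigma> (cocycle_mult (b \<otimes> b' \<otimes> h) n) q" for b b' h
    by - (rule tensor3_ext2[of "\<lambda>n q. pairing \<sigma> (b \<otimes> b' \<otimes> h) (cocycle_mult n q)" "\<lambda>n q. pairing \<sigma>
        (cocycle_mult (b \<otimes> b' \<otimes> h) n) q"], simp_all)
  then show ?thesis
    by - (rule tensor3_ext[of "\<lambda>m. pairing \<sigma> m (cocycle_mult n q)" "\<lambda>m. pairing \<sigma>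
        (cocycle_mult m n) q"], simp_all)
qed

lemma is_cocycle: "invertible_normalised_cocycle L \<sigma>'"
proof (intro invertible_normalised_cocycle.intro invertible_normalised_cocycle_axioms.intro
    triv.is_left_bialgebroid)
  show "bihom L \<sigma>'" by (rule pairing_bihom[OF sigma_bilin sigma'_phi(1)])
  show "\<exists>g. conv_inverse L \<sigma>' g" using conv_inverse_sigma' by blast
  show "\<sigma>' a (\<Sum>(x, y)\<leftarrow>csw2 L a'. \<Sum>(x', y')\<leftarrow>csw2 L a''. lmul L (src L (\<sigma>' x x')) (lmul L y y'))
      = \<sigma>' (\<Sum>(x, y)\<leftarrow>csw2 L a. \<Sum>(x', y')\<leftarrow>csw2 L a'. lmul L (src L (\<sigma>' x x')) (lmul L y y')) a''"
    if "a \<in> lcar L" "a' \<in> lcar L" "a'' \<in> lcar L" for a a' a''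
    using that by (auto simp: triv.lcar_eq csw2_cocycle_mult sigma'_phi pairing_cocycle)
  have "pairing \<sigma> (1 \<otimes> 1 \<otimes> 1) m = model_cou m" "pairing \<sigma> m (1 \<otimes> 1 \<otimes> 1) = model_cou m" for m
    by (rule tensor3_ext[of "\<lambda>m. pairing \<sigma> (1 \<otimes> 1 \<otimes> 1) m"]
        tensor3_ext[of "\<lambda>m. pairing \<sigma> m (1 \<otimes> 1 \<otimes> 1)"]; simp add: pairing_sigma_mult
        model_cou_tensor sigma_mult_one)+
  then show "a \<in> lcar L \<Longrightarrow> \<sigma>' (lone L) a = lcou L a" "a \<in> lcar L \<Longrightarrow> \<sigma>' a (lone L) = lcou L a" for a
    by (auto simp: triv.lcar_eq triv.lone_eq sigma'_phi triv.lcou_eq)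
qed

text \<open>\<open>\<sigma>\<close> acts on the first legs, the untwisted product on the middle legs
  and \<open>\<sigma>i\<close> on the last legs, which is the formula of \<open>model_mult\<close>.
  The effort goes into removing the chosen representatives of both threefold coproducts.\<close>

lemma lmul_twist: "lmul (twist L \<sigma>') (\<phi> m) (\<phi> n) = \<phi> (model_mult m n)"
proof -
  define K where "K p q s p' q' s' = \<phi> (src_mult (pairing \<sigma> p p')
      (tgt_mult (pairing \<sigma>i s s') (triv.model_mult q q')))" for p q s p' q' s'
  have lin [simp]:
    "clinear f \<Longrightarrow> clinear (\<lambda>x. K (f x) q s p' q' s')"
    "clinear f \<Longrightarrow> clinear (\<lambda>x. K p (f x) s p' q' s')"
    "clinear f \<Longrightarrow> clinear (\<lambda>x. K p q (f x) p' q' s')"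
    "clinear f \<Longrightarrow> clinear (\<lambda>x. K p q s (f x) q' s')"
    "clinear f \<Longrightarrow> clinear (\<lambda>x. K p q s p' (f x) s')"
    "clinear f \<Longrightarrow> clinear (\<lambda>x. K p q s p' q' (f x))" for f
        :: "'b \<otimes> 'b \<otimes> 'h \<Rightarrow> 'b \<otimes> 'b \<otimes> 'h" and p q s p' q' s'
    by (simp_all add: K_def)
  have K1: "K (tgt_mult \<beta> p) q s p' q' s' = K p (src_mult \<beta> q) s p' q' s'" "K p (tgt_mult \<beta> q) s p'
      q' s' = K p q (src_mult \<beta> s) p' q' s'"
    for \<beta> p q s p' q' s'
    by (simp_all add: K_def pairing_bimodule triv.src_mult_model_mult triv.tgt_mult_model_mult
        tgt_mult_src_mult tgt_mult_tgt_mult src_mult_src_mult)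
  \<comment> \<open>In the legs of the second argument \<open>K\<close> is balanced only after
    summation over the legs of the first, as in the Takeuchi condition; \<open>K3\<close> is the
    same for the other tensor sign.\<close>
  have K2: "tfold (model_cop m) (\<lambda>p r. tfold (model_cop r) (\<lambda>q s. K p q s (tgt_mult \<beta> p') q' s'))
      = tfold (model_cop m) (\<lambda>p r. tfold (model_cop r) (\<lambda>q s. K p q s p' (src_mult \<beta> q') s'))" for
      m \<beta> p' q' s'
    by (rule tensor3_ext[of "\<lambda>m. tfold (model_cop m)
        (\<lambda>p r. tfold (model_cop r) (\<lambda>q s. K p q s (tgt_mult \<beta> p') q' s'))"], simp, simp)
      (simp add: model_cop_tensor tfold_tfold K_def triv_model_mult_shift tgt_mult_src_mult
          src_mult_src_mult)
  have K3: "tfold (model_cop m) (\<lambda>p r. tfold (model_cop r) (\<lambda>q s. K p q s p' (tgt_mult \<beta> q') s'))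
      = tfold (model_cop m) (\<lambda>p r. tfold (model_cop r) (\<lambda>q s. K p q s p' q' (src_mult \<beta> s')))" for
      m \<beta> p' q' s'
    by (rule tensor3_ext[of "\<lambda>m. tfold (model_cop m)
        (\<lambda>p r. tfold (model_cop r) (\<lambda>q s. K p q s p' (tgt_mult \<beta> q') s'))"], simp, simp)
      (simp add: model_cop_tensor tfold_tfold K_def triv_model_mult_shift tgt_mult_src_mult
          tgt_mult_tgt_mult)
  have K: "lmul L (src L (\<sigma>' (\<phi> p) (\<phi> p'))) (lmul L (tgt L (conv_inv L \<sigma>' (\<phi> s) (\<phi> s')))
      (lmul L (\<phi> q) (\<phi> q'))) = K p q s p' q' s'"
    for p q s p' q' s'
    by (simp add: K_def sigma'_phi conv_inv_sigma' triv.lmul_eq triv.lmul_src triv.lmul_tgt)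
  let ?X = "\<lambda>p q s. \<Sum>(x, y, z)\<leftarrow>csw3 L (\<phi> n). K p q s (\<rho> x) (\<rho> y) (\<rho> z)"
  have "lmul (twist L \<sigma>') (\<phi> m) (\<phi> n) = tfold (model_cop m)
      (\<lambda>p r. tfold (model_cop r) (\<lambda>q s. ?X p q s))"
    unfolding twist_def
  proof (simp, rule triv.csw3_eval)
    show "(\<Sum>(x', y', z')\<leftarrow>csw3 L (\<phi> n). lmul L (src L (\<sigma>' (\<phi> p) x'))
        (lmul L (tgt L (conv_inv L \<sigma>' (\<phi> s) z')) (lmul L (\<phi> q) y'))) = ?X p q s" for p q s
      by (rule triv.csw3_cong) (rule K)
  qed (simp_all add: split_def K1)
  also have "\<dots> = (\<Sum>(x, y, z)\<leftarrow>csw3 L (\<phi> n). tfold (model_cop m)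
      (\<lambda>p r. tfold (model_cop r) (\<lambda>q s. K p q s (\<rho> x) (\<rho> y) (\<rho> z))))"
    by (simp only: split_def tfold_sum_list)
  also have "\<dots> = tfold (model_cop n) (\<lambda>p' r'. tfold (model_cop r')
      (\<lambda>q' s'. tfold (model_cop m) (\<lambda>p r. tfold (model_cop r) (\<lambda>q s. K p q s p' q' s'))))"
    by (rule triv.csw3_eval) (simp_all add: K2 K3)
  also have "\<dots> = \<phi> (model_mult m n)"
  proof (rule tensor3_ext2[of "\<lambda>m n. tfold (model_cop n)
      (\<lambda>p' r'. tfold (model_cop r')
      (\<lambda>q' s'. tfold (model_cop m) (\<lambda>p r. tfold (model_cop r) (\<lambda>q s. K p q s p' q' s'))))" "\<lambda>m n. \<phi>
      (model_mult m n)"])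
    fix b b' h c c' k
    show "tfold (model_cop (c \<otimes> c' \<otimes> k)) (\<lambda>p' r'. tfold (model_cop r')
        (\<lambda>q' s'. tfold (model_cop (b \<otimes> b' \<otimes> h))
        (\<lambda>p r. tfold (model_cop r) (\<lambda>q s. K p q s p' q' s'))))
        = \<phi> (model_mult (b \<otimes> b' \<otimes> h) (c \<otimes> c' \<otimes> k))"
      by (simp add: model_cop_tensor tfold_tfold K_def triv_model_mult pairing_sigma_mult
          model_mult_tensor sigma_mult_left tfold_push[of \<phi>, OF triv.clinear_phi])
        (simp add: tag_start[of h _ 0] tag_start[of k _ 1] sweedler)
  qed simp_all
  finally show ?thesis .
qed

text \<open>As \<open>\<sigma>\<close> is normalised, left multiplication by source and target is
  the same before and after twisting. Hence the balancing relations coincide, and so do the cosets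
  in which the coproduct takes its values.\<close>

lemma twist_modelled: "modelled \<Delta> \<epsilon> S \<sigma> \<sigma>i (twist L \<sigma>') \<phi> \<rho>"
proof (intro modelled.intro modelled_axioms.intro central_cocycle_axioms)
  have eqs: "lcar (twist L \<sigma>') = lcar L" "lone (twist L \<sigma>') = lone L" "leta (twist L \<sigma>') = leta L"
    "lcop (twist L \<sigma>') = lcop L" "lcou (twist L \<sigma>') = lcou L"
    by (simp_all add: twist_def)
  have st: "src (twist L \<sigma>') = src L" "tgt (twist L \<sigma>') = tgt L"
    by (simp_all add: fun_eq_iff src_def tgt_def eqs)
  have st': "lmul (twist L \<sigma>') (src L \<beta>) (\<phi> m)
      = lmul L (src L \<beta>) (\<phi> m)" "lmul (twist L \<sigma>') (tgt L \<beta>) (\<phi> m) = lmul L (tgt L \<beta>) (\<phi> m)" for \<beta> m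
    unfolding triv.lmul_src triv.lmul_tgt by (simp_all add: triv.src_eq triv.tgt_eq lmul_twist
        model_mult_src model_mult_tgt)
  have "{lmul (twist L \<sigma>') (tgt L b) x \<otimes> y - x \<otimes> lmul (twist L \<sigma>') (src L b) y | x y b. x \<in> range \<phi>
      \<and> y \<in> range \<phi>}
    = {lmul L (tgt L b) x \<otimes> y - x \<otimes> lmul L (src L b) y | x y b. x \<in> range \<phi> \<and> y \<in> range \<phi>}"
    by (metis (no_types, opaque_lifting) rangeE st')
  then have bal: "bal (twist L \<sigma>') = bal L"
    by (simp add: bal_def st eqs triv.lcar_eq)
  show "lcop (twist L \<sigma>') (\<phi> m) = coset (bal (twist L \<sigma>')) (map_tensor \<phi> (model_cop m))" for m
    by (simp add: bal eqs triv.lcop_eq)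
  show "clinear \<phi>" "clinear \<rho>" by (rule triv.clinear_phi triv.clinear_rho)+
  show "lmul (twist L \<sigma>') (\<phi> m) (\<phi> n) = \<phi> (model_mult m n)" for m n by (rule lmul_twist)
qed (simp_all add: twist_def triv.lcar_eq triv.lone_eq triv.leta_eq triv.lcou_eq)

end

section \<open>The isomorphism\<close>

context crossed_system
begin

lemma crossed_central_cocycle:
  assumes central: "\<And>h k b. \<sigma> h k * b = b * \<sigma> h k" and trivial: "\<And>h b. act h b = \<epsilon> h *\<^sub>C b"
  shows "central_cocycle \<Delta> \<epsilon> S \<sigma> \<sigma>i"
proof (intro central_cocycle.intro central_cocycle_axioms.intro hopf_algebra_axioms sigma_bilinear
    sigma_inv_bilinear)
  fix h k m
  note [simp] = clinear_bilinear_left[OF sigma_bilinear] clinear_bilinear_right[OF sigma_bilinear]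
  show "sw k (\<lambda>k1 k2. sw m (\<lambda>m1 m2. \<sigma> k1 m1 * \<sigma> h (k2 * m2)))
      = sw h (\<lambda>h1 h2. sw k (\<lambda>k1 k2. \<sigma> h1 k1 * \<sigma> (h2 * k2) m))"
    using sigma_cocycle[where h = h and k = k and m = m]
    by (simp add: sw2_eq trivial scaleC_out tfold_scale counits)
qed (use sigma_inv_right sigma_inv_left in \<open>simp_all add: sw2_eq central sigma_one_right
    sigma_one_left\<close>)

lemma smash_product_eq:
  assumes trivial: "\<And>h b. act h b = \<epsilon> h *\<^sub>C b"
  shows "smash_product \<Delta> act = central_cocycle.crossed_ext \<Delta> triv"
proof -
  interpret triv: central_cocycle \<Delta> \<epsilon> S "triv :: 'h \<Rightarrow> 'h \<Rightarrow> 'b" triv by (rule triv_central_cocycle)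
  have "triv.sigma_mult h k b = \<epsilon> h *\<^sub>C \<epsilon> k *\<^sub>C b" for h k b
    by (simp add: triv.sigma_mult_def triv_def scaleC_out counit_simps)
  then show ?thesis
    by (simp add: smash_product_def triv.crossed_ext_def fun_eq_iff sum_list_simple sw2_eq trivial
        triv.crossed_mult_def scaleC_out tfold_scale counits)
qed

lemma crossed_product_eq:
  assumes central: "\<And>h k b. \<sigma> h k * b = b * \<sigma> h k" and trivial: "\<And>h b. act h b = \<epsilon> h *\<^sub>C b"
  shows "crossed_product \<Delta> act \<sigma> = central_cocycle.crossed_ext \<Delta> \<sigma>"
proof -
  interpret central_cocycle \<Delta> \<epsilon> S \<sigma> \<sigma>i by (rule crossed_central_cocycle[OF assms])
  show ?thesis
    by (simp add: crossed_product_def crossed_ext_def fun_eq_iff sum_list_simple sw2_eq sw3_eq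
        trivial crossed_mult_def scaleC_out tfold_scale counits sigma_mult_def central)
qed

end

theorem theorem3p5:
  fixes \<Delta> :: "'h::complex_algebra \<Rightarrow> 'h \<otimes> 'h"
    and \<epsilon> :: "'h \<Rightarrow> complex"
    and S :: "'h \<Rightarrow> 'h"
    and act :: "'h \<Rightarrow> 'b::complex_algebra \<Rightarrow> 'b"
    and \<sigma> \<sigma>i :: "'h \<Rightarrow> 'h \<Rightarrow> 'b"
  assumes crossed: "crossed_system \<Delta> \<epsilon> S act \<sigma> \<sigma>i"
    and central: "\<And>h k b. \<sigma> h k * b = b * \<sigma> h k"
    and trivial: "\<And>h b. act h b = \<epsilon> h *\<^sub>C b"
  shows "\<exists>\<sigma>' \<phi>.
    invertible_normalised_cocycle (es_bialgebroid (smash_product \<Delta> act)) \<sigma>' \<and>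
    bialgebroid_isomorphism (twist (es_bialgebroid (smash_product \<Delta> act)) \<sigma>')
      (es_bialgebroid (crossed_product \<Delta> act \<sigma>)) \<phi> \<and>
    (\<forall>b b' c c' h g.
      \<sigma>' (\<Sum>(h1, h2)\<leftarrow>sw2 \<Delta> h. (b \<otimes> h1) \<otimes> (b' \<otimes> S h2))
         (\<Sum>(g1, g2)\<leftarrow>sw2 \<Delta> g. (c \<otimes> g1) \<otimes> (c' \<otimes> S g2))
      = (\<Sum>(h1, h2, h3, h4)\<leftarrow>sw4 \<Delta> h. \<Sum>(g1, g2)\<leftarrow>sw2 \<Delta> g.
          b * act h1 c * \<sigma> h2 g1 * act (h3 * g2) c' * act h4 b')) \<and>
    (\<forall>b b' h.
      \<phi> (\<Sum>(h1, h2)\<leftarrow>sw2 \<Delta> h. (b \<otimes> h1) \<otimes> (b' \<otimes> S h2))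
      = (\<Sum>(h1, h2, h3, h4)\<leftarrow>sw4 \<Delta> h. (b \<otimes> h1) \<otimes> ((b' * \<sigma>i (S h3) h4) \<otimes> S h2)))"
proof -
  interpret crossed_system \<Delta> \<epsilon> S act \<sigma> \<sigma>i by (rule crossed)
  interpret cc: central_cocycle \<Delta> \<epsilon> S \<sigma> \<sigma>i by (rule crossed_central_cocycle[OF central trivial])
  interpret t: central_cocycle \<Delta> \<epsilon> S "triv :: 'h \<Rightarrow> 'h \<Rightarrow> 'b" triv by (rule triv_central_cocycle)
  let ?L = "es_bialgebroid t.crossed_ext"
  interpret tw: cocycle_twist \<Delta> \<epsilon> S \<sigma> \<sigma>i ?L t.\<Phi> t.Phi_inv
    by (intro cocycle_twist.intro cc.central_cocycle_axioms t.es_modelled)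
  \<comment> \<open>For the trivial cocycle the inverse of the cleaving map is the antipode, so
    these generators are the images of simple tensors of the model.\<close>
  have gen: "(\<Sum>(h1, h2)\<leftarrow>sw2 \<Delta> h. (b \<otimes> h1) \<otimes> (b' \<otimes> S h2)) = t.\<Phi> (b \<otimes> b' \<otimes> h)" for b b' h
    by (simp add: sw2_eq t.Phi_tensor t.cleft_inv_def tw.triv_sigma_mult scaleC_out tfold_scale
        counits)
  have 1: "pairing \<sigma> (b \<otimes> b' \<otimes> h) (c \<otimes> c' \<otimes> g) = (\<Sum>(h1, h2, h3, h4)\<leftarrow>sw4 \<Delta> h. \<Sum>(g1, g2)\<leftarrow>sw2 \<Delta> g.
          b * act h1 c * \<sigma> h2 g1 * act (h3 * g2) c' * act h4 b')" for b b' h c c' g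
    by (simp add: sw4_eq sw2_eq trivial pairing_tensor sigma_bilinear scaleC_out counit_simps
        tfold_scale counits mult.assoc)
  have 2: "cc.\<Phi> (b \<otimes> b' \<otimes> h) = (\<Sum>(h1, h2, h3, h4)\<leftarrow>sw4 \<Delta> h. (b \<otimes> h1) \<otimes>
      ((b' * \<sigma>i (S h3) h4) \<otimes> S h2))" for b b' h
    by (simp add: sw4_eq cc.Phi_tensor cc.cleft_inv_def cc.sigma_inv_mult_def cc.sigma_inv_central
        tensor_nf)
  show ?thesis
    unfolding smash_product_eq[OF trivial] crossed_product_eq[OF central trivial]
    using tw.is_cocycle modelled_isomorphism[OF tw.twist_modelled cc.es_modelled]
    by (intro exI[of _ tw.\<sigma>'] exI[of _ "\<lambda>x. cc.\<Phi> (t.Phi_inv x)"]) (simp add: gen tw.sigma'_phi 1 2)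
qed

end
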